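(* Non-generic non-negative forms in $\partial\mathcal{C}_{d,n}$ form a semialgebraic subset of $\mathcal{H}_{d,n}$ of codimension at least $2$. Moreover, this set is nowhere dense in $\partial\mathcal{C}_{d,n}\subset\mathcal{H}_{d,n}$, endowed with the topology induced from $\mathcal{H}_{d,n}$.
   Context: $n$ is a positive integer and $d\ge 2$ is even. $\mathcal{H}_{d,n}$ is the finite-dimensional space of real $n$-variate forms (homogeneous polynomials) of degree $d$, with its norm topology (e.g. from the Bombieri inner product $\langle g,h\rangle=\sum_{|\alpha|=d}\binom{d}{\alpha}^{-1}g_\alpha h_\alpha$). $\mathcal{C}_{d,n}\subset\mathcal{H}_{d,n}$ is the open convex cone of forms strictly positive on $\mathbb{R}^n\setminus\{\mathbf{0}\}$; its closure $\overline{\mathcal{C}_{d,n}}$ is the cone of forms non-negative on $\mathbb{R}^n$, and $\partial\mathcal{C}_{d,n}=\overline{\mathcal{C}_{d,n}}\setminus\mathcal{C}_{d,n}$. A non-negative form $g\in\overline{\mathcal{C}_{d,n}}$ is called generic if at every real zero $\mathbf{x}\in\mathbb{R}^n\setminus\{\mathbf{0}\}$ of $g$ the Hessian matrix $\mathrm{Hess}_{\mathbf{x}}g=\left(\frac{\partial^2g}{\partial x_i\partial x_j}(\mathbf{x})\right)$ is positive definite when restricted to the orthogonal complement of $\mathbf{x}$ (equivalently, $\mathrm{Hess}_{\mathbf{x}}g$ is of corank one); otherwise it is non-generic. *)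

theory Defs
  imports
    "HOL-Analysis.Analysis"
    "HOL-Algebra.QuotRing"
    "HOL-Library.Poly_Mapping"
begin

section \<open>Real polynomials in a family of variables\<close>

text \<open>A polynomial is a finitely supported map from exponents to coefficients; the product of the
  type class instance in \<^theory>\<open>HOL-Library.Poly_Mapping\<close> is the usual product of polynomials.\<close>

type_synonym 'v rpoly = "('v \<Rightarrow>\<^sub>0 nat) \<Rightarrow>\<^sub>0 real"

definition rpoly_eval :: "'v rpoly \<Rightarrow> ('v \<Rightarrow> real) \<Rightarrow> real" where
  "rpoly_eval p x =
     (\<Sum>m\<in>Poly_Mapping.keys p. Poly_Mapping.lookup p m *
        (\<Prod>i\<in>Poly_Mapping.keys m. x i ^ Poly_Mapping.lookup m i))"

definition rpoly_ring :: "'v set \<Rightarrow> 'v rpoly ring" where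
  "rpoly_ring I =
     \<lparr>carrier = {p. \<forall>m\<in>Poly_Mapping.keys p. Poly_Mapping.keys m \<subseteq> I},
      mult = (*), one = 1, zero = 0, add = (+)\<rparr>"

section \<open>Semialgebraic sets and their dimension\<close>

text \<open>For a finite index set \<open>I\<close>, the coordinate space \<open>\<real>\<^sup>I\<close> consists of the functions vanishing
  outside \<open>I\<close>.\<close>

definition coord_space :: "'v set \<Rightarrow> ('v \<Rightarrow> real) set" where
  "coord_space I = {x. \<forall>i. i \<notin> I \<longrightarrow> x i = 0}"

definition semialgebraic :: "'v set \<Rightarrow> ('v \<Rightarrow> real) set \<Rightarrow> bool" where
  "semialgebraic I S \<longleftrightarrow>
     (\<exists>F :: ('v rpoly set \<times> 'v rpoly set) set. finite F \<and>
        (\<forall>(E, P)\<in>F. finite E \<and> finite P \<and>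
           E \<subseteq> carrier (rpoly_ring I) \<and> P \<subseteq> carrier (rpoly_ring I)) \<and>
        S = (\<Union>(E, P)\<in>F. {x \<in> coord_space I.
               (\<forall>p\<in>E. rpoly_eval p x = 0) \<and> (\<forall>q\<in>P. rpoly_eval q x > 0)}))"

definition vanishing_ideal :: "'v set \<Rightarrow> ('v \<Rightarrow> real) set \<Rightarrow> 'v rpoly set" where
  "vanishing_ideal I S = {p \<in> carrier (rpoly_ring I). \<forall>x\<in>S. rpoly_eval p x = 0}"

text \<open>The supremum of the lengths \<open>k\<close> of chains \<open>P\<^sub>0 \<subset> \<dots> \<subset> P\<^sub>k\<close> of prime ideals; it is
  \<open>-\<infinity>\<close> for the zero ring.\<close>

definition krull_dim :: "('a, 'b) ring_scheme \<Rightarrow> ereal" where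
  "krull_dim R = Sup {ereal (real k) |k.
     \<exists>P. (\<forall>i\<le>k. primeideal (P i) R) \<and> (\<forall>i<k. P i \<subset> P (Suc i))}"

text \<open>The dimension of a semialgebraic set is the Krull dimension of its ring of polynomial
  functions \<open>\<real>[X]/\<I>(S)\<close> (Bochnak, Coste and Roy, Real Algebraic Geometry, 2.8.1).\<close>

definition semialg_dim :: "'v set \<Rightarrow> ('v \<Rightarrow> real) set \<Rightarrow> ereal" where
  "semialg_dim I S = krull_dim (rpoly_ring I Quot vanishing_ideal I S)"

definition semialg_codim :: "'v set \<Rightarrow> ('v \<Rightarrow> real) set \<Rightarrow> ereal" where
  "semialg_codim I S = ereal (real (card I)) - semialg_dim I S"

section \<open>Forms\<close>

definition exponents :: "nat \<Rightarrow> ('n::finite \<Rightarrow>\<^sub>0 nat) set" where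
  "exponents d = {\<alpha>. (\<Sum>i\<in>UNIV. Poly_Mapping.lookup \<alpha> i) = d}"

definition forms :: "nat \<Rightarrow> 'n::finite rpoly set" where
  "forms d = {g. Poly_Mapping.keys g \<subseteq> exponents d}"

definition form_fun :: "'n::finite rpoly \<Rightarrow> real ^ 'n \<Rightarrow> real" where
  "form_fun g x = rpoly_eval g (\<lambda>i. x $ i)"

text \<open>The coordinates of a form, indexed by \<^term>\<open>exponents d\<close>, are its coefficients.\<close>

definition form_coeffs :: "'n::finite rpoly \<Rightarrow> ('n \<Rightarrow>\<^sub>0 nat) \<Rightarrow> real" where
  "form_coeffs g = Poly_Mapping.lookup g"

definition multinomial :: "nat \<Rightarrow> ('n::finite \<Rightarrow>\<^sub>0 nat) \<Rightarrow> real" where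
  "multinomial d \<alpha> = fact d / (\<Prod>i\<in>UNIV. fact (Poly_Mapping.lookup \<alpha> i))"

definition bombieri :: "nat \<Rightarrow> 'n::finite rpoly \<Rightarrow> 'n rpoly \<Rightarrow> real" where
  "bombieri d g h = (\<Sum>\<alpha>\<in>exponents d. inverse (multinomial d \<alpha>) * form_coeffs g \<alpha> * form_coeffs h \<alpha>)"

definition form_dist :: "nat \<Rightarrow> 'n::finite rpoly \<Rightarrow> 'n rpoly \<Rightarrow> real" where
  "form_dist d g h = sqrt (bombieri d (g - h) (g - h))"

definition form_topology :: "nat \<Rightarrow> 'n::finite rpoly topology" where
  "form_topology d = Metric_space.mtopology (forms d) (form_dist d)"

section \<open>The cone of positive forms and its boundary\<close>

definition pos_cone :: "nat \<Rightarrow> 'n::finite rpoly set" where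
  "pos_cone d = {g \<in> forms d. \<forall>x. x \<noteq> 0 \<longrightarrow> form_fun g x > 0}"

definition pos_cone_boundary :: "nat \<Rightarrow> 'n::finite rpoly set" where
  "pos_cone_boundary d = (form_topology d closure_of pos_cone d) - pos_cone d"

definition partial_deriv :: "'n::finite \<Rightarrow> (real ^ 'n \<Rightarrow> real) \<Rightarrow> real ^ 'n \<Rightarrow> real" where
  "partial_deriv i f x = deriv (\<lambda>t. f (x + t *\<^sub>R axis i 1)) 0"

definition hessian :: "(real ^ 'n::finite \<Rightarrow> real) \<Rightarrow> real ^ 'n \<Rightarrow> real ^ 'n ^ 'n" where
  "hessian f x = (\<chi> i j. partial_deriv i (partial_deriv j f) x)"

definition generic :: "'n::finite rpoly \<Rightarrow> bool" where
  "generic g \<longleftrightarrow>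
     (\<forall>x. x \<noteq> 0 \<and> form_fun g x = 0 \<longrightarrow>
        (\<forall>v. v \<bullet> x = 0 \<and> v \<noteq> 0 \<longrightarrow> v \<bullet> (hessian (form_fun g) x *v v) > 0))"

definition nongeneric_boundary :: "nat \<Rightarrow> 'n::finite rpoly set" where
  "nongeneric_boundary d = {g \<in> pos_cone_boundary d. \<not> generic g}"

definition nowhere_dense_in :: "'a topology \<Rightarrow> 'a set \<Rightarrow> bool" where
  "nowhere_dense_in T S \<longleftrightarrow> S \<subseteq> topspace T \<and> T interior_of (T closure_of S) = {}"

section \<open>Well-definedness\<close>

text \<open>\<^term>\<open>form_topology\<close> is only meaningful if \<^term>\<open>form_dist\<close> is a metric on \<^term>\<open>forms\<close>, and
  \<^term>\<open>semialg_dim\<close> only if the quotient is a commutative ring (\<^const>\<open>primeideal\<close> requires this, so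
  otherwise there would be no prime ideals at all).\<close>

lemma finite_exponents: "finite (exponents d :: ('n::finite \<Rightarrow>\<^sub>0 nat) set)"
proof -
  have "Poly_Mapping.lookup ` (exponents d :: ('n \<Rightarrow>\<^sub>0 nat) set) \<subseteq> (UNIV :: 'n set) \<rightarrow>\<^sub>E {..d}"
    by (auto simp: exponents_def intro: member_le_sum)
  moreover have "finite ((UNIV :: 'n set) \<rightarrow>\<^sub>E {..d})"
    by (intro finite_PiE) auto
  ultimately have "finite (Poly_Mapping.lookup ` (exponents d :: ('n \<Rightarrow>\<^sub>0 nat) set))"
    by (rule finite_subset)
  then show ?thesis
    by (rule finite_imageD) (auto simp: inj_on_def Poly_Mapping.lookup_inject)
qed

lemma form_dist_eq:
  "form_dist d g h =
     L2_set (\<lambda>\<alpha>. sqrt (inverse (multinomial d \<alpha>)) * (form_coeffs g \<alpha> - form_coeffs h \<alpha>)) (exponents d)"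
proof -
  have nonneg: "inverse (multinomial d \<alpha>) \<ge> 0" for \<alpha> :: "'a \<Rightarrow>\<^sub>0 nat"
    by (auto simp: multinomial_def intro!: divide_nonneg_nonneg prod_nonneg)
  show ?thesis
    unfolding form_dist_def bombieri_def L2_set_def power_mult_distrib
      real_sqrt_pow2[OF nonneg] form_coeffs_def lookup_minus
    by (simp only: power2_eq_square mult.assoc)
qed

lemma Metric_space_forms: "Metric_space (forms d) (form_dist d)"
proof
  fix g h :: "'a rpoly"
  show "0 \<le> form_dist d g h"
    by (simp add: form_dist_eq)
  show "form_dist d g h = form_dist d h g"
    unfolding form_dist_eq L2_set_def
    by (simp add: power_mult_distrib power2_commute)
next
  fix g h :: "'a rpoly"
  assume gh: "g \<in> forms d" "h \<in> forms d"
  have nz: "multinomial d \<alpha> \<noteq> 0" for \<alpha> :: "'a \<Rightarrow>\<^sub>0 nat"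
    by (simp add: multinomial_def)
  have "form_dist d g h = 0 \<longleftrightarrow> (\<forall>\<alpha>\<in>exponents d. form_coeffs g \<alpha> = form_coeffs h \<alpha>)"
    by (simp add: form_dist_eq L2_set_eq_0_iff finite_exponents nz)
  also have "\<dots> \<longleftrightarrow> (\<forall>\<alpha>. form_coeffs g \<alpha> = form_coeffs h \<alpha>)"
  proof -
    have zero: "form_coeffs f \<alpha> = 0" if "f \<in> forms d" "\<alpha> \<notin> exponents d" for f :: "'a rpoly" and \<alpha>
    proof -
      have "\<alpha> \<notin> Poly_Mapping.keys f"
        using that unfolding forms_def by blast
      then show ?thesis
        by (simp add: in_keys_iff form_coeffs_def)
    qed
    have "form_coeffs g \<alpha> = form_coeffs h \<alpha>" if "\<alpha> \<notin> exponents d" for \<alpha>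
      by (simp only: zero[OF gh(1) that] zero[OF gh(2) that])
    then show ?thesis
      by blast
  qed
  also have "\<dots> \<longleftrightarrow> g = h"
    by (auto simp: form_coeffs_def intro: poly_mapping_eqI)
  finally show "form_dist d g h = 0 \<longleftrightarrow> g = h" .
next
  fix f g h :: "'a rpoly"
  show "form_dist d f h \<le> form_dist d f g + form_dist d g h"
    unfolding form_dist_eq
    by (rule order_trans[OF _ L2_set_triangle_ineq]) (simp add: algebra_simps)
qed

lemma cring_rpoly_ring: "cring (rpoly_ring (I :: 'v set))"
proof (rule cringI)
  show "abelian_group (rpoly_ring I)"
  proof (rule abelian_groupI)
    fix p assume p: "p \<in> carrier (rpoly_ring I)"
    show "\<exists>q\<in>carrier (rpoly_ring I). q \<oplus>\<^bsub>rpoly_ring I\<^esub> p = \<zero>\<^bsub>rpoly_ring I\<^esub>"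
      using p by (intro bexI[of _ "- p"]) (auto simp: rpoly_ring_def)
  next
    fix p q assume "p \<in> carrier (rpoly_ring I)" "q \<in> carrier (rpoly_ring I)"
    then show "p \<oplus>\<^bsub>rpoly_ring I\<^esub> q \<in> carrier (rpoly_ring I)"
      using Poly_Mapping.keys_add[of p q] by (fastforce simp: rpoly_ring_def)
  qed (auto simp: rpoly_ring_def algebra_simps)
  show "Group.comm_monoid (rpoly_ring I)"
  proof (rule comm_monoidI)
    fix p q assume pq: "p \<in> carrier (rpoly_ring I)" "q \<in> carrier (rpoly_ring I)"
    show "p \<otimes>\<^bsub>rpoly_ring I\<^esub> q \<in> carrier (rpoly_ring I)"
    proof -
      have "Poly_Mapping.keys m \<subseteq> I" if m: "m \<in> Poly_Mapping.keys (p * q)" for m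
      proof -
        obtain a b where "m = a + b" "a \<in> Poly_Mapping.keys p" "b \<in> Poly_Mapping.keys q"
          using m Poly_Mapping.keys_mult[of p q] by blast
        then show ?thesis
          using pq Poly_Mapping.keys_add[of a b] by (fastforce simp: rpoly_ring_def)
      qed
      then show ?thesis by (auto simp: rpoly_ring_def)
    qed
  qed (auto simp: rpoly_ring_def algebra_simps)
qed (auto simp: rpoly_ring_def algebra_simps)

lemma rpoly_eval_superset:
  assumes "finite A" "Poly_Mapping.keys p \<subseteq> A"
  shows "rpoly_eval p x =
    (\<Sum>m\<in>A. Poly_Mapping.lookup p m * (\<Prod>i\<in>Poly_Mapping.keys m. x i ^ Poly_Mapping.lookup m i))"
  unfolding rpoly_eval_def
  by (rule sum.mono_neutral_left) (use assms in \<open>auto simp: in_keys_iff\<close>)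

lemma rpoly_eval_add: "rpoly_eval (p + q) x = rpoly_eval p x + rpoly_eval q x"
proof -
  let ?A = "Poly_Mapping.keys p \<union> Poly_Mapping.keys q"
  have "Poly_Mapping.keys (p + q) \<subseteq> ?A"
    by (rule Poly_Mapping.keys_add)
  then show ?thesis
    by (simp add: rpoly_eval_superset[of ?A] lookup_add distrib_right sum.distrib)
qed

lemma rpoly_eval_single:
  "rpoly_eval (Poly_Mapping.single m c) x =
     c * (\<Prod>i\<in>Poly_Mapping.keys m. x i ^ Poly_Mapping.lookup m i)"
  by (subst rpoly_eval_superset[of "{m}"]) auto

lemma monomial_eval_add:
  fixes x :: "'v \<Rightarrow> real"
  shows "(\<Prod>i\<in>Poly_Mapping.keys (a + b). x i ^ Poly_Mapping.lookup (a + b) i) =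
    (\<Prod>i\<in>Poly_Mapping.keys a. x i ^ Poly_Mapping.lookup a i) *
    (\<Prod>i\<in>Poly_Mapping.keys b. x i ^ Poly_Mapping.lookup b i)"
proof -
  let ?A = "Poly_Mapping.keys a \<union> Poly_Mapping.keys b"
  have *: "(\<Prod>i\<in>Poly_Mapping.keys m. x i ^ Poly_Mapping.lookup m i) =
      (\<Prod>i\<in>?A. x i ^ Poly_Mapping.lookup m i)" if "Poly_Mapping.keys m \<subseteq> ?A" for m
    by (rule prod.mono_neutral_left) (use that in \<open>auto simp: in_keys_iff\<close>)
  show ?thesis
    unfolding *[OF Poly_Mapping.keys_add] *[OF Un_upper1] *[OF Un_upper2]
    by (simp add: lookup_add power_add prod.distrib)
qed

lemma rpoly_eval_sum: "rpoly_eval (sum f A) x = (\<Sum>a\<in>A. rpoly_eval (f a) x)"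
  by (induction A rule: infinite_finite_induct)
     (auto simp: rpoly_eval_add, auto simp: rpoly_eval_def)

lemma rpoly_sum_single:
  fixes p :: "'v rpoly"
  shows "p = (\<Sum>m\<in>Poly_Mapping.keys p. Poly_Mapping.single m (Poly_Mapping.lookup p m))"
  by (rule poly_mapping_eqI)
     (auto simp: lookup_sum lookup_single when_def in_keys_iff sum.delta)

lemma rpoly_eval_mult: "rpoly_eval (p * q) x = rpoly_eval p x * rpoly_eval q x"
proof -
  have "rpoly_eval (p * q) x =
      rpoly_eval ((\<Sum>m\<in>Poly_Mapping.keys p. Poly_Mapping.single m (Poly_Mapping.lookup p m)) *
        (\<Sum>m\<in>Poly_Mapping.keys q. Poly_Mapping.single m (Poly_Mapping.lookup q m))) x"
    by (simp flip: rpoly_sum_single)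
  also have "\<dots> = rpoly_eval p x * rpoly_eval q x"
    unfolding sum_product rpoly_eval_sum mult_single rpoly_eval_single monomial_eval_add
    by (simp add: rpoly_eval_def sum_product mult_ac)
  finally show ?thesis .
qed

lemma ideal_vanishing_ideal: "ideal (vanishing_ideal I S) (rpoly_ring I)"
proof -
  interpret cring "rpoly_ring I" by (rule cring_rpoly_ring)
  have minus: "\<ominus>\<^bsub>rpoly_ring I\<^esub> p = - p" if "p \<in> carrier (rpoly_ring I)" for p
    by (rule minus_equality) (use that in \<open>auto simp: rpoly_ring_def\<close>)
  have eval_minus: "rpoly_eval (- p) x = - rpoly_eval p x" for p :: "'a rpoly" and x
    by (simp add: rpoly_eval_def sum_negf)
  show ?thesis
  proof (rule idealI[OF ring_axioms])
    show "subgroup (vanishing_ideal I S) (add_monoid (rpoly_ring I))"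
    proof (rule add.subgroupI)
      show "vanishing_ideal I S \<noteq> {}"
        by (auto simp: vanishing_ideal_def rpoly_ring_def rpoly_eval_def intro!: exI[of _ 0])
    next
      fix p assume "p \<in> vanishing_ideal I S"
      then show "\<ominus>\<^bsub>rpoly_ring I\<^esub> p \<in> vanishing_ideal I S"
        by (auto simp: vanishing_ideal_def minus eval_minus) (simp add: rpoly_ring_def)
    next
      fix p q assume "p \<in> vanishing_ideal I S" "q \<in> vanishing_ideal I S"
      then show "p \<oplus>\<^bsub>rpoly_ring I\<^esub> q \<in> vanishing_ideal I S"
        using add.m_closed[of p q]
        by (auto simp: vanishing_ideal_def rpoly_ring_def rpoly_eval_add)
    qed (auto simp: vanishing_ideal_def)
  next
    fix p q assume "p \<in> vanishing_ideal I S" "q \<in> carrier (rpoly_ring I)"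
    then show "q \<otimes>\<^bsub>rpoly_ring I\<^esub> p \<in> vanishing_ideal I S"
      and "p \<otimes>\<^bsub>rpoly_ring I\<^esub> q \<in> vanishing_ideal I S"
      using m_closed[of p q] m_closed[of q p]
      by (auto simp: vanishing_ideal_def rpoly_ring_def rpoly_eval_mult)
  qed
qed

lemma cring_polynomial_functions: "cring (rpoly_ring I Quot vanishing_ideal I S)"
  by (rule ideal.quotient_is_cring[OF ideal_vanishing_ideal cring_rpoly_ring])

end

theory Submission
  imports Defs
begin

text \<open>Semialgebraicity is the Tarski--Seidenberg theorem, in a form without formulas: if two parameter
  points give the same sign to enough polynomial functions, then some increasing bijection of the
  line matches the signs of the two specialised families of univariate polynomials.

  For a non-generic \<open>g\<close> with a degenerate zero \<open>x\<close> in the direction \<open>v\<close>, a linear change of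
  coordinates with \<open>x = e\<^sub>i\<close>, \<open>v = e\<^sub>j\<close> kills the coefficients of \<open>X\<^sub>i\<^sup>d\<close>,
  \<open>X\<^sub>i\<^bsup>d-1\<^esup>X\<^sub>k\<close> and \<open>X\<^sub>i\<^bsup>d-2\<^esup>X\<^sub>jX\<^sub>k\<close>. Normalising \<open>x\<close> and \<open>v\<close> leaves two parameters fewer than
  the dimension \<open>N\<close> of the space of forms, so finitely many polynomial charts in \<open>N - 2\<close> variables
  cover the set. By counting monomials any \<open>N - 1\<close> polynomials are algebraically dependent on it,
  whereas a chain of prime ideals of length \<open>N - 1\<close> would provide independent ones.

  The non-generic forms are closed in the boundary, and adding a small multiple of
  \<open>(|y|\<^sup>2|x|\<^sup>2 - (x \<bullet> y)\<^sup>2)|y|\<^bsup>d-2\<^esup>\<close> makes a boundary form with zero \<open>x\<close> generic.\<close>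

section \<open>The Tarski--Seidenberg theorem\<close>

text \<open>The codimension comes from a count. With n variables and N monomials of degree d, the
  normalised x and v have (n-1) + (n-2) free entries, while at least 2n-1 coefficients are killed:
  one for X_i^d, n-1 for X_i^(d-1) X_k and n-1 for X_i^(d-2) X_j X_k. The last family is where
  nonnegativity is essential: the Hessian at a zero is semidefinite, so a degenerate direction lies
  in its radical, and one inequality turns into n-1 linear equations. Since the dimension is a Krull
  dimension, the charts only have to cover the set: they may overlap and may also produce forms
  outside it. The elimination follows the idea of Cohen and Hoermander: a finite family of
  polynomials with parameters is closed under derivative, pseudo-remainder and removal of the formal
  leading term. The last operation lets the signs of the coefficients decide the true degrees, so
  the parameter space need not be split according to vanishing leading coefficients.\<close>

lemma strict_mono_on_finite_extension:
  fixes f :: "real \<Rightarrow> real"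
  assumes "finite W" "strict_mono_on W f"
  shows "\<exists>\<psi>. strict_mono \<psi> \<and> surj \<psi> \<and> (\<forall>w\<in>W. \<psi> w = f w)"
  using assms
proof (induction W rule: finite_linorder_max_induct)
  case empty
  show ?case by (intro exI[of _ "\<lambda>t. t"]) (auto simp: strict_mono_def)
next
  case (insert b A)
  show ?case
  proof (cases "A = {}")
    case True
    then show ?thesis
      by (intro exI[of _ "\<lambda>t. t + (f b - b)"])
        (auto simp: strict_mono_def surj_def intro: exI[of _ "y - (f b - b)" for y])
  next
    case False
    have "strict_mono_on A f"
      using insert.prems by (auto simp: strict_mono_on_def)
    then obtain \<psi> where \<psi>: "strict_mono \<psi>" "surj \<psi>" "\<And>w. w \<in> A \<Longrightarrow> \<psi> w = f w"
      using insert.IH by blast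
    define m where "m = Max A"
    have m: "m \<in> A" "\<And>a. a \<in> A \<Longrightarrow> a \<le> m"
      using insert.hyps False by (auto simp: m_def)
    have mb: "m < b" using insert.hyps m by auto
    then have fmb: "f m < f b"
      using insert.prems m by (auto simp: strict_mono_on_def)
    \<comment> \<open>The slope of the ray through (m, f m) and (b, f b). The ray replaces
      \<open>\<psi>\<close> to the right of m; being unbounded, it keeps the map onto.\<close>
    define k where "k = (f b - f m) / (b - m)"
    have k: "k > 0" using mb fmb by (simp add: k_def)
    define g where "g t = (if t \<le> m then \<psi> t else f m + k * (t - m))" for t
    have "strict_mono g"
    proof (rule strict_monoI)
      fix s t :: real assume st: "s < t"
      have "\<psi> s \<le> f m" if "s \<le> m"
        using \<psi>(1) \<psi>(3)[OF m(1)] that by (metis strict_mono_less_eq)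
      moreover have "k * (s - m) < k * (t - m)" using k st by simp
      moreover have "0 < k * (t - m)" if "t > m" using k that by simp
      ultimately show "g s < g t"
        using st \<psi>(1) by (auto simp: g_def strict_mono_def)
    qed
    moreover have "surj g"
    unfolding surj_def
    proof
      fix y
      show "\<exists>x. y = g x"
      proof (cases "y \<le> f m")
        case True
        obtain t where t: "\<psi> t = y" using \<psi>(2) by (metis surjD)
        then have "t \<le> m" using True \<psi>(1) \<psi>(3)[OF m(1)] by (metis strict_mono_less_eq)
        then show ?thesis using t by (auto simp: g_def)
      next
        case False
        then show ?thesis
          using k by (intro exI[of _ "m + (y - f m) / k"]) (auto simp: g_def field_simps)
      qed
    qed
    moreover have "g w = f w" if "w \<in> insert b A" for w
      using that m mb \<psi>(3) insert.hyps by (auto simp: g_def k_def)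
    ultimately show ?thesis by blast
  qed
qed

lemma poly_sgn_eq_if_no_root:
  fixes p :: "real poly"
  assumes "\<And>r. min a b \<le> r \<Longrightarrow> r \<le> max a b \<Longrightarrow> poly p r \<noteq> 0"
  shows "sgn (poly p a) = sgn (poly p b)"
proof (rule ccontr)
  assume neq: "sgn (poly p a) \<noteq> sgn (poly p b)"
  have *: "poly p a \<noteq> 0" "poly p b \<noteq> 0" using assms[of a] assms[of b] by auto
  then have "a \<noteq> b" and "poly p a * poly p b < 0"
    using neq by (auto simp: sgn_if mult_less_0_iff split: if_splits)
  then consider "a < b" | "b < a" by linarith
  then show False
  proof cases
    case 1
    from poly_IVT[OF 1 \<open>poly p a * poly p b < 0\<close>] show False using assms by fastforce
  next
    case 2
    have "poly p b * poly p a < 0" using \<open>poly p a * poly p b < 0\<close> by (simp add: mult.commute)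
    from poly_IVT[OF 2 this] show False using assms by fastforce
  qed
qed

lemma poly_sgn_diff_between_critical_points:
  fixes p :: "real poly"
  assumes "\<And>r. a < r \<Longrightarrow> r < b \<Longrightarrow> poly (pderiv p) r \<noteq> 0"
    and "a \<le> s" "s < t" "t \<le> b" "a < u" "u < b"
  shows "sgn (poly p t - poly p s) = sgn (poly (pderiv p) u)"
proof -
  obtain \<xi> where \<xi>: "s < \<xi>" "\<xi> < t" "poly p t - poly p s = (t - s) * poly (pderiv p) \<xi>"
    using poly_MVT[OF \<open>s < t\<close>, of p] by blast
  have "sgn (poly (pderiv p) \<xi>) = sgn (poly (pderiv p) u)"
    by (rule poly_sgn_eq_if_no_root) (use assms \<xi> in auto)
  then show ?thesis using \<xi> \<open>s < t\<close> by (simp add: sgn_mult)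
qed

lemma poly_sgn_at_infinity:
  fixes p :: "real poly"
  assumes "p \<noteq> 0"
  shows "\<exists>M. \<forall>t\<ge>M. sgn (poly p t) = sgn (lead_coeff p) \<and>
    sgn (poly p (- t)) = sgn (lead_coeff p) * (- 1) ^ degree p"
proof -
  have pos: "\<exists>M. \<forall>t\<ge>M. sgn (poly p t) = sgn (lead_coeff p)" if "p \<noteq> 0" for p :: "real poly"
  proof (cases "lead_coeff p > 0")
    case True
    with poly_pinfty_gt_lc[OF True] show ?thesis by (metis less_le_trans sgn_pos)
  next
    case False
    then have neg: "lead_coeff (- p) > 0" using that by (simp add: less_le)
    then obtain M where M: "\<And>t. t \<ge> M \<Longrightarrow> poly (- p) t \<ge> lead_coeff (- p)"
      using poly_pinfty_gt_lc by metis
    then have "poly p t < 0" if "t \<ge> M" for t using M[OF that] neg by simp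
    then show ?thesis using neg by (auto intro!: exI[of _ M])
  qed
  have "p \<circ>\<^sub>p [:0, - 1:] \<noteq> 0" using assms by (simp add: pcompose_eq_0_iff)
  then obtain M1 where M1: "\<And>t. t \<ge> M1 \<Longrightarrow>
      sgn (poly (p \<circ>\<^sub>p [:0, - 1:]) t) = sgn (lead_coeff (p \<circ>\<^sub>p [:0, - 1:]))"
    using pos by metis
  obtain M2 where M2: "\<And>t. t \<ge> M2 \<Longrightarrow> sgn (poly p t) = sgn (lead_coeff p)"
    using pos assms by metis
  have sgn_power: "sgn ((- 1 :: real) ^ n) = (- 1) ^ n" for n
    by (cases "even n") auto
  show ?thesis
    by (intro exI[of _ "max M1 M2"])
      (use M1 M2 in \<open>auto simp: poly_pcompose lead_coeff_comp sgn_mult sgn_power\<close>)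
qed

text \<open>A matching may be deformed freely away from the zeros of \<open>P\<close>. By
  surjectivity of \<open>\<phi>\<close> every zero of \<open>Q\<close> is the image of a zero of
  \<open>P\<close>; there the two maps agree, so by monotonicity \<open>\<phi> t\<close> and
  \<open>\<psi> t\<close> lie on the same side of each zero of \<open>Q\<close>. For
  \<open>P = 0\<close> surjectivity makes \<open>Q\<close> vanish everywhere.\<close>

lemma sgn_preserving_transfer:
  fixes \<phi> \<psi> :: "real \<Rightarrow> real" and P Q :: "real poly"
  assumes \<phi>: "strict_mono \<phi>" "surj \<phi>" and \<psi>: "strict_mono \<psi>"
    and sgn: "\<And>t. sgn (poly P t) = sgn (poly Q (\<phi> t))"
    and eq: "\<And>r. P \<noteq> 0 \<Longrightarrow> poly P r = 0 \<Longrightarrow> \<psi> r = \<phi> r"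
  shows "sgn (poly P t) = sgn (poly Q (\<psi> t))"
proof (cases "poly P t = 0")
  case True
  show ?thesis
  proof (cases "P = 0")
    case True
    obtain s where "\<psi> t = \<phi> s" using \<phi>(2) by (metis surjD)
    then show ?thesis using True sgn[of s] by simp
  next
    case False
    then show ?thesis using eq[OF False True] sgn[of t] by simp
  qed
next
  case False
  then have P: "P \<noteq> 0" by auto
  have "sgn (poly Q (\<phi> t)) = sgn (poly Q (\<psi> t))"
  proof (rule poly_sgn_eq_if_no_root)
    fix s assume s: "min (\<phi> t) (\<psi> t) \<le> s" "s \<le> max (\<phi> t) (\<psi> t)"
    show "poly Q s \<noteq> 0"
    proof
      assume Q: "poly Q s = 0"
      obtain r where r: "s = \<phi> r" using \<phi>(2) by (metis surjD)
      then have r0: "poly P r = 0" using Q sgn[of r] by (simp add: sgn_0_0)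
      then have r': "\<psi> r = \<phi> r" using eq P by blast
      have "r \<noteq> t" using False r0 by auto
      then consider "r < t" | "t < r" by linarith
      then show False
      proof cases
        case 1
        then show False using s r r' strict_monoD[OF \<phi>(1) 1] strict_monoD[OF \<psi> 1] by auto
      next
        case 2
        then show False using s r r' strict_monoD[OF \<phi>(1) 2] strict_monoD[OF \<psi> 2] by auto
      qed
    qed
  qed
  then show ?thesis using sgn by simp
qed

definition sgn_matching :: "(real \<Rightarrow> real) \<Rightarrow> real poly \<Rightarrow> real poly \<Rightarrow> bool" where
  "sgn_matching \<phi> P Q \<longleftrightarrow> (\<forall>t. sgn (poly P t) = sgn (poly Q (\<phi> t)))"

lemma sgn_eq_if_between:
  fixes a b t :: real
  assumes "sgn (t - a) = sgn (b - t)" "sgn a = sgn b"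
  shows "sgn t = sgn a"
proof -
  consider "t - a > 0" "b - t > 0" | "t - a < 0" "b - t < 0" | "t = a"
    using assms(1) by (cases "t - a" "0 :: real" rule: linorder_cases) (auto simp: sgn_if split: if_splits)
  then show ?thesis
    using assms(2) by cases (auto simp: sgn_if split: if_splits)
qed

lemma mult_neg_if_sgn_opposite:
  fixes a b s :: real
  assumes "s \<noteq> 0" "sgn b = sgn s" "sgn a = - sgn s"
  shows "a * b < 0"
proof -
  have "sgn (a * b) = - (sgn s * sgn s)" using assms by (simp add: sgn_mult)
  moreover have "sgn s * sgn s = 1" using assms(1) by (simp add: sgn_if)
  ultimately show ?thesis by (simp add: sgn_1_neg)
qed

lemma exists_adjacent:
  fixes Z :: "real set"
  assumes "finite Z" "l \<in> Z" "u \<in> Z" "l < t" "t < u" "t \<notin> Z"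
  obtains a b where "a \<in> Z" "b \<in> Z" "a < t" "t < b" "\<forall>z\<in>Z. \<not> (a < z \<and> z < b)"
proof -
  define a where "a = Max {z\<in>Z. z < t}"
  define b where "b = Min {z\<in>Z. t < z}"
  have a: "a \<in> {z\<in>Z. z < t}" unfolding a_def by (rule Max_in) (use assms in auto)
  have b: "b \<in> {z\<in>Z. t < z}" unfolding b_def by (rule Min_in) (use assms in auto)
  have "z \<notin> Z" if "a < z" "z < b" for z
  proof
    assume z: "z \<in> Z"
    show False
    proof (cases "z < t")
      case True
      then have "z \<le> a" unfolding a_def using assms z by (intro Max_ge) auto
      then show False using that by simp
    next
      case False
      then have "b \<le> z" unfolding b_def using assms z by (intro Min_le) (auto simp: less_le)
      then show False using that by simp
    qed
  qed
  with a b that show ?thesis by blast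
qed

text \<open>The zeros of \<open>P\<close> are separated by those of \<open>P'\<close>, and between two consecutive points of \<open>Z\<close>
  the polynomial \<open>P\<close> is strictly monotone, so its signs on the interval only depend on its signs at
  the end points. The points \<open>\<plusminus>M\<close> in \<open>Z\<close> take care of the unbounded intervals.\<close>

lemma sgn_matching_insert:
  fixes \<phi> :: "real \<Rightarrow> real" and P Q :: "real poly"
  assumes fin: "finite H" and \<phi>: "strict_mono \<phi>" "surj \<phi>"
    and H: "\<And>A B. (A, B) \<in> H \<Longrightarrow> sgn_matching \<phi> A B"
    and deriv: "(pderiv P, pderiv Q) \<in> H"
    and deg: "degree P > 0" "degree Q = degree P" "sgn (lead_coeff P) = sgn (lead_coeff Q)"
    and roots: "\<And>A B r. (A, B) \<in> H \<Longrightarrow> A \<noteq> 0 \<Longrightarrow> poly A r = 0 \<Longrightarrow>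
      sgn (poly P r) = sgn (poly Q (\<phi> r))"
  shows "\<exists>\<psi>. strict_mono \<psi> \<and> surj \<psi> \<and>
    (\<forall>(A, B)\<in>insert (P, Q) H. sgn_matching \<psi> A B)"
proof -
  have nz: "P \<noteq> 0" "Q \<noteq> 0" using deg by auto
  have dP: "pderiv P \<noteq> 0" using deg by (simp add: pderiv_eq_0_iff)
  define Z0 where "Z0 = (\<Union>A\<in>{A \<in> fst ` H. A \<noteq> 0}. {r. poly A r = 0})"
  have finZ0: "finite Z0"
    unfolding Z0_def using fin by (intro finite_UN_I) (auto simp: poly_roots_finite)
  obtain M1 where M1: "\<And>t. t \<ge> M1 \<Longrightarrow> sgn (poly P t) = sgn (lead_coeff P) \<and>
    sgn (poly P (- t)) = sgn (lead_coeff P) * (- 1) ^ degree P"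
    using poly_sgn_at_infinity[OF nz(1)] by blast
  obtain M1' where M1': "\<And>t. t \<ge> M1' \<Longrightarrow> sgn (poly Q t) = sgn (lead_coeff Q) \<and>
    sgn (poly Q (- t)) = sgn (lead_coeff Q) * (- 1) ^ degree Q"
    using poly_sgn_at_infinity[OF nz(2)] by blast
  have bound: "\<exists>M>0. \<forall>z\<in>A. \<bar>z\<bar> < M" if "finite A" for A :: "real set"
  proof -
    obtain b where "\<And>z. z \<in> A \<Longrightarrow> norm z \<le> b"
      using finite_imp_bounded[OF \<open>finite A\<close>] by (metis bounded_iff)
    then show ?thesis by (intro exI[of _ "\<bar>b\<bar> + 1"]) force
  qed
  obtain M2 where M2: "M2 > 0" "\<And>z. z \<in> Z0 \<Longrightarrow> \<bar>z\<bar> < M2" using bound[OF finZ0] by blast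
  obtain M2' where M2': "M2' > 0" "\<And>z. z \<in> \<phi> ` Z0 \<Longrightarrow> \<bar>z\<bar> < M2'"
    using bound[of "\<phi> ` Z0"] finZ0 by blast
  define M where "M = max M1 M2"
  define M' where "M' = max M1' M2'"
  have M: "M > 0" "\<And>z. z \<in> Z0 \<Longrightarrow> - M < z \<and> z < M"
    using M2 by (fastforce simp: M_def)+
  have M': "M' > 0" "\<And>z. z \<in> Z0 \<Longrightarrow> - M' < \<phi> z \<and> \<phi> z < M'"
    using M2' by (fastforce simp: M'_def)+
  have sgnM: "sgn (poly P t) = sgn (poly Q s)" "sgn (poly P (- t)) = sgn (poly Q (- s))"
    if "t \<ge> M" "s \<ge> M'" for t s
    using M1[of t] M1'[of s] that deg by (auto simp: M_def M'_def)
  define Z where "Z = insert M (insert (- M) Z0)"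
  have finZ: "finite Z" using finZ0 by (simp add: Z_def)
  \<comment> \<open>\<open>\<phi>\<close> need not send the far points of \<open>P\<close> to far
    points of \<open>Q\<close>. It is therefore kept only on \<open>Z0\<close> and corrected at M
    and -M; the pairs in \<open>H\<close> stay matched by
    \<open>sgn_preserving_transfer\<close>.\<close>
  define f0 where "f0 z = (if z = M then M' else if z = - M then - M' else \<phi> z)" for z
  have "strict_mono_on Z f0"
  proof (rule strict_mono_onI)
    fix r s assume rs: "r \<in> Z" "s \<in> Z" "r < s"
    then have "r \<noteq> M" "s \<noteq> - M" using M by (auto simp: Z_def dest: M(2))
    moreover have "\<phi> r < \<phi> s" using rs \<phi> by (simp add: strict_mono_def)
    ultimately show "f0 r < f0 s"
      using rs M M' by (auto simp: f0_def Z_def)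
  qed
  from strict_mono_on_finite_extension[OF finZ this]
  obtain \<psi>0 where \<psi>0: "strict_mono \<psi>0" "surj \<psi>0" "\<And>z. z \<in> Z \<Longrightarrow> \<psi>0 z = f0 z"
    by blast
  have \<psi>0_less: "\<psi>0 s < \<psi>0 t \<longleftrightarrow> s < t" for s t using \<psi>0(1) by (simp add: strict_mono_less)
  have \<psi>0_Z0: "\<psi>0 z = \<phi> z" if "z \<in> Z0" for z
    using \<psi>0(3)[of z] M(2)[OF that] that by (auto simp: Z_def f0_def)
  have \<psi>0_M: "\<psi>0 M = M'" "\<psi>0 (- M) = - M'" using \<psi>0(3)[of M] \<psi>0(3)[of "- M"] M
    by (auto simp: Z_def f0_def)
  have sgn_Z: "sgn (poly P z) = sgn (poly Q (\<psi>0 z))" if z: "z \<in> Z" for z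
  proof -
    consider "z = M" | "z = - M" | "z \<in> Z0" using z unfolding Z_def by blast
    then show ?thesis
    proof cases
      case 3
      then show ?thesis using roots \<psi>0_Z0 by (auto simp: Z0_def)
    qed (use sgnM[of M M'] \<psi>0_M in auto)
  qed
  have H0: "sgn_matching \<psi> A B"
    if AB: "(A, B) \<in> H" and mono: "strict_mono \<psi>" and eq: "\<And>z. z \<in> Z \<Longrightarrow> \<psi> z = \<psi>0 z" for A B \<psi>
  proof -
    have "\<psi> r = \<phi> r" if r: "A \<noteq> 0" "poly A r = 0" for r
    proof -
      have "r \<in> Z0" using AB r by (auto simp: Z0_def image_iff intro!: bexI[of _ "(A, B)"])
      then show ?thesis using eq \<psi>0_Z0 by (simp add: Z_def)
    qed
    then show ?thesis
      using sgn_preserving_transfer[OF \<phi> mono, of A B] H[OF AB]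
      unfolding sgn_matching_def by blast
  qed
  have dQ: "sgn (poly (pderiv P) t) = sgn (poly (pderiv Q) (\<psi>0 t))" for t
    using H0[OF deriv \<psi>0(1)] by (simp add: sgn_matching_def)
  have dP_Z: "r \<in> Z" if "poly (pderiv P) r = 0" for r
    using that deriv dP by (force simp: Z_def Z0_def image_iff)
  have dQ_Z: "\<exists>r\<in>Z. s = \<psi>0 r" if "poly (pderiv Q) s = 0" for s
  proof -
    obtain r where r: "s = \<psi>0 r" using \<psi>0(2) by (metis surjD)
    then show ?thesis using that dQ[of r] dP_Z[of r] by (auto simp: sgn_0_0)
  qed
  have gapP: "sgn (poly P t - poly P s) = sgn (poly (pderiv P) u)"
    if "\<forall>z\<in>Z. \<not> (a < z \<and> z < b)" "a \<le> s" "s < t" "t \<le> b" "a < u" "u < b" for a b s t u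
    by (rule poly_sgn_diff_between_critical_points[of a b]) (use that dP_Z in blast)+
  have gapQ: "sgn (poly Q t - poly Q s) = sgn (poly (pderiv P) u)"
    if gap: "\<forall>z\<in>Z. \<not> (a < z \<and> z < b)" and "\<psi>0 a \<le> s" "s < t" "t \<le> \<psi>0 b" "a < u" "u < b"
    for a b s t u
    unfolding dQ
  proof (rule poly_sgn_diff_between_critical_points[of "\<psi>0 a" "\<psi>0 b"])
    fix r assume r: "\<psi>0 a < r" "r < \<psi>0 b"
    then show "poly (pderiv Q) r \<noteq> 0" using dQ_Z gap by (force simp: \<psi>0_less)
  qed (use that in \<open>auto simp: \<psi>0_less\<close>)
  have inM: "- M < t \<and> t < M" if "poly P t = 0" "t \<notin> Z" for t
  proof -
    have "lead_coeff P \<noteq> 0" using nz by simp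
    then have "\<not> t \<ge> M" "\<not> - t \<ge> M"
      using M1[of t] M1[of "- t"] that by (auto simp: M_def sgn_0_0)
    then show ?thesis by linarith
  qed
  \<comment> \<open>In the gap around c the polynomial \<open>P\<close> is strictly monotone with a
    zero inside, so its signs at the two ends are opposite. These signs transfer to
    \<open>Q\<close>, and the intermediate value theorem gives a zero of \<open>Q\<close> in the
    corresponding gap.\<close>
  have ex_root: "\<exists>c'. poly Q c' = 0 \<and> (\<forall>z\<in>Z. (z < c \<longrightarrow> \<psi>0 z < c') \<and> (c < z \<longrightarrow> c' < \<psi>0 z))"
    if c: "poly P c = 0" "c \<notin> Z" for c
  proof -
    obtain a b where ab: "a \<in> Z" "b \<in> Z" "a < c" "c < b" "\<forall>z\<in>Z. \<not> (a < z \<and> z < b)"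
      using exists_adjacent[OF finZ, of "- M" M c] inM[OF c] c by (auto simp: Z_def)
    have "sgn (poly P b) = sgn (poly (pderiv P) c)"
      using gapP[OF ab(5), of c b c] ab c by simp
    moreover have "sgn (- poly P a) = sgn (poly (pderiv P) c)"
      using gapP[OF ab(5), of a c c] ab c by simp
    moreover have "poly (pderiv P) c \<noteq> 0" using dP_Z c by blast
    ultimately have "poly Q (\<psi>0 a) * poly Q (\<psi>0 b) < 0"
      using sgn_Z[OF ab(1)] sgn_Z[OF ab(2)]
      by (intro mult_neg_if_sgn_opposite[of "poly (pderiv P) c"]) (auto simp: sgn_minus)
    moreover have "\<psi>0 a < \<psi>0 b" using ab by (simp add: \<psi>0_less)
    ultimately obtain c' where c': "\<psi>0 a < c'" "c' < \<psi>0 b" "poly Q c' = 0"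
      using poly_IVT by blast
    show ?thesis
    proof (intro exI[of _ c'] conjI ballI impI)
      fix z assume z: "z \<in> Z"
      { assume "z < c"
        then have "z \<le> a" using ab(4) ab(5) z by force
        then show "\<psi>0 z < c'" using c' \<psi>0(1) by (meson le_less_trans strict_mono_less_eq)
      }
      { assume "c < z"
        then have "b \<le> z" using ab(3) ab(5) z by force
        then show "c' < \<psi>0 z" using c' \<psi>0(1) by (meson less_le_trans strict_mono_less_eq)
      }
    qed (use c' in auto)
  qed
  define f where "f c = (if c \<in> Z then \<psi>0 c else SOME c'. poly Q c' = 0 \<and>
      (\<forall>z\<in>Z. (z < c \<longrightarrow> \<psi>0 z < c') \<and> (c < z \<longrightarrow> c' < \<psi>0 z)))" for c
  have f_root: "poly Q (f c) = 0" "\<And>z. z \<in> Z \<Longrightarrow> z < c \<Longrightarrow> \<psi>0 z < f c"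
    "\<And>z. z \<in> Z \<Longrightarrow> c < z \<Longrightarrow> f c < \<psi>0 z" if "poly P c = 0" "c \<notin> Z" for c
    using someI_ex[OF ex_root[OF that]] that by (auto simp: f_def)
  define W where "W = Z \<union> {c. poly P c = 0}"
  have finW: "finite W" using finZ nz by (simp add: W_def poly_roots_finite)
  have "strict_mono_on W f"
  proof (rule strict_mono_onI)
    fix r s assume rs: "r \<in> W" "s \<in> W" "r < s"
    consider "r \<in> Z" "s \<in> Z" | "r \<in> Z" "s \<notin> Z" "poly P s = 0" | "r \<notin> Z" "poly P r = 0" "s \<in> Z"
      | "r \<notin> Z" "poly P r = 0" "s \<notin> Z" "poly P s = 0"
      using rs unfolding W_def by blast
    then show "f r < f s"
    proof cases
      case 1
      then show ?thesis using rs by (simp add: f_def \<psi>0_less)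
    next
      case 2
      then show ?thesis using rs f_root(2)[of s r] by (simp add: f_def)
    next
      case 3
      then show ?thesis using rs f_root(3)[of r s] by (simp add: f_def)
    next
      case 4
      \<comment> \<open>Two zeros of \<open>P\<close> outside \<open>Z\<close> never share a gap: by
        Rolle a critical point, which belongs to \<open>Z\<close>, separates them.\<close>
      obtain \<xi> where \<xi>: "r < \<xi>" "\<xi> < s" "poly P s - poly P r = (s - r) * poly (pderiv P) \<xi>"
        using poly_MVT[OF \<open>r < s\<close>, of P] by blast
      then have "\<xi> \<in> Z" using 4 rs by (intro dP_Z) auto
      then show ?thesis using f_root(3)[of r \<xi>] f_root(2)[of s \<xi>] 4 \<xi> by auto
    qed
  qed
  from strict_mono_on_finite_extension[OF finW this]
  obtain \<psi> where \<psi>: "strict_mono \<psi>" "surj \<psi>" "\<And>z. z \<in> W \<Longrightarrow> \<psi> z = f z"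
    by blast
  have \<psi>_less: "\<psi> s < \<psi> t \<longleftrightarrow> s < t" for s t using \<psi>(1) by (simp add: strict_mono_less)
  have \<psi>_Z: "\<psi> z = \<psi>0 z" if "z \<in> Z" for z using \<psi>(3)[of z] that by (simp add: W_def f_def)
  have \<psi>_root: "poly Q (\<psi> c) = 0" if "poly P c = 0" for c
  proof (cases "c \<in> Z")
    case True
    then show ?thesis using sgn_Z[OF True] that \<psi>_Z by (simp add: sgn_0_0)
  next
    case False
    then show ?thesis using f_root(1)[OF that False] \<psi>(3)[of c] that by (simp add: W_def)
  qed
  have "sgn (poly P t) = sgn (poly Q (\<psi> t))" for t
  proof -
    consider "t \<in> Z" | "t \<ge> M" | "t \<le> - M" | "t \<notin> Z" "- M < t" "t < M" by linarith
    then show ?thesis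
    proof cases
      case 1
      then show ?thesis using sgn_Z \<psi>_Z by simp
    next
      case 2
      have "\<psi> M \<le> \<psi> t" using 2 \<psi>(1) by (simp add: strict_mono_less_eq)
      then show ?thesis using sgnM(1)[of t "\<psi> t"] 2 \<psi>_Z[of M] \<psi>0_M by (simp add: Z_def)
    next
      case 3
      have "\<psi> t \<le> \<psi> (- M)" using 3 \<psi>(1) by (simp add: strict_mono_less_eq)
      then show ?thesis using sgnM(2)[of "- t" "- \<psi> t"] 3 \<psi>_Z[of "- M"] \<psi>0_M by (simp add: Z_def)
    next
      case 4
      then obtain a b where ab: "a \<in> Z" "b \<in> Z" "a < t" "t < b"
          "\<forall>z\<in>Z. \<not> (a < z \<and> z < b)"
        using exists_adjacent[OF finZ, of "- M" M t] by (auto simp: Z_def)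
      have \<psi>ab: "\<psi> a = \<psi>0 a" "\<psi> b = \<psi>0 b" "\<psi> a < \<psi> t" "\<psi> t < \<psi> b"
        using \<psi>_Z[OF ab(1)] \<psi>_Z[OF ab(2)] \<psi>_less[of a t] \<psi>_less[of t b] ab by blast+
      note P = gapP[OF ab(5)] and Q = gapQ[OF ab(5)]
      have nz': "poly (pderiv P) t \<noteq> 0" using dP_Z 4 by blast
      have Pa: "sgn (poly P t - poly P a) = sgn (poly (pderiv P) t)"
        and Pb: "sgn (poly P b - poly P t) = sgn (poly (pderiv P) t)"
        using P[of a t t] P[of t b t] ab by auto
      have Qa: "sgn (poly Q (\<psi> t) - poly Q (\<psi> a)) = sgn (poly (pderiv P) t)"
        and Qb: "sgn (poly Q (\<psi> b) - poly Q (\<psi> t)) = sgn (poly (pderiv P) t)"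
        using Q[of "\<psi> a" "\<psi> t" t] Q[of "\<psi> t" "\<psi> b" t] ab \<psi>ab by auto
      have sab: "sgn (poly P a) = sgn (poly Q (\<psi> a))" "sgn (poly P b) = sgn (poly Q (\<psi> b))"
        using sgn_Z ab \<psi>ab by auto
      show ?thesis
      proof (cases "\<exists>c. a < c \<and> c < b \<and> poly P c = 0")
        case True
        then obtain c where c: "a < c" "c < b" "poly P c = 0" by blast
        have Qc: "poly Q (\<psi> c) = 0" using \<psi>_root c by blast
        have \<psi>c: "\<psi>0 a < \<psi> c" "\<psi> c < \<psi>0 b" using c \<psi>ab \<psi>_less by metis+
        consider "t = c" | "t < c" | "c < t" by linarith
        then show ?thesis
        proof cases
          case 1
          then show ?thesis using c Qc by simp
        next
          case 2
          then have "sgn (- poly P t) = sgn (- poly Q (\<psi> t))"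
            using P[of t c t] Q[of "\<psi> t" "\<psi> c" t] ab c Qc \<psi>ab \<psi>c by (simp add: \<psi>_less)
          then show ?thesis by (simp add: sgn_minus)
        next
          case 3
          then show ?thesis
            using P[of c t t] Q[of "\<psi> c" "\<psi> t" t] ab c Qc \<psi>ab \<psi>c by (simp add: \<psi>_less)
        qed
      next
        case False
        \<comment> \<open>Without a zero inside the gap, \<open>P\<close> keeps its sign from any
          end where it is nonzero. If an end is a zero of \<open>P\<close>, hence of
          \<open>Q\<close> at the image, the sign at t is that of the increment from this end. If
          neither end is a zero, the values of \<open>Q\<close> at both ends have the same sign, and
          by monotonicity the value at \<open>\<psi> t\<close> lies between them.\<close>
        have eqP: "sgn (poly P a) = sgn (poly P t)" if "poly P a \<noteq> 0"
        proof (rule poly_sgn_eq_if_no_root)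
          fix r assume "min a t \<le> r" "r \<le> max a t"
          then have "r = a \<or> a < r \<and> r < b" using ab by auto
          then show "poly P r \<noteq> 0" using False that by blast
        qed
        have eqP': "sgn (poly P b) = sgn (poly P t)" if "poly P b \<noteq> 0"
        proof (rule poly_sgn_eq_if_no_root)
          fix r assume "min b t \<le> r" "r \<le> max b t"
          then have "r = b \<or> a < r \<and> r < b" using ab by auto
          then show "poly P r \<noteq> 0" using False that by blast
        qed
        show ?thesis
        proof (cases "poly P a = 0")
          case True
          then show ?thesis using Pa Qa sab by (simp add: sgn_0_0)
        next
          case a: False
          show ?thesis
          proof (cases "poly P b = 0")
            case True
            then have "sgn (- poly P t) = sgn (- poly Q (\<psi> t))"
              using Pb Qb sab by (simp add: sgn_0_0)
            then show ?thesis by (simp add: sgn_minus)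
          next
            case False
            have "sgn (poly Q (\<psi> a)) = sgn (poly Q (\<psi> b))"
              using sab eqP[OF a] eqP'[OF False] by argo
            from sgn_eq_if_between[OF trans[OF Qa Qb[symmetric]] this]
            show ?thesis using eqP[OF a] sab(1) by argo
          qed
        qed
      qed
    qed
  qed
  then have "sgn_matching \<psi> P Q" by (simp add: sgn_matching_def)
  then show ?thesis
    using \<psi> H0[OF _ \<psi>(1) \<psi>_Z] by (intro exI[of _ \<psi>]) auto
qed

text \<open>Assumption \<open>rem\<close> is what pseudo-division provides: on the zeros of \<open>A\<close> the sign of \<open>P\<close> is
  that of a polynomial of smaller degree. The polynomials are matched one by one, by increasing degree.\<close>

lemma sgn_matching_exists:
  fixes G :: "(real poly \<times> real poly) set"
  assumes fin: "finite G"
    and lead: "\<And>P Q. (P, Q) \<in> G \<Longrightarrow> degree Q = degree P \<and> sgn (lead_coeff Q) = sgn (lead_coeff P)"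
    and deriv: "\<And>P Q. (P, Q) \<in> G \<Longrightarrow> degree P > 0 \<Longrightarrow> (pderiv P, pderiv Q) \<in> G"
    and rem: "\<And>P Q A B. (P, Q) \<in> G \<Longrightarrow> (A, B) \<in> G \<Longrightarrow> 0 < degree A \<Longrightarrow> degree A \<le> degree P \<Longrightarrow>
      \<exists>(R, S)\<in>G. degree R < degree A \<and>
        (\<forall>r. poly A r = 0 \<longrightarrow> sgn (poly P r) = sgn (poly R r)) \<and>
        (\<forall>r. poly B r = 0 \<longrightarrow> sgn (poly Q r) = sgn (poly S r))"
  shows "\<exists>\<phi>. strict_mono \<phi> \<and> surj \<phi> \<and> (\<forall>(P, Q)\<in>G. sgn_matching \<phi> P Q)"
proof -
  \<comment> \<open>The subsets \<open>H\<close> are closed downwards by degree. A pair of top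
    degree can be removed from such a set, and whatever its reinsertion consults, namely the
    derivative and the remainders, has smaller degree and is still present.\<close>
  have "\<exists>\<phi>. strict_mono \<phi> \<and> surj \<phi> \<and> (\<forall>(P, Q)\<in>H. sgn_matching \<phi> P Q)"
    if "H \<subseteq> G" "\<And>x y. x \<in> H \<Longrightarrow> y \<in> G \<Longrightarrow> degree (fst y) < degree (fst x) \<Longrightarrow> y \<in> H" for H
    using that
  proof (induction "card H" arbitrary: H rule: less_induct)
    case less
    have finH: "finite H" using less.prems(1) fin finite_subset by blast
    show ?case
    proof (cases "H = {}")
      case True
      then show ?thesis
        by (intro exI[of _ "\<lambda>t. t"]) (auto simp: strict_mono_def)
    next
      case False
      define k where "k = Max ((\<lambda>x. degree (fst x)) ` H)"
      have "k \<in> (\<lambda>x. degree (fst x)) ` H"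
        unfolding k_def by (rule Max_in) (use finH False in auto)
      then obtain P Q where PQ: "(P, Q) \<in> H" "degree P = k" by force
      have kmax: "degree (fst x) \<le> k" if "x \<in> H" for x
        unfolding k_def by (rule Max_ge) (use finH that in auto)
      define H' where "H' = H - {(P, Q)}"
      have H_eq: "H = insert (P, Q) H'" using PQ by (auto simp: H'_def)
      have small: "y \<in> H'" if "y \<in> G" "degree (fst y) < k" for y
        using less.prems(2)[OF PQ(1), of y] that PQ(2) by (auto simp: H'_def)
      have "card H' < card H" unfolding H'_def by (rule card_Diff1_less[OF finH PQ(1)])
      moreover have "H' \<subseteq> G" using less.prems(1) by (auto simp: H'_def)
      moreover have "y \<in> H'" if "x \<in> H'" "y \<in> G" "degree (fst y) < degree (fst x)" for x y
        using that kmax[of x] small[of y] by (auto simp: H'_def)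
      ultimately obtain \<phi> where \<phi>: "strict_mono \<phi>" "surj \<phi>"
        "\<And>A B. (A, B) \<in> H' \<Longrightarrow> sgn_matching \<phi> A B"
        using less.hyps[of H'] by blast
      have G: "(P, Q) \<in> G" using PQ less.prems by blast
      note PQ_lead = lead[OF G]
      show ?thesis
      proof (cases "k = 0")
        case True
        then obtain a b where "P = [:a:]" "Q = [:b:]"
          using PQ PQ_lead by (metis degree_eq_zeroE)
        then have "sgn_matching \<phi> P Q" using PQ_lead by (simp add: sgn_matching_def)
        then show ?thesis using \<phi> unfolding H_eq by (intro exI[of _ \<phi>]) auto
      next
        case False
        have "degree (pderiv P) < k" using False PQ by (simp add: degree_pderiv)
        then have d: "(pderiv P, pderiv Q) \<in> H'" using deriv[OF G] False PQ by (intro small) auto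
        show ?thesis unfolding H_eq
        proof (rule sgn_matching_insert[OF _ \<phi> d])
          fix A B r assume A: "(A, B) \<in> H'" "A \<noteq> 0" "poly A r = 0"
          have AG: "(A, B) \<in> G" using A less.prems by (auto simp: H'_def)
          have "degree A \<noteq> 0"
          proof
            assume "degree A = 0"
            then obtain a where "A = [:a:]" by (metis degree_eq_zeroE)
            then show False using A by simp
          qed
          moreover have "degree A \<le> degree P" using kmax[of "(A, B)"] A PQ by (simp add: H'_def)
          ultimately obtain R S where RS: "(R, S) \<in> G" "degree R < degree A"
            "\<And>r. poly A r = 0 \<Longrightarrow> sgn (poly P r) = sgn (poly R r)"
            "\<And>r. poly B r = 0 \<Longrightarrow> sgn (poly Q r) = sgn (poly S r)"
            using rem[OF G AG] by fastforce
          have "(R, S) \<in> H'" using RS \<open>degree A \<le> degree P\<close> PQ by (intro small) auto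
          then have "sgn (poly R r) = sgn (poly S (\<phi> r))"
            using \<phi>(3) by (simp add: sgn_matching_def)
          \<comment> \<open>A zero r of \<open>A\<close> is carried to a zero of \<open>B\<close>,
            so on both sides the sign can be read off from the remainders, which are matched
            already.\<close>
          moreover have "poly B (\<phi> r) = 0"
            using \<phi>(3)[OF A(1)] A(3) by (simp add: sgn_matching_def) (metis sgn_0 sgn_0_0)
          ultimately show "sgn (poly P r) = sgn (poly Q (\<phi> r))" using RS A by simp
        qed (use False PQ PQ_lead finH in \<open>auto simp: H'_def\<close>)
      qed
    qed
  qed
  from this[of G] show ?thesis by blast
qed

section \<open>Univariate polynomials with coefficients in an algebra of functions;
  pseudo-division\<close>

definition function_algebra :: "('x \<Rightarrow> real) set \<Rightarrow> bool" where
  "function_algebra A \<longleftrightarrow> (\<forall>c. (\<lambda>_. c) \<in> A) \<and>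
     (\<forall>f\<in>A. \<forall>g\<in>A. (\<lambda>x. f x + g x) \<in> A \<and> (\<lambda>x. f x * g x) \<in> A)"

lemma function_algebra_const: "function_algebra A \<Longrightarrow> (\<lambda>_. c) \<in> A"
  and function_algebra_add: "function_algebra A \<Longrightarrow> f \<in> A \<Longrightarrow> g \<in> A \<Longrightarrow> (\<lambda>x. f x + g x) \<in> A"
  and function_algebra_mult: "function_algebra A \<Longrightarrow> f \<in> A \<Longrightarrow> g \<in> A \<Longrightarrow> (\<lambda>x. f x * g x) \<in> A"
  by (auto simp: function_algebra_def)

lemma function_algebra_cmult: "function_algebra A \<Longrightarrow> f \<in> A \<Longrightarrow> (\<lambda>x. c * f x) \<in> A"
  using function_algebra_mult[OF _ function_algebra_const] .

lemma function_algebra_diff: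
  assumes "function_algebra A" "f \<in> A" "g \<in> A"
  shows "(\<lambda>x. f x - g x) \<in> A"
  using function_algebra_add[OF assms(1,2) function_algebra_cmult[OF assms(1,3), of "- 1"]] by simp

lemma function_algebra_sum:
  assumes "function_algebra A" "\<And>i. i \<in> I \<Longrightarrow> f i \<in> A"
  shows "(\<lambda>x. \<Sum>i\<in>I. f i x) \<in> A"
  using assms(2)
  by (induction I rule: infinite_finite_induct)
    (auto intro: function_algebra_const[OF assms(1)] function_algebra_add[OF assms(1)])

lemma function_algebra_prod:
  assumes "function_algebra A" "\<And>i. i \<in> I \<Longrightarrow> f i \<in> A"
  shows "(\<lambda>x. \<Prod>i\<in>I. f i x) \<in> A"
  using assms(2)
  by (induction I rule: infinite_finite_induct)
    (auto intro: function_algebra_const[OF assms(1)] function_algebra_mult[OF assms(1)])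

lemma function_algebra_power:
  assumes "function_algebra A" "f \<in> A"
  shows "(\<lambda>x. f x ^ n) \<in> A"
  by (induction n) (auto intro: function_algebra_const[OF assms(1)] function_algebra_mult[OF assms(1,2)])

text \<open>Univariate polynomials over \<open>A\<close> with a formal degree, which may exceed the degree at points
  where leading coefficients vanish.\<close>

definition formal_polys :: "('x \<Rightarrow> real) set \<Rightarrow> (nat \<times> ('x \<Rightarrow> real poly)) set" where
  "formal_polys A = {(k, p). (\<forall>x. degree (p x) \<le> k) \<and> (\<forall>i. (\<lambda>x. coeff (p x) i) \<in> A)}"

definition formal_deriv :: "nat \<times> ('x \<Rightarrow> real poly) \<Rightarrow> nat \<times> ('x \<Rightarrow> real poly)" where
  "formal_deriv = (\<lambda>(k, p). (k - 1, \<lambda>x. pderiv (p x)))"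

text \<open>At points where the formal leading coefficient vanishes, the truncation is the same
  polynomial with a smaller formal degree. Repeated truncation thus reaches the true degree at any
  given point.\<close>

definition formal_trunc :: "nat \<times> ('x \<Rightarrow> real poly) \<Rightarrow> nat \<times> ('x \<Rightarrow> real poly)" where
  "formal_trunc = (\<lambda>(k, p). (k - 1, \<lambda>x. p x - monom (coeff (p x) k) k))"

text \<open>The exponent is even so that the factor is positive wherever the leading coefficient of
  the divisor is nonzero: at a zero of the divisor, dividend and remainder then have the same sign.
  The quotient s is an arbitrary function of the parameter because it drops out at such
  zeros.\<close>

definition is_formal_rem ::
  "nat \<times> ('x \<Rightarrow> real poly) \<Rightarrow> nat \<times> ('x \<Rightarrow> real poly) \<Rightarrow> nat \<times> ('x \<Rightarrow> real poly) \<Rightarrow> bool" where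
  "is_formal_rem = (\<lambda>(k, p) (j, q) (i, r). i = j - 1 \<and>
     (\<exists>n s. \<forall>x. smult (coeff (q x) j ^ (2 * n)) (p x) = s x * q x + r x))"

lemma formal_deriv_in:
  assumes "function_algebra A" "P \<in> formal_polys A"
  shows "formal_deriv P \<in> formal_polys A"
proof (cases P)
  case (Pair k p)
  then have "(\<lambda>x. coeff (pderiv (p x)) i) \<in> A" for i
    using assms(2) by (auto simp: formal_polys_def coeff_pderiv intro!: function_algebra_cmult[OF assms(1)])
  then show ?thesis
    using assms(2) Pair by (auto simp: formal_polys_def formal_deriv_def degree_pderiv intro: diff_le_mono)
qed

lemma degree_le_pred:
  fixes p :: "real poly"
  assumes "degree p \<le> k" "coeff p k = 0"
  shows "degree p \<le> k - 1"
proof (rule degree_le, intro allI impI)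
  fix i assume "k - 1 < i"
  then have "i = k \<or> k < i" by auto
  then show "coeff p i = 0" using assms by (auto intro: coeff_eq_0)
qed

lemma formal_trunc_in:
  assumes "function_algebra A" "P \<in> formal_polys A"
  shows "formal_trunc P \<in> formal_polys A"
proof (cases P)
  case (Pair k p)
  then have p: "\<And>x. degree (p x) \<le> k" "\<And>i. (\<lambda>x. coeff (p x) i) \<in> A"
    using assms(2) by (auto simp: formal_polys_def)
  have "(\<lambda>x. coeff (p x - monom (coeff (p x) k) k) i) \<in> A" for i
    using p(2)[of i] function_algebra_const[OF assms(1), of 0] by (cases "i = k") auto
  moreover have "degree (p x - monom (coeff (p x) k) k) \<le> k - 1" for x
    by (rule degree_le_pred) (auto intro: degree_diff_le p(1) order_trans[OF degree_monom_le])
  ultimately show ?thesis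
    using Pair by (auto simp: formal_polys_def formal_trunc_def)
qed

text \<open>Multiplying the dividend by the formal leading coefficient of the divisor, in place of
  dividing by the latter, keeps all coefficients in \<open>A\<close> and gives one identity for all
  parameters, including those where this coefficient vanishes.\<close>

lemma formal_rem_exists:
  assumes A: "function_algebra A" and "(k, p) \<in> formal_polys A" and q: "(j, q) \<in> formal_polys A"
    and "j > 0"
  shows "\<exists>R\<in>formal_polys A. is_formal_rem (k, p) (j, q) R"
proof -
  have qc: "(\<lambda>x. coeff (q x) i) \<in> A" and qd: "degree (q x) \<le> j" for i x
    using q by (auto simp: formal_polys_def)
  have "\<exists>n r s. (j - 1, r) \<in> formal_polys A \<and>
      (\<forall>x. smult (coeff (q x) j ^ n) (p x) = s x * q x + r x)" if "(k, p) \<in> formal_polys A" for k p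
    using that
  proof (induction k arbitrary: p rule: less_induct)
    case (less k)
    have pc: "(\<lambda>x. coeff (p x) i) \<in> A" and pd: "degree (p x) \<le> k" for i x
      using less.prems by (auto simp: formal_polys_def)
    show ?case
    proof (cases "k < j")
      case True
      then have "(j - 1, p) \<in> formal_polys A"
        using pc pd by (force simp: formal_polys_def intro: order_trans)
      then show ?thesis by (intro exI[of _ 0] exI[of _ p] exI[of _ "\<lambda>_. 0"]) auto
    next
      case False
      define b where "b x = coeff (q x) j" for x
      define a where "a x = coeff (p x) k" for x
      define p1 where "p1 x = smult (b x) (p x) - monom (a x) (k - j) * q x" for x
      have d1: "degree (p1 x) \<le> k - 1" for x
      proof (rule degree_le_pred)
        have "degree (monom (a x) (k - j) * q x) \<le> k"
          using degree_mult_le[of "monom (a x) (k - j)" "q x"] degree_monom_le[of "a x" "k - j"] qd[of x] False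
          by linarith
        then show "degree (p1 x) \<le> k"
          unfolding p1_def by (intro degree_diff_le) (auto simp: pd)
        show "coeff (p1 x) k = 0"
          using False by (simp add: p1_def a_def b_def coeff_monom_mult)
      qed
      have "(\<lambda>x. coeff (p1 x) i) \<in> A" for i
      proof (cases "k - j \<le> i")
        case True
        have "(\<lambda>x. b x * coeff (p x) i - a x * coeff (q x) (i - (k - j))) \<in> A"
          unfolding a_def b_def
          by (intro function_algebra_diff function_algebra_mult A pc qc)
        then show ?thesis using True by (simp add: p1_def coeff_monom_mult)
      next
        case False
        have "(\<lambda>x. b x * coeff (p x) i) \<in> A"
          unfolding b_def by (intro function_algebra_mult A pc qc)
        then show ?thesis using False by (simp add: p1_def coeff_monom_mult)
      qed
      then have "(k - 1, p1) \<in> formal_polys A" using d1 by (simp add: formal_polys_def)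
      moreover have "k - 1 < k" using False \<open>j > 0\<close> by simp
      ultimately obtain n r s where rs: "(j - 1, r) \<in> formal_polys A"
          "\<And>x. smult (b x ^ n) (p1 x) = s x * q x + r x"
        using less.IH unfolding b_def by blast
      have "smult (b x ^ Suc n) (p x) = (s x + smult (b x ^ n) (monom (a x) (k - j))) * q x + r x" for x
      proof -
        have "smult (b x ^ Suc n) (p x) = smult (b x ^ n) (p1 x) + smult (b x ^ n) (monom (a x) (k - j)) * q x"
          by (simp add: p1_def smult_diff_right mult.commute)
        then show ?thesis using rs(2)[of x] by (simp add: algebra_simps)
      qed
      then show ?thesis using rs(1) unfolding b_def
        by (intro exI[of _ "Suc n"] exI[of _ r] exI[of _ "\<lambda>x. s x + smult (coeff (q x) j ^ n) (monom (a x) (k - j))"])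
          blast
    qed
  qed
  then obtain n r s where r: "(j - 1, r) \<in> formal_polys A"
      "\<And>x. smult (coeff (q x) j ^ n) (p x) = s x * q x + r x"
    using assms(2) by blast
  \<comment> \<open>One more factor, the n-th power of the leading coefficient, turns the exponent n
    into 2 * n.\<close>
  define r' where "r' x = smult (coeff (q x) j ^ n) (r x)" for x
  have "(\<lambda>x. coeff (r' x) i) \<in> A" for i
    unfolding r'_def coeff_smult
    using r(1) by (intro function_algebra_mult function_algebra_power A qc) (auto simp: formal_polys_def)
  then have "(j - 1, r') \<in> formal_polys A"
    using r(1) by (auto simp: formal_polys_def r'_def intro: order_trans[OF degree_smult_le])
  moreover have "smult (coeff (q x) j ^ (2 * n)) (p x) = smult (coeff (q x) j ^ n) (s x) * q x + r' x" for x
    using arg_cong[OF r(2)[of x], of "smult (coeff (q x) j ^ n)"]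
    by (simp add: r'_def smult_add_right power_add mult_2)
  then have "is_formal_rem (k, p) (j, q) (j - 1, r')"
    unfolding is_formal_rem_def prod.case
    by (intro conjI refl exI[of _ n] exI[of _ "\<lambda>x. smult (coeff (q x) j ^ n) (s x)"]) blast
  ultimately show ?thesis by blast
qed

text \<open>Remainders have smaller formal degree than the divisor and the other two operations lower the
  formal degree, so a finite family can be closed up from the top degree downwards.\<close>

definition closed_from :: "nat \<Rightarrow> (nat \<times> ('x \<Rightarrow> real poly)) set \<Rightarrow> bool" where
  "closed_from k G \<longleftrightarrow>
     (\<forall>P\<in>G. k \<le> fst P \<longrightarrow> formal_deriv P \<in> G \<and> formal_trunc P \<in> G \<and>
       (\<forall>Q\<in>G. k \<le> fst Q \<longrightarrow> fst Q \<le> fst P \<longrightarrow> (\<exists>R\<in>G. is_formal_rem P Q R)))"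

text \<open>Divisors of formal degree above k are already served by \<open>G\<close>, so only those
  of degree exactly k need new remainders. All elements added have formal degree below k, hence
  impose no further condition at level k.\<close>

lemma closed_from_step:
  assumes A: "function_algebra A" and G: "finite G" "G \<subseteq> formal_polys A" "closed_from (Suc k) G" and "k > 0"
  shows "\<exists>G'. finite G' \<and> G \<subseteq> G' \<and> G' \<subseteq> formal_polys A \<and> closed_from k G'"
proof -
  define rem where "rem P Q = (SOME R. R \<in> formal_polys A \<and> is_formal_rem P Q R)" for P Q
  have rem: "rem P Q \<in> formal_polys A" "is_formal_rem P Q (rem P Q)"
    if "P \<in> G" "Q \<in> G" "fst Q = k" for P Q
  proof -
    obtain k' p j q where PQ: "P = (k', p)" "Q = (j, q)" by (metis prod.exhaust)
    have "(k', p) \<in> formal_polys A" "(j, q) \<in> formal_polys A" "j > 0"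
      using that G PQ \<open>k > 0\<close> by auto
    from formal_rem_exists[OF A this] have "\<exists>R. R \<in> formal_polys A \<and> is_formal_rem P Q R"
      unfolding PQ by blast
    from someI_ex[OF this] show "rem P Q \<in> formal_polys A" "is_formal_rem P Q (rem P Q)"
      by (auto simp: rem_def)
  qed
  define Gk where "Gk = {P \<in> G. fst P = k}"
  define N where "N = formal_deriv ` Gk \<union> formal_trunc ` Gk \<union> (\<lambda>(P, Q). rem P Q) ` (G \<times> Gk)"
  have N1: "N \<subseteq> formal_polys A"
    using G rem formal_deriv_in[OF A] formal_trunc_in[OF A] by (auto simp: N_def Gk_def)
  have "fst (rem P Q) < k" if "P \<in> G" "Q \<in> Gk" for P Q
    using rem(2)[of P Q] that \<open>k > 0\<close> by (auto simp: is_formal_rem_def Gk_def split: prod.splits)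
  then have N2: "fst P < k" if "P \<in> N" for P
    using that \<open>k > 0\<close> by (auto simp: N_def Gk_def formal_deriv_def formal_trunc_def split: prod.splits)
  have "finite Gk" using G by (simp add: Gk_def)
  then have "finite N" using G by (simp add: N_def)
  moreover have "closed_from k (G \<union> N)"
    unfolding closed_from_def
  proof (intro ballI impI)
    fix P assume P: "P \<in> G \<union> N" "k \<le> fst P"
    then have PG: "P \<in> G" using N2 by fastforce
    have "formal_deriv P \<in> G \<union> N \<and> formal_trunc P \<in> G \<union> N"
    proof (cases "fst P = k")
      case True
      then show ?thesis using PG by (auto simp: N_def Gk_def)
    next
      case False
      then show ?thesis using PG P G(3) by (auto simp: closed_from_def)
    qed
    moreover have "\<exists>R\<in>G \<union> N. is_formal_rem P Q R"
      if Q: "Q \<in> G \<union> N" "k \<le> fst Q" "fst Q \<le> fst P" for Q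
    proof -
      have QG: "Q \<in> G" using Q N2 by fastforce
      show ?thesis
      proof (cases "fst Q = k")
        case True
        then have "rem P Q \<in> N" using PG QG by (auto simp: N_def Gk_def)
        then show ?thesis using rem(2)[OF PG QG True] by blast
      next
        case False
        then have "Suc k \<le> fst Q" "Suc k \<le> fst P" using Q by auto
        then show ?thesis using PG QG Q(3) G(3) unfolding closed_from_def by blast
      qed
    qed
    ultimately show "formal_deriv P \<in> G \<union> N \<and> formal_trunc P \<in> G \<union> N \<and>
        (\<forall>Q\<in>G \<union> N. k \<le> fst Q \<longrightarrow> fst Q \<le> fst P \<longrightarrow> (\<exists>R\<in>G \<union> N. is_formal_rem P Q R))"
      by blast
  qed
  ultimately show ?thesis using G N1 by (intro exI[of _ "G \<union> N"]) auto
qed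

lemma closed_from_exists:
  assumes A: "function_algebra A" and F: "finite F" "F \<subseteq> formal_polys A"
  shows "\<exists>G. finite G \<and> F \<subseteq> G \<and> G \<subseteq> formal_polys A \<and> closed_from 1 G"
proof -
  obtain K where K: "\<And>P. P \<in> F \<Longrightarrow> fst P \<le> K"
    using F(1) by (metis finite_imageI finite_nat_set_iff_bounded_le imageI)
  have "\<exists>G. finite G \<and> F \<subseteq> G \<and> G \<subseteq> formal_polys A \<and> closed_from k G" if "1 \<le> k" "k \<le> Suc K" for k
    using that(2,1)
  proof (induction k rule: inc_induct)
    case base
    have "closed_from (Suc K) F" using K by (fastforce simp: closed_from_def)
    then show ?case using F by blast
  next
    case (step k)
    then obtain G where G: "finite G" "F \<subseteq> G" "G \<subseteq> formal_polys A" "closed_from (Suc k) G" by auto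
    moreover have "k > 0" using step.prems by simp
    ultimately obtain G' where "finite G'" "G \<subseteq> G'" "G' \<subseteq> formal_polys A" "closed_from k G'"
      using closed_from_step[OF A G(1,3,4)] by blast
    then show ?case using \<open>F \<subseteq> G\<close> by blast
  qed
  from this[of 1] show ?thesis by simp
qed

definition sgn_equiv :: "('x \<Rightarrow> real) set \<Rightarrow> 'x \<Rightarrow> 'x \<Rightarrow> bool" where
  "sgn_equiv B x y \<longleftrightarrow> (\<forall>b\<in>B. sgn (b x) = sgn (b y))"

text \<open>\<open>B\<close> collects the coefficients of the closed-up family. Equal signs at x and
  y make leading coefficients vanish simultaneously, so both specialisations have the same degree
  and leading sign, and the closure supplies the derivatives and remainders that
  \<open>sgn_matching_exists\<close> asks for.\<close>

lemma sgn_equiv_sgn_matching: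
  assumes A: "function_algebra A" and F: "finite F" "F \<subseteq> formal_polys A"
  shows "\<exists>B\<subseteq>A. finite B \<and> (\<forall>x y. sgn_equiv B x y \<longrightarrow>
    (\<exists>\<phi>. \<forall>(k, p)\<in>F. sgn_matching \<phi> (p x) (p y)))"
proof -
  obtain G where G: "finite G" "F \<subseteq> G" "G \<subseteq> formal_polys A" "closed_from 1 G"
    using closed_from_exists[OF A F] by blast
  define B where "B = (\<Union>(k, p)\<in>G. (\<lambda>i x. coeff (p x) i) ` {..k})"
  have "finite B" using G(1) by (auto simp: B_def)
  moreover have "B \<subseteq> A" using G(3) by (auto simp: B_def formal_polys_def)
  moreover have "\<exists>\<phi>. \<forall>(k, p)\<in>F. sgn_matching \<phi> (p x) (p y)" if xy: "sgn_equiv B x y" for x y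
  proof -
    have coeffs: "sgn (coeff (p x) k) = sgn (coeff (p y) k)" if "(k, p) \<in> G" for k p
      using xy that unfolding sgn_equiv_def B_def by force
    have deg: "degree (p z) \<le> k" if "(k, p) \<in> G" for k p z
      using that G(3) by (auto simp: formal_polys_def)
    define C where "C = (\<lambda>(k, p). (p x, p y)) ` G"
    \<comment> \<open>Truncation is applied until the formal leading coefficient is nonzero at x,
      equivalently at y; the formal degree is then the true degree at both points.\<close>
    have rep: "\<exists>k' p'. (k', p') \<in> G \<and> p' x = p x \<and> p' y = p y \<and> (k' = 0 \<or> coeff (p' x) k' \<noteq> 0)"
      if "(k, p) \<in> G" for k p
      using that
    proof (induction k arbitrary: p)
      case 0
      then show ?case by blast
    next
      case (Suc k)
      show ?case
      proof (cases "coeff (p x) (Suc k) = 0")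
        case True
        then have "coeff (p y) (Suc k) = 0" using coeffs[OF Suc.prems] by (simp add: sgn_0_0)
        moreover have "formal_trunc (Suc k, p) \<in> G"
          using G(4) Suc.prems by (auto simp: closed_from_def)
        ultimately show ?thesis using Suc.IH True by (fastforce simp: formal_trunc_def)
      next
        case False
        then show ?thesis using Suc.prems by blast
      qed
    qed
    have rep': "\<exists>k p. (k, p) \<in> G \<and> P = p x \<and> Q = p y \<and> degree P = k \<and> degree Q = k"
      if PQ: "(P, Q) \<in> C" for P Q
    proof -
      obtain k p where "(k, p) \<in> G" "P = p x" "Q = p y" using PQ by (auto simp: C_def)
      then obtain k p where kp: "(k, p) \<in> G" "P = p x" "Q = p y" "k = 0 \<or> coeff (p x) k \<noteq> 0"
        using rep by metis
      moreover have "k = 0 \<or> coeff (p y) k \<noteq> 0"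
        using kp(4) coeffs[OF kp(1)] by (metis sgn_0_0 sgn_0)
      ultimately have "k \<le> degree (p x)" "k \<le> degree (p y)"
        by (metis le0 le_degree)+
      then have "degree (p x) = k" "degree (p y) = k"
        using deg[OF kp(1), of x] deg[OF kp(1), of y] by auto
      then show ?thesis using kp by blast
    qed
    have "\<exists>\<phi>. strict_mono \<phi> \<and> surj \<phi> \<and> (\<forall>(P, Q)\<in>C. sgn_matching \<phi> P Q)"
    proof (rule sgn_matching_exists)
      show "finite C" using G(1) by (simp add: C_def)
    next
      fix P Q assume "(P, Q) \<in> C"
      from rep'[OF this] obtain k p where kp: "(k, p) \<in> G" "P = p x" "Q = p y" "degree P = k" "degree Q = k"
        by blast
      then show "degree Q = degree P \<and> sgn (lead_coeff Q) = sgn (lead_coeff P)"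
        using coeffs[OF kp(1)] by simp
    next
      fix P Q assume "(P, Q) \<in> C" and d: "degree P > 0"
      from rep'[OF this(1)] obtain k p where kp: "(k, p) \<in> G" "P = p x" "Q = p y" "degree P = k" "degree Q = k"
        by blast
      then have "formal_deriv (k, p) \<in> G" using d G(4) by (auto simp: closed_from_def)
      then show "(pderiv P, pderiv Q) \<in> C"
        unfolding C_def by (rule image_eqI[rotated]) (simp add: formal_deriv_def kp)
    next
      fix P Q A B assume PQ: "(P, Q) \<in> C" and AB: "(A, B) \<in> C" and d: "0 < degree A" "degree A \<le> degree P"
      obtain k p where kp: "(k, p) \<in> G" "P = p x" "Q = p y" "degree P = k" "degree Q = k"
        using rep'[OF PQ] by blast
      obtain j q where jq: "(j, q) \<in> G" "A = q x" "B = q y" "degree A = j" "degree B = j"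
        using rep'[OF AB] by blast
      obtain i r where r: "(i, r) \<in> G" "is_formal_rem (k, p) (j, q) (i, r)"
        using G(4) kp(1) jq(1) d kp(4) jq(4) unfolding closed_from_def by fastforce
      obtain n s where ns: "\<And>z. smult (coeff (q z) j ^ (2 * n)) (p z) = s z * q z + r z"
        using r(2) by (auto simp: is_formal_rem_def)
      have i: "i = j - 1" using r(2) by (simp add: is_formal_rem_def)
      have sgn_root: "sgn (poly (p z) t) = sgn (poly (r z) t)"
        if "poly (q z) t = 0" "coeff (q z) j \<noteq> 0" for z t
      proof -
        have "coeff (q z) j ^ (2 * n) * poly (p z) t = poly (r z) t"
          using arg_cong[OF ns[of z], of "\<lambda>P. poly P t"] that by simp
        moreover have "coeff (q z) j ^ (2 * n) > 0" using that by (simp add: power_mult)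
        ultimately show ?thesis by (metis mult_1 sgn_mult sgn_pos)
      qed
      have "coeff (q x) j \<noteq> 0" "coeff (q y) j \<noteq> 0"
        using jq d by (metis leading_coeff_0_iff degree_0 less_irrefl)+
      then show "\<exists>(R, S)\<in>C. degree R < degree A \<and>
          (\<forall>r. poly A r = 0 \<longrightarrow> sgn (poly P r) = sgn (poly R r)) \<and>
          (\<forall>r. poly B r = 0 \<longrightarrow> sgn (poly Q r) = sgn (poly S r))"
        using sgn_root[of x] sgn_root[of y] deg[OF r(1), of x] r(1) d jq kp i
        by (intro bexI[of _ "(r x, r y)"]) (auto simp: C_def)
    qed
    then show ?thesis using G(2) by (fastforce simp: C_def)
  qed
  ultimately show ?thesis by blast
qed

section \<open>Elimination of existential quantifiers for sign classes of polynomial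
  functions\<close>

inductive_set polyfun :: "'w set \<Rightarrow> (('w \<Rightarrow> real) \<Rightarrow> real) set" for J where
  polyfun_const: "(\<lambda>_. c) \<in> polyfun J"
| polyfun_var: "j \<in> J \<Longrightarrow> (\<lambda>x. x j) \<in> polyfun J"
| polyfun_add: "f \<in> polyfun J \<Longrightarrow> g \<in> polyfun J \<Longrightarrow> (\<lambda>x. f x + g x) \<in> polyfun J"
| polyfun_mult: "f \<in> polyfun J \<Longrightarrow> g \<in> polyfun J \<Longrightarrow> (\<lambda>x. f x * g x) \<in> polyfun J"

lemma function_algebra_polyfun: "function_algebra (polyfun J)"
  by (auto simp: function_algebra_def intro: polyfun.intros)

lemma polyfun_insert_formal_poly:
  assumes "f \<in> polyfun (insert v J)" "v \<notin> J"
  shows "\<exists>k p. (k, p) \<in> formal_polys (polyfun J) \<and> (\<forall>x t. f (x(v := t)) = poly (p x) t)"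
  using assms(1)
proof induction
  case (polyfun_const c)
  have "(\<lambda>x. coeff [:c:] i) \<in> polyfun J" for i by (rule polyfun.intros)
  then show ?case
    by (intro exI[of _ 0] exI[of _ "\<lambda>_. [:c:]"]) (auto simp: formal_polys_def)
next
  case (polyfun_var j)
  show ?case
  proof (cases "j = v")
    case True
    have "(\<lambda>x. coeff [:0, 1:] i) \<in> polyfun J" for i by (rule polyfun.intros)
    then show ?thesis using True
      by (intro exI[of _ 1] exI[of _ "\<lambda>_. [:0, 1:]"]) (auto simp: formal_polys_def)
  next
    case False
    then have "j \<in> J" using polyfun_var by simp
    then have "(\<lambda>x. coeff [:x j:] i) \<in> polyfun J" for i
      by (cases i) (auto intro: polyfun.intros)
    then show ?thesis using False
      by (intro exI[of _ 0] exI[of _ "\<lambda>x. [:x j:]"]) (auto simp: formal_polys_def)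
  qed
next
  case (polyfun_add f g)
  then obtain k p l q where pq: "(k, p) \<in> formal_polys (polyfun J)" "\<And>x t. f (x(v := t)) = poly (p x) t"
      "(l, q) \<in> formal_polys (polyfun J)" "\<And>x t. g (x(v := t)) = poly (q x) t" by blast
  have "degree (p x + q x) \<le> max k l" for x
    using pq by (intro degree_add_le) (auto simp: formal_polys_def intro: le_max_iff_disj[THEN iffD2])
  then have "(max k l, \<lambda>x. p x + q x) \<in> formal_polys (polyfun J)"
    using pq by (auto simp: formal_polys_def intro!: polyfun.polyfun_add)
  then show ?case by (intro exI conjI) (auto simp only: pq poly_add)
next
  case (polyfun_mult f g)
  then obtain k p l q where pq: "(k, p) \<in> formal_polys (polyfun J)" "\<And>x t. f (x(v := t)) = poly (p x) t"
      "(l, q) \<in> formal_polys (polyfun J)" "\<And>x t. g (x(v := t)) = poly (q x) t" by blast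
  have "degree (p x * q x) \<le> k + l" for x
    using pq by (intro order_trans[OF degree_mult_le] add_mono) (auto simp: formal_polys_def)
  moreover have "(\<lambda>x. coeff (p x * q x) i) \<in> polyfun J" for i
    unfolding coeff_mult
    using pq by (intro function_algebra_sum function_algebra_mult function_algebra_polyfun)
      (auto simp: formal_polys_def)
  ultimately have "(k + l, \<lambda>x. p x * q x) \<in> formal_polys (polyfun J)"
    by (auto simp: formal_polys_def)
  then show ?case by (intro exI conjI) (auto simp only: pq poly_mult)
qed

text \<open>Being a union of sign classes of finitely many functions replaces semialgebraicity here: it is
  evidently preserved by Boolean operations, and \<open>sgn_determined_ex\<close> is the Tarski--Seidenberg
  theorem.\<close>

definition sgn_determined :: "('x \<Rightarrow> real) set \<Rightarrow> 'x set \<Rightarrow> bool" where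
  "sgn_determined A S \<longleftrightarrow>
     (\<exists>B\<subseteq>A. finite B \<and> (\<forall>x y. sgn_equiv B x y \<longrightarrow> x \<in> S \<longrightarrow> y \<in> S))"

text \<open>A witness t at x becomes the witness \<open>\<phi> t\<close> at y, since one map
  \<open>\<phi>\<close> matches the signs of all polynomials arising from \<open>B\<close>
  simultaneously.\<close>

lemma sgn_determined_ex1:
  assumes "sgn_determined (polyfun (insert v J)) S" "v \<notin> J"
  shows "sgn_determined (polyfun J) {x. \<exists>t. x(v := t) \<in> S}"
proof -
  obtain B where B: "B \<subseteq> polyfun (insert v J)" "finite B"
    "\<And>x y. sgn_equiv B x y \<Longrightarrow> x \<in> S \<Longrightarrow> y \<in> S"
    using assms(1) by (auto simp: sgn_determined_def)
  have "\<forall>b\<in>B. \<exists>P. P \<in> formal_polys (polyfun J) \<and> (\<forall>x t. b (x(v := t)) = poly (snd P x) t)"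
    using polyfun_insert_formal_poly[OF _ assms(2)] B(1) by (fastforce)
  then obtain P where P: "\<And>b. b \<in> B \<Longrightarrow> P b \<in> formal_polys (polyfun J)"
      "\<And>b x t. b \<in> B \<Longrightarrow> b (x(v := t)) = poly (snd (P b) x) t" by metis
  have "finite (P ` B)" "P ` B \<subseteq> formal_polys (polyfun J)" using B(2) P(1) by auto
  from sgn_equiv_sgn_matching[OF function_algebra_polyfun this]
  obtain C where C: "C \<subseteq> polyfun J" "finite C" "\<And>x y. sgn_equiv C x y \<Longrightarrow>
      \<exists>\<phi>. \<forall>(k, p)\<in>P ` B. sgn_matching \<phi> (p x) (p y)"
    by blast
  have "\<exists>t. y(v := t) \<in> S" if xy: "sgn_equiv C x y" and x: "x(v := t) \<in> S" for x y t
  proof -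
    obtain \<phi> where \<phi>: "\<And>k p. (k, p) \<in> P ` B \<Longrightarrow> sgn_matching \<phi> (p x) (p y)"
      using C(3)[OF xy] by blast
    have "sgn_matching \<phi> (snd (P b) x) (snd (P b) y)" if "b \<in> B" for b
      using \<phi>[of "fst (P b)" "snd (P b)"] that by simp
    then have "sgn_equiv B (x(v := t)) (y(v := \<phi> t))"
      by (auto simp: sgn_equiv_def P(2) sgn_matching_def)
    then show ?thesis using B(3) x by blast
  qed
  then show ?thesis using C(1,2) unfolding sgn_determined_def by blast
qed

lemma sgn_determined_ex:
  assumes "finite V" "sgn_determined (polyfun (J \<union> V)) S" "J \<inter> V = {}"
  shows "sgn_determined (polyfun J) {x. \<exists>u. override_on x u V \<in> S}"
  using assms
proof (induction V arbitrary: S rule: finite_induct)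
  case empty
  then show ?case by simp
next
  case (insert v V)
  have "sgn_determined (polyfun (J \<union> V)) {x. \<exists>t. x(v := t) \<in> S}"
    using insert.prems insert.hyps by (intro sgn_determined_ex1) auto
  then have "sgn_determined (polyfun J) {x. \<exists>u. override_on x u V \<in> {x. \<exists>t. x(v := t) \<in> S}}"
    by (rule insert.IH) (use insert.prems in auto)
  also have "{x. \<exists>u. override_on x u V \<in> {x. \<exists>t. x(v := t) \<in> S}} =
      {x. \<exists>u. override_on x u (insert v V) \<in> S}"
  proof -
    have 1: "(override_on x u V)(v := t) = override_on x (u(v := t)) (insert v V)" for x u t
      using insert.hyps by (auto simp: override_on_def fun_eq_iff)
    show ?thesis unfolding mem_Collect_eq 1 by (metis fun_upd_triv)
  qed
  finally show ?case .
qed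

lemma sgn_determined_compl:
  assumes "sgn_determined A S"
  shows "sgn_determined A (- S)"
proof -
  have "sgn_equiv B x y \<Longrightarrow> sgn_equiv B y x" for B :: "('a \<Rightarrow> real) set" and x y
    by (simp add: sgn_equiv_def)
  then show ?thesis using assms unfolding sgn_determined_def by blast
qed

lemma sgn_determined_Int:
  assumes "sgn_determined A S" "sgn_determined A T"
  shows "sgn_determined A (S \<inter> T)"
proof -
  obtain B C where BC: "B \<subseteq> A" "finite B" "\<And>x y. sgn_equiv B x y \<Longrightarrow> x \<in> S \<Longrightarrow> y \<in> S"
     "C \<subseteq> A" "finite C" "\<And>x y. sgn_equiv C x y \<Longrightarrow> x \<in> T \<Longrightarrow> y \<in> T"
    using assms by (auto simp: sgn_determined_def)
  have "sgn_equiv B x y" "sgn_equiv C x y" if "sgn_equiv (B \<union> C) x y" for x y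
    using that by (auto simp: sgn_equiv_def)
  then show ?thesis unfolding sgn_determined_def
    using BC by (intro exI[of _ "B \<union> C"]) blast
qed

lemma sgn_determined_sgn:
  assumes "f \<in> A"
  shows "sgn_determined A {x. Q (sgn (f x))}"
  unfolding sgn_determined_def
proof (intro exI[of _ "{f}"] conjI allI impI)
  fix x y assume "sgn_equiv {f} x y" and x: "x \<in> {x. Q (sgn (f x))}"
  then have "sgn (f y) = sgn (f x)" by (simp add: sgn_equiv_def)
  then show "y \<in> {x. Q (sgn (f x))}" using x by simp
qed (use assms in auto)

lemma sgn_determined_less: "f \<in> A \<Longrightarrow> sgn_determined A {x. f x < 0}"
  and sgn_determined_eq: "f \<in> A \<Longrightarrow> sgn_determined A {x. f x = 0}"
  and sgn_determined_le: "f \<in> A \<Longrightarrow> sgn_determined A {x. f x \<le> 0}"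
  using sgn_determined_sgn[of f A "\<lambda>s. s < 0"] sgn_determined_sgn[of f A "\<lambda>s. s = 0"]
    sgn_determined_sgn[of f A "\<lambda>s. s \<le> 0"]
  by (auto simp: sgn_less sgn_0_0 sgn_le_0_iff)

section \<open>From sign classes back to semialgebraic sets\<close>

lemma rpoly_eval_uminus: "rpoly_eval (- p) x = - rpoly_eval p x"
  by (simp add: rpoly_eval_def sum_negf)

text \<open>\<open>S\<close> is the union of the sign classes of its points, of which there are
  finitely many because each is described by subsets of a finite set. The negatives of the elements
  of \<open>B\<close> are included since \<open>semialgebraic\<close> only admits equations and
  strict inequalities \<open>> 0\<close>.\<close>

lemma semialgebraic_if_sgn_equiv:
  assumes B: "finite B" "B \<subseteq> carrier (rpoly_ring I)" and S: "S \<subseteq> coord_space I"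
    and eq: "\<And>x y. x \<in> S \<Longrightarrow> y \<in> coord_space I \<Longrightarrow> sgn_equiv (rpoly_eval ` B) x y \<Longrightarrow> y \<in> S"
  shows "semialgebraic I S"
proof -
  define E where "E x = {p \<in> B. rpoly_eval p x = 0}" for x
  define P where "P x = {p \<in> B \<union> uminus ` B. rpoly_eval p x > 0}" for x
  define F where "F = (\<lambda>x. (E x, P x)) ` S"
  have um: "- p \<in> carrier (rpoly_ring I)" if "p \<in> carrier (rpoly_ring I)" for p
    using that by (simp add: rpoly_ring_def)
  have FF: "F \<subseteq> Pow B \<times> Pow (B \<union> uminus ` B)" by (auto simp: F_def E_def P_def)
  then have "finite F" by (rule finite_subset) (use B in auto)
  moreover have "finite E' \<and> finite P' \<and> E' \<subseteq> carrier (rpoly_ring I) \<and> P' \<subseteq> carrier (rpoly_ring I)"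
    if "(E', P') \<in> F" for E' P'
  proof -
    have "E' \<subseteq> B" "P' \<subseteq> B \<union> uminus ` B" using that FF by auto
    then show ?thesis using B um by (auto intro: finite_subset)
  qed
  moreover have "S = (\<Union>(E, P)\<in>F. {x \<in> coord_space I.
               (\<forall>p\<in>E. rpoly_eval p x = 0) \<and> (\<forall>q\<in>P. rpoly_eval q x > 0)})" (is "S = ?R")
  proof
    show "S \<subseteq> ?R" using S by (auto simp: F_def E_def P_def)
    show "?R \<subseteq> S"
    proof
      fix y assume "y \<in> ?R"
      then obtain x where x: "x \<in> S" "y \<in> coord_space I" "\<And>p. p \<in> E x \<Longrightarrow> rpoly_eval p y = 0"
         "\<And>p. p \<in> P x \<Longrightarrow> rpoly_eval p y > 0" by (auto simp: F_def)
      have "sgn (rpoly_eval p x) = sgn (rpoly_eval p y)" if "p \<in> B" for p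
      proof (cases "rpoly_eval p x" "0 :: real" rule: linorder_cases)
        case less
        then have "- p \<in> P x" using that by (simp add: P_def rpoly_eval_uminus)
        then show ?thesis using x(4)[of "- p"] less by (simp add: rpoly_eval_uminus)
      next
        case equal
        then show ?thesis using x(3)[of p] that by (simp add: E_def)
      next
        case greater
        then show ?thesis using x(4)[of p] that by (simp add: P_def)
      qed
      then show "y \<in> S" using eq[OF x(1,2)] by (auto simp: sgn_equiv_def)
    qed
  qed
  ultimately show ?thesis
    unfolding semialgebraic_def by (intro exI[of _ F] conjI) auto
qed

lemma rpoly_ring_const: "Poly_Mapping.single 0 c \<in> carrier (rpoly_ring I)"
  by (auto simp: rpoly_ring_def)

lemma polyfun_Inl_rpoly:
  assumes "f \<in> polyfun (Inl ` I :: ('v + 'u) set)"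
  shows "\<exists>p\<in>carrier (rpoly_ring I). \<forall>c. f (case_sum c z) = rpoly_eval p c"
  using assms
proof induction
  case (polyfun_const a)
  then show ?case
    by (intro bexI[of _ "Poly_Mapping.single 0 a"]) (auto simp: rpoly_eval_single rpoly_ring_const)
next
  case (polyfun_var j)
  then obtain i where i: "i \<in> I" "j = Inl i" by blast
  then show ?case
    by (intro bexI[of _ "Poly_Mapping.single (Poly_Mapping.single i 1) 1"])
      (auto simp: rpoly_eval_single rpoly_ring_def)
next
  case (polyfun_add f g)
  then obtain p q where "p \<in> carrier (rpoly_ring I)" "\<forall>c. f (case_sum c z) = rpoly_eval p c"
    "q \<in> carrier (rpoly_ring I)" "\<forall>c. g (case_sum c z) = rpoly_eval q c" by blast
  moreover have "p + q \<in> carrier (rpoly_ring I)" if "p \<in> carrier (rpoly_ring I)" "q \<in> carrier (rpoly_ring I)"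
    using cring.cring_simprules(1)[OF cring_rpoly_ring that] by (simp add: rpoly_ring_def)
  ultimately show ?case by (intro bexI[of _ "p + q"]) (auto simp: rpoly_eval_add)
next
  case (polyfun_mult f g)
  then obtain p q where "p \<in> carrier (rpoly_ring I)" "\<forall>c. f (case_sum c z) = rpoly_eval p c"
    "q \<in> carrier (rpoly_ring I)" "\<forall>c. g (case_sum c z) = rpoly_eval q c" by blast
  moreover have "p * q \<in> carrier (rpoly_ring I)" if "p \<in> carrier (rpoly_ring I)" "q \<in> carrier (rpoly_ring I)"
    using cring.cring_simprules(5)[OF cring_rpoly_ring that] by (simp add: rpoly_ring_def)
  ultimately show ?case by (intro bexI[of _ "p * q"]) (auto simp: rpoly_eval_mult)
qed

lemma semialgebraic_if_sgn_determined:
  fixes T :: "('v + 'u \<Rightarrow> real) set"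
  assumes "sgn_determined (polyfun (Inl ` I)) T"
  shows "semialgebraic I {c \<in> coord_space I. case_sum c z \<in> T}"
proof -
  obtain B where B: "B \<subseteq> polyfun (Inl ` I)" "finite B" "\<And>x y. sgn_equiv B x y \<Longrightarrow> x \<in> T \<Longrightarrow> y \<in> T"
    using assms by (auto simp: sgn_determined_def)
  have "\<forall>b\<in>B. \<exists>p. p \<in> carrier (rpoly_ring I) \<and> (\<forall>c. b (case_sum c z) = rpoly_eval p c)"
    using polyfun_Inl_rpoly B(1) by blast
  then obtain p where p: "\<And>b. b \<in> B \<Longrightarrow> p b \<in> carrier (rpoly_ring I)"
    "\<And>b c. b \<in> B \<Longrightarrow> b (case_sum c z) = rpoly_eval (p b) c" by metis
  show ?thesis
  proof (rule semialgebraic_if_sgn_equiv[of "p ` B"])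
    fix x y assume xy: "x \<in> {c \<in> coord_space I. case_sum c z \<in> T}" "y \<in> coord_space I"
      "sgn_equiv (rpoly_eval ` p ` B) x y"
    then have "sgn_equiv B (case_sum x z) (case_sum y z)"
      by (auto simp: sgn_equiv_def p(2))
    then show "y \<in> {c \<in> coord_space I. case_sum c z \<in> T}" using xy B(3) by auto
  qed (use B p in auto)
qed

section \<open>Forms and their restrictions to lines\<close>

definition power_product :: "('n::finite \<Rightarrow>\<^sub>0 nat) \<Rightarrow> real ^ 'n \<Rightarrow> real" where
  "power_product \<beta> y = (\<Prod>i\<in>UNIV. (y $ i) ^ Poly_Mapping.lookup \<beta> i)"

lemma prod_keys_eq_prod_UNIV:
  fixes f :: "'n::finite \<Rightarrow> 'a::comm_semiring_1"
  shows "(\<Prod>i\<in>Poly_Mapping.keys m. f i ^ Poly_Mapping.lookup m i) = (\<Prod>i\<in>UNIV. f i ^ Poly_Mapping.lookup m i)"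
  by (rule prod.mono_neutral_left) (auto simp: in_keys_iff)

lemma power_product_add: "power_product (\<beta> + \<gamma>) y = power_product \<beta> y * power_product \<gamma> y"
  by (simp add: power_product_def lookup_add power_add prod.distrib)

lemma form_fun_eq_sum:
  assumes "g \<in> forms d"
  shows "form_fun g y = (\<Sum>\<beta>\<in>exponents d. Poly_Mapping.lookup g \<beta> * power_product \<beta> y)"
  unfolding form_fun_def
  by (subst rpoly_eval_superset[of "exponents d"])
    (use assms in \<open>auto simp: finite_exponents forms_def prod_keys_eq_prod_UNIV power_product_def\<close>)

lemma power_product_scaleR:
  assumes "\<beta> \<in> exponents d"
  shows "power_product \<beta> (r *\<^sub>R y) = r ^ d * power_product \<beta> y"
proof -
  have "(\<Prod>i\<in>UNIV. r ^ Poly_Mapping.lookup \<beta> i) = r ^ d"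
    using assms by (simp add: exponents_def flip: power_sum)
  then show ?thesis
    by (simp add: power_product_def power_mult_distrib prod.distrib)
qed

lemma form_fun_scaleR:
  assumes "g \<in> forms d"
  shows "form_fun g (r *\<^sub>R y) = r ^ d * form_fun g y"
  by (simp add: form_fun_eq_sum[OF assms] power_product_scaleR sum_distrib_left mult_ac)

definition form_of :: "nat \<Rightarrow> (('n::finite \<Rightarrow>\<^sub>0 nat) \<Rightarrow> real) \<Rightarrow> 'n rpoly" where
  "form_of d c = (\<Sum>\<beta>\<in>exponents d. Poly_Mapping.single \<beta> (c \<beta>))"

lemma lookup_form_of: "Poly_Mapping.lookup (form_of d c) \<beta> = (if \<beta> \<in> exponents d then c \<beta> else 0)"
  by (simp add: form_of_def lookup_sum lookup_single when_def sum.delta finite_exponents)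

lemma form_of_in_forms [simp]: "form_of d c \<in> forms d"
  by (auto simp: forms_def in_keys_iff lookup_form_of split: if_splits)

lemma form_of_lookup:
  assumes "g \<in> forms d"
  shows "form_of d (Poly_Mapping.lookup g) = g"
  by (rule poly_mapping_eqI) (use assms in \<open>auto simp: lookup_form_of forms_def in_keys_iff\<close>)

lemma form_fun_form_of: "form_fun (form_of d c) y = (\<Sum>\<beta>\<in>exponents d. c \<beta> * power_product \<beta> y)"
  by (simp add: form_fun_eq_sum[OF form_of_in_forms] lookup_form_of)

text \<open>Monomials are independent: one variable is split off at a time, by comparing
  coefficients of a univariate polynomial that vanishes everywhere. The exponents are an abstract
  function, required to be distinct on \<open>T\<close> only, because the lemma is also applied to
  monomials from which one variable has been removed.\<close>

lemma sum_power_products_eq_0D: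
  fixes c :: "'a \<Rightarrow> real" and e :: "'a \<Rightarrow> 'i \<Rightarrow> nat"
  assumes "finite T" "finite M"
    and "\<And>m m'. m \<in> M \<Longrightarrow> m' \<in> M \<Longrightarrow> (\<forall>i\<in>T. e m i = e m' i) \<Longrightarrow> m = m'"
    and "\<And>y. (\<Sum>m\<in>M. c m * (\<Prod>i\<in>T. y i ^ e m i)) = 0"
    and "m \<in> M"
  shows "c m = 0"
  using assms
proof (induction T arbitrary: M rule: finite_induct)
  case empty
  then have "M = {m}" by auto
  then show ?case using empty.prems(3) by simp
next
  case (insert i T)
  define k where "k = e m i"
  have "(\<Sum>m\<in>{m\<in>M. e m i = k}. c m * (\<Prod>i\<in>T. y i ^ e m i)) = 0" for y
  proof -
    define p where "p = (\<Sum>m\<in>M. monom (c m * (\<Prod>i\<in>T. y i ^ e m i)) (e m i))"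
    have "poly p t = 0" for t
    proof -
      have "(\<Prod>j\<in>T. (y(i := t)) j ^ e m j) = (\<Prod>j\<in>T. y j ^ e m j)" for m
        by (rule prod.cong) (use insert.hyps in auto)
      then show ?thesis
        using insert.prems(3)[of "y(i := t)"] insert.hyps
        by (simp add: p_def poly_sum poly_monom mult_ac del: fun_upd_apply) (simp add: mult_ac)
    qed
    then have "poly p = poly 0" by auto
    then have "p = 0" by (simp only: poly_eq_poly_eq_iff)
    then have "coeff p k = 0" by simp
    then show ?thesis
      by (simp add: p_def coeff_sum sum.If_cases \<open>finite M\<close> Int_def conj_commute)
  qed
  then show ?case
    by (intro insert.IH[of "{m\<in>M. e m i = k}"]) (use insert.prems in \<open>auto simp: k_def\<close>)
qed

lemma power_products_independent:
  assumes "\<And>y. (\<Sum>\<beta>\<in>exponents d. c \<beta> * power_product \<beta> y) = (\<Sum>\<beta>\<in>exponents d. c' \<beta> * power_product \<beta> y)"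
    and "\<beta> \<in> exponents d"
  shows "c \<beta> = c' \<beta>"
proof -
  have "c \<beta> - c' \<beta> = 0"
  proof (rule sum_power_products_eq_0D[of UNIV "exponents d" "Poly_Mapping.lookup" "\<lambda>\<beta>. c \<beta> - c' \<beta>"])
    fix y :: "'a \<Rightarrow> real"
    show "(\<Sum>m\<in>exponents d. (c m - c' m) * (\<Prod>i\<in>UNIV. y i ^ Poly_Mapping.lookup m i)) = 0"
      using assms(1)[of "vec_lambda y"] by (simp add: power_product_def left_diff_distrib sum_subtractf)
  qed (use assms(2) in \<open>auto simp: finite_exponents intro: poly_mapping_eqI\<close>)
  then show ?thesis by simp
qed

section \<open>Forms whose coefficients depend on parameters\<close>

definition form_family ::
  "('x \<Rightarrow> real) set \<Rightarrow> nat \<Rightarrow> ('x \<Rightarrow> real ^ 'n::finite \<Rightarrow> real) \<Rightarrow> bool" where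
  "form_family A d f \<longleftrightarrow> (\<exists>c. (\<forall>\<beta>. c \<beta> \<in> A) \<and>
     (\<forall>x y. f x y = (\<Sum>\<beta>\<in>exponents d. c \<beta> x * power_product \<beta> y)))"

lemma exponents_0: "exponents 0 = {0}"
  by (auto simp: exponents_def intro!: poly_mapping_eqI)

lemma form_family_const:
  assumes "a \<in> A"
  shows "form_family A 0 (\<lambda>x y. a x)"
  unfolding form_family_def exponents_0
  by (intro exI[of _ "\<lambda>_. a"]) (use assms in \<open>auto simp: power_product_def\<close>)

lemma form_family_var:
  fixes A :: "('x \<Rightarrow> real) set" and i :: "'n::finite"
  assumes "function_algebra A"
  shows "form_family A 1 (\<lambda>x y. y $ i)"
proof -
  define c :: "('n \<Rightarrow>\<^sub>0 nat) \<Rightarrow> 'x \<Rightarrow> real" where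
    "c \<beta> = (\<lambda>_. if \<beta> = Poly_Mapping.single i 1 then 1 else 0)" for \<beta>
  have "(\<Sum>\<beta>\<in>exponents 1. c \<beta> x * power_product \<beta> y) = y $ i" for x y
  proof -
    have "(\<Sum>j\<in>UNIV. Poly_Mapping.lookup (Poly_Mapping.single i (1::nat)) j) = 1"
      by (simp add: lookup_single when_def sum.delta)
    then have "Poly_Mapping.single i 1 \<in> exponents 1" by (simp add: exponents_def)
    moreover have "power_product (Poly_Mapping.single i 1) y = y $ i"
    proof -
      have "power_product (Poly_Mapping.single i 1) y = (\<Prod>j\<in>UNIV. if j = i then y $ i else 1)"
        unfolding power_product_def by (rule prod.cong) (auto simp: lookup_single when_def)
      then show ?thesis by (simp add: prod.delta)
    qed
    ultimately show ?thesis
      by (simp add: c_def if_distrib[of "\<lambda>a. a * b" for b] sum.delta finite_exponents cong: if_cong)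
  qed
  then show ?thesis
    unfolding form_family_def
    by (intro exI[of _ c]) (auto simp: c_def intro: function_algebra_const[OF assms])
qed

lemma form_family_add:
  assumes "function_algebra A" "form_family A d f" "form_family A d g"
  shows "form_family A d (\<lambda>x y. f x y + g x y)"
proof -
  obtain a where "\<And>\<beta>. a \<beta> \<in> A" "\<And>x y. f x y = (\<Sum>\<beta>\<in>exponents d. a \<beta> x * power_product \<beta> y)"
    using assms(2) unfolding form_family_def by blast
  moreover obtain b where "\<And>\<beta>. b \<beta> \<in> A" "\<And>x y. g x y = (\<Sum>\<beta>\<in>exponents d. b \<beta> x * power_product \<beta> y)"
    using assms(3) unfolding form_family_def by blast
  ultimately show ?thesis unfolding form_family_def
    by (intro exI[of _ "\<lambda>\<beta> x. a \<beta> x + b \<beta> x"])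
      (auto simp: sum.distrib distrib_right intro: function_algebra_add[OF assms(1)])
qed

lemma form_family_mult:
  assumes A: "function_algebra A" and "form_family A d f" "form_family A e g"
  shows "form_family A (d + e) (\<lambda>x y. f x y * g x y)"
proof -
  obtain a where a: "\<And>\<beta>. a \<beta> \<in> A" "\<And>x y. f x y = (\<Sum>\<beta>\<in>exponents d. a \<beta> x * power_product \<beta> y)"
    using assms(2) unfolding form_family_def by blast
  obtain b where b: "\<And>\<beta>. b \<beta> \<in> A" "\<And>x y. g x y = (\<Sum>\<beta>\<in>exponents e. b \<beta> x * power_product \<beta> y)"
    using assms(3) unfolding form_family_def by blast
  note ab = a b
  define E where "E = (exponents d :: ('b \<Rightarrow>\<^sub>0 nat) set) \<times> (exponents e :: ('b \<Rightarrow>\<^sub>0 nat) set)"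
  have finE: "finite E" by (simp add: E_def finite_exponents)
  define c where "c \<gamma> x = (\<Sum>p\<in>{p\<in>E. fst p + snd p = \<gamma>}. a (fst p) x * b (snd p) x)" for \<gamma> x
  have cA: "c \<gamma> \<in> A" for \<gamma>
    unfolding c_def by (intro function_algebra_sum function_algebra_mult A ab)
  have E: "(\<lambda>p. fst p + snd p) ` E \<subseteq> exponents (d + e)"
    by (auto simp: E_def exponents_def lookup_add sum.distrib)
  have "f x y * g x y = (\<Sum>\<gamma>\<in>exponents (d + e). c \<gamma> x * power_product \<gamma> y)" for x y
  proof -
    have "f x y * g x y = (\<Sum>p\<in>E. (a (fst p) x * b (snd p) x) * power_product (fst p + snd p) y)"
      unfolding ab sum_product E_def sum.cartesian_product
      by (rule sum.cong) (auto simp: power_product_add)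
    also have "\<dots> = (\<Sum>\<gamma>\<in>exponents (d + e). \<Sum>p\<in>{p\<in>E. fst p + snd p = \<gamma>}.
        (a (fst p) x * b (snd p) x) * power_product (fst p + snd p) y)"
      by (rule sum.group[symmetric]) (use finE E finite_exponents in auto)
    also have "\<dots> = (\<Sum>\<gamma>\<in>exponents (d + e). c \<gamma> x * power_product \<gamma> y)"
      unfolding c_def sum_distrib_right by (intro sum.cong) auto
    finally show ?thesis .
  qed
  then show ?thesis unfolding form_family_def using cA by blast
qed

lemma form_family_cmult:
  assumes "function_algebra A" "a \<in> A" "form_family A d f"
  shows "form_family A d (\<lambda>x y. a x * f x y)"
  using form_family_mult[OF assms(1) form_family_const[OF assms(2)] assms(3)] by simp

lemma form_family_sum:
  assumes "function_algebra A" "\<And>i. i \<in> I \<Longrightarrow> form_family A d (f i)"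
  shows "form_family A d (\<lambda>x y. \<Sum>i\<in>I. f i x y)"
proof -
  have 0: "form_family A d (\<lambda>x y. 0)"
    unfolding form_family_def
    by (intro exI[of _ "\<lambda>_ _. 0"]) (auto intro: function_algebra_const[OF assms(1)])
  show ?thesis
    using assms(2)
    by (induction I rule: infinite_finite_induct) (auto intro: 0 form_family_add[OF assms(1)])
qed

lemma form_family_power:
  assumes "function_algebra A" "form_family A d f"
  shows "form_family A (n * d) (\<lambda>x y. f x y ^ n)"
proof (induction n)
  case 0
  show ?case using form_family_const[OF function_algebra_const[OF assms(1)], of 1] by simp
next
  case (Suc n)
  show ?case using form_family_mult[OF assms Suc] by simp
qed

lemma form_family_prod:
  assumes "function_algebra A" "\<And>i. i \<in> I \<Longrightarrow> form_family A (d i) (f i)"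
  shows "form_family A (\<Sum>i\<in>I. d i) (\<lambda>x y. \<Prod>i\<in>I. f i x y)"
proof -
  have 1: "form_family A 0 (\<lambda>x y. 1)"
    using form_family_const[OF function_algebra_const[OF assms(1)], of 1] by simp
  show ?thesis
    using assms(2)
    by (induction I rule: infinite_finite_induct) (auto intro: 1 form_family_mult[OF assms(1)])
qed

lemma form_family_power_product:
  assumes "function_algebra A" "\<And>i. form_family A 1 (f i)" "\<beta> \<in> exponents d"
  shows "form_family A d (\<lambda>x y. power_product \<beta> (\<chi> i. f i x y))"
proof -
  have "form_family A (\<Sum>i\<in>UNIV. Poly_Mapping.lookup \<beta> i * 1)
      (\<lambda>x y. \<Prod>i\<in>UNIV. f i x y ^ Poly_Mapping.lookup \<beta> i)"
    by (intro form_family_prod form_family_power assms)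
  then show ?thesis using assms(3) by (simp add: exponents_def power_product_def)
qed

lemma function_algebra_UNIV: "function_algebra UNIV"
  by (simp add: function_algebra_def)

text \<open>With \<open>A = UNIV\<close> and a trivial parameter, the closure properties of families
  recognise an expression as a form without any computation of its coefficients.\<close>

lemma form_family_imp_form:
  assumes "form_family A d f"
  shows "\<exists>h\<in>forms d. \<forall>y. form_fun h y = f x y"
proof -
  obtain c where "\<And>x y. f x y = (\<Sum>\<beta>\<in>exponents d. c \<beta> x * power_product \<beta> y)"
    using assms by (auto simp: form_family_def)
  then show ?thesis
    by (intro bexI[of _ "form_of d (\<lambda>\<beta>. c \<beta> x)"]) (simp_all add: form_fun_form_of)
qed

section \<open>Restriction of forms to lines, and the Hessian\<close>

definition line_poly :: "'n::finite rpoly \<Rightarrow> real ^ 'n \<Rightarrow> real ^ 'n \<Rightarrow> real poly" where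
  "line_poly g x v = (\<Sum>m\<in>Poly_Mapping.keys g. smult (Poly_Mapping.lookup g m)
     (\<Prod>i\<in>UNIV. [:x $ i, v $ i:] ^ Poly_Mapping.lookup m i))"

lemma poly_line_poly: "poly (line_poly g x v) t = form_fun g (x + t *\<^sub>R v)"
  by (simp add: line_poly_def form_fun_def rpoly_eval_def prod_keys_eq_prod_UNIV poly_sum poly_prod)

lemma line_poly_eqI:
  assumes "\<And>t. form_fun g (x + t *\<^sub>R v) = poly p t"
  shows "line_poly g x v = p"
  using assms by (simp add: poly_line_poly flip: poly_eq_poly_eq_iff) (auto simp: fun_eq_iff poly_line_poly)

lemma real_polynomial_function_form_fun: "real_polynomial_function (form_fun g)"
proof -
  have "real_polynomial_function (\<lambda>x::real ^ 'a. \<Sum>m\<in>Poly_Mapping.keys g. Poly_Mapping.lookup g m *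
      (\<Prod>i\<in>Poly_Mapping.keys m. (x $ i) ^ Poly_Mapping.lookup m i))"
    by (intro real_polynomial_function_sum real_polynomial_function_prod real_polynomial_function_power
        real_polynomial_function.intros bounded_linear_vec_nth) auto
  then show ?thesis by (simp add: form_fun_def[abs_def] rpoly_eval_def)
qed

lemma real_polynomial_function_has_partial_derivs:
  fixes f :: "real ^ 'n::finite \<Rightarrow> real"
  assumes "real_polynomial_function f"
  shows "\<exists>D. (\<forall>i. real_polynomial_function (D i)) \<and>
    (\<forall>x. (f has_derivative (\<lambda>h. \<Sum>i\<in>UNIV. h $ i * D i x)) (at x))"
  using assms
proof induction
  case (linear f)
  have "f = (\<lambda>h. \<Sum>i\<in>UNIV. h $ i * f (axis i 1))"
  proof
    fix h
    have "f h = f (\<Sum>i\<in>UNIV. (h $ i) *\<^sub>R axis i 1)"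
      by (simp add: basis_expansion flip: scalar_mult_eq_scaleR)
    also have "\<dots> = (\<Sum>i\<in>UNIV. h $ i * f (axis i 1))"
      using bounded_linear.linear[OF linear] by (simp add: linear_sum linear_scale)
    finally show "f h = (\<Sum>i\<in>UNIV. h $ i * f (axis i 1))" .
  qed
  then show ?case
    using bounded_linear_imp_has_derivative[OF linear]
    by (intro exI[of _ "\<lambda>i _. f (axis i 1)"]) (auto)
next
  case (const c)
  show ?case by (intro exI[of _ "\<lambda>i _. 0"]) auto
next
  case (add f g)
  then obtain D E where D: "\<And>i. real_polynomial_function (D i)"
      "\<And>x. (f has_derivative (\<lambda>h. \<Sum>i\<in>UNIV. h $ i * D i x)) (at x)"
      "\<And>i. real_polynomial_function (E i)"
      "\<And>x. (g has_derivative (\<lambda>h. \<Sum>i\<in>UNIV. h $ i * E i x)) (at x)" by blast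
  show ?case
    using D(1,3) has_derivative_add[OF D(2,4)]
    by (intro exI[of _ "\<lambda>i x. D i x + E i x"]) (auto simp: distrib_left sum.distrib)
next
  case (mult f g)
  then obtain D E where D: "\<And>i. real_polynomial_function (D i)"
      "\<And>x. (f has_derivative (\<lambda>h. \<Sum>i\<in>UNIV. h $ i * D i x)) (at x)"
      "\<And>i. real_polynomial_function (E i)"
      "\<And>x. (g has_derivative (\<lambda>h. \<Sum>i\<in>UNIV. h $ i * E i x)) (at x)" by blast
  have "(\<lambda>h. f x * (\<Sum>i\<in>UNIV. h $ i * E i x) + (\<Sum>i\<in>UNIV. h $ i * D i x) * g x) =
      (\<lambda>h. \<Sum>i\<in>UNIV. h $ i * (f x * E i x + D i x * g x))" for x
    by (simp add: sum_distrib_left sum_distrib_right distrib_left sum.distrib mult_ac)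
  then show ?case
    using D(1,3) mult.hyps has_derivative_mult[OF D(2,4)]
    by (intro exI[of _ "\<lambda>i x. f x * E i x + D i x * g x"])
      (auto intro!: real_polynomial_function.intros(3,4))
qed

lemma has_derivative_along_line:
  fixes f :: "real ^ 'n::finite \<Rightarrow> real"
  assumes "\<And>x. (f has_derivative (\<lambda>h. \<Sum>i\<in>UNIV. h $ i * D i x)) (at x)"
  shows "((\<lambda>t. f (x + t *\<^sub>R v)) has_real_derivative (\<Sum>i\<in>UNIV. v $ i * D i (x + t *\<^sub>R v))) (at t)"
proof -
  have "((\<lambda>t. x + t *\<^sub>R v) has_derivative (\<lambda>s. s *\<^sub>R v)) (at t)"
    by (auto intro!: derivative_eq_intros)
  from has_derivative_compose[OF this assms]
  have "((\<lambda>t. f (x + t *\<^sub>R v)) has_derivative (\<lambda>s. \<Sum>i\<in>UNIV. (s *\<^sub>R v) $ i * D i (x + t *\<^sub>R v))) (at t)" .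
  moreover have "(\<lambda>s. \<Sum>i\<in>UNIV. (s *\<^sub>R v) $ i * D i (x + t *\<^sub>R v)) = (*) (\<Sum>i\<in>UNIV. v $ i * D i (x + t *\<^sub>R v))"
    by (rule ext) (simp add: sum_distrib_left mult_ac)
  ultimately show ?thesis by (simp only: has_field_derivative_def)
qed

lemma partial_deriv_eqI:
  fixes f :: "real ^ 'n::finite \<Rightarrow> real"
  assumes "\<And>x. (f has_derivative (\<lambda>h. \<Sum>i\<in>UNIV. h $ i * D i x)) (at x)"
  shows "partial_deriv i f = D i"
proof
  fix x
  have "(\<Sum>j\<in>UNIV. axis i 1 $ j * D j x) = D i x"
    by (simp add: axis_def if_distrib[of "\<lambda>a. a * b" for b] sum.delta cong: if_cong)
  then have "((\<lambda>t. f (x + t *\<^sub>R axis i 1)) has_real_derivative D i x) (at 0)"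
    using has_derivative_along_line[OF assms, of x "axis i 1" 0] by simp
  then show "partial_deriv i f x = D i x"
    unfolding partial_deriv_def by (rule DERIV_imp_deriv)
qed

text \<open>Both sides are the second derivative of g(x + t v) at t = 0. From here on the Hessian is
  replaced by a coefficient that is polynomial in the coefficients of g, in x and in v.\<close>

lemma hessian_quadratic_form:
  "v \<bullet> (hessian (form_fun g) x *v v) = 2 * coeff (line_poly g x v) 2"
proof -
  obtain D where D: "\<And>i. real_polynomial_function (D i)"
    "\<And>x. (form_fun g has_derivative (\<lambda>h. \<Sum>i\<in>UNIV. h $ i * D i x)) (at x)"
    using real_polynomial_function_has_partial_derivs[OF real_polynomial_function_form_fun[of g]] by blast
  have "\<forall>i. \<exists>E. (\<forall>x. (D i has_derivative (\<lambda>h. \<Sum>j\<in>UNIV. h $ j * E j x)) (at x))"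
    using real_polynomial_function_has_partial_derivs[OF D(1)] by blast
  then obtain E where E: "\<And>i x. (D i has_derivative (\<lambda>h. \<Sum>j\<in>UNIV. h $ j * E i j x)) (at x)"
    by metis
  define P where "P = line_poly g x v"
  have P: "poly P = (\<lambda>t. form_fun g (x + t *\<^sub>R v))" by (auto simp: P_def poly_line_poly)
  have P': "poly (pderiv P) = (\<lambda>t. \<Sum>i\<in>UNIV. v $ i * D i (x + t *\<^sub>R v))"
  proof
    fix t
    show "poly (pderiv P) t = (\<Sum>i\<in>UNIV. v $ i * D i (x + t *\<^sub>R v))"
      using DERIV_unique[OF poly_DERIV[of P t]] has_derivative_along_line[OF D(2), of x v t] P by simp
  qed
  have "((\<lambda>t. \<Sum>i\<in>UNIV. v $ i * D i (x + t *\<^sub>R v)) has_real_derivative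
      (\<Sum>i\<in>UNIV. v $ i * (\<Sum>j\<in>UNIV. v $ j * E i j (x + 0 *\<^sub>R v)))) (at 0)"
    by (intro DERIV_sum DERIV_cmult has_derivative_along_line E)
  then have "poly (pderiv (pderiv P)) 0 = (\<Sum>i\<in>UNIV. v $ i * (\<Sum>j\<in>UNIV. v $ j * E i j x))"
    using DERIV_unique[OF poly_DERIV[of "pderiv P" 0]] P' by simp
  moreover have "poly (pderiv (pderiv P)) 0 = 2 * coeff P 2"
    by (simp add: poly_0_coeff_0 coeff_pderiv numeral_2_eq_2)
  moreover have "hessian (form_fun g) x $ i $ j = E j i x" for i j
    by (simp add: hessian_def partial_deriv_eqI[OF D(2)] partial_deriv_eqI[OF E])
  then have "v \<bullet> (hessian (form_fun g) x *v v) = (\<Sum>j\<in>UNIV. v $ j * (\<Sum>i\<in>UNIV. v $ i * E j i x))"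
  proof -
    have "v \<bullet> (hessian (form_fun g) x *v v) = (\<Sum>i\<in>UNIV. \<Sum>j\<in>UNIV. v $ i * (E j i x * v $ j))"
      using \<open>\<And>j i. hessian (form_fun g) x $ i $ j = E j i x\<close>
      by (simp add: inner_vec_def matrix_vector_mult_def sum_distrib_left)
    also have "\<dots> = (\<Sum>j\<in>UNIV. \<Sum>i\<in>UNIV. v $ i * (E j i x * v $ j))" by (rule sum.swap)
    finally show ?thesis by (simp add: sum_distrib_left mult_ac)
  qed
  ultimately show ?thesis by (simp add: P_def)
qed

text \<open>The inequality \<open>\<le> 0\<close> is the literal negation of the condition in
  \<open>generic\<close> and is a closed condition on all forms. For nonnegative forms it amounts to
  the vanishing of the coefficient.\<close>

definition degenerate_zero :: "'n::finite rpoly \<Rightarrow> real ^ 'n \<Rightarrow> real ^ 'n \<Rightarrow> bool" where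
  "degenerate_zero g x v \<longleftrightarrow> x \<noteq> 0 \<and> form_fun g x = 0 \<and> v \<noteq> 0 \<and> v \<bullet> x = 0 \<and> coeff (line_poly g x v) 2 \<le> 0"

lemma generic_iff: "generic g \<longleftrightarrow> \<not> (\<exists>x v. degenerate_zero g x v)"
  unfolding generic_def degenerate_zero_def hessian_quadratic_form by (auto simp: not_le)

section \<open>The boundary of the cone of positive forms\<close>

text \<open>Writing p(t) = t (a + t q(t)), nonnegativity near 0 from the right gives a >= 0 and from
  the left a <= 0. Then p(t) = t^2 q(t), and letting t tend to 0 gives q(0) >= 0.\<close>

lemma coeff_poly_nonneg_zero:
  fixes p :: "real poly"
  assumes nonneg: "\<And>t. poly p t \<ge> 0" and "coeff p 0 = 0"
  shows "coeff p 1 = 0" "coeff p 2 \<ge> 0"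
proof -
  have at_0: "poly q 0 \<ge> 0" if "\<And>t. t > 0 \<Longrightarrow> poly q t \<ge> 0" for q :: "real poly"
  proof (rule tendsto_lowerbound)
    show "(poly q \<longlongrightarrow> poly q 0) (at_right 0)"
      by (rule tendsto_within_subset[of _ _ _ UNIV]) (auto intro!: isCont_tendsto_compose[of _ "poly q"] tendsto_ident_at)
    show "\<forall>\<^sub>F t in at_right 0. 0 \<le> poly q t"
      using that by (auto simp: eventually_at_filter)
  qed auto
  obtain a q where p: "p = pCons 0 (pCons a q)"
    using assms(2) by (metis coeff_pCons_0 pCons_cases)
  have p_eq: "poly p t = t * (a + t * poly q t)" for t by (simp add: p)
  have "poly (pCons a q) 0 \<ge> 0"
    by (rule at_0) (use nonneg p_eq in \<open>force simp: zero_le_mult_iff\<close>)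
  moreover have "poly (- (pCons a q) \<circ>\<^sub>p [:0, - 1:]) 0 \<ge> 0"
  proof (rule at_0)
    fix t :: real assume "t > 0"
    then show "poly (- (pCons a q) \<circ>\<^sub>p [:0, - 1:]) t \<ge> 0"
      using nonneg[of "- t"] p_eq[of "- t"] by (auto simp: poly_pcompose zero_le_mult_iff mult_le_0_iff)
  qed
  ultimately have a: "a = 0" by (simp add: poly_pcompose)
  then show "coeff p 1 = 0" by (simp add: p)
  have "poly q 0 \<ge> 0"
    by (rule at_0) (use nonneg p_eq a in \<open>force simp: zero_le_mult_iff\<close>)
  then show "coeff p 2 \<ge> 0" by (simp add: p numeral_2_eq_2 poly_0_coeff_0)
qed

lemma coeff_line_poly_nonneg:
  assumes "\<And>y. form_fun g y \<ge> 0" "form_fun g x = 0"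
  shows "coeff (line_poly g x v) 1 = 0" "coeff (line_poly g x v) 2 \<ge> 0"
proof -
  have "coeff (line_poly g x v) 0 = 0"
    using poly_line_poly[of g x v 0] assms(2) by (simp add: poly_0_coeff_0)
  then show "coeff (line_poly g x v) 1 = 0" "coeff (line_poly g x v) 2 \<ge> 0"
    using coeff_poly_nonneg_zero[of "line_poly g x v"] assms(1) by (auto simp: poly_line_poly)
qed

lemma line_poly_scaleR:
  assumes "g \<in> forms d" "r \<noteq> 0"
  shows "line_poly g (r *\<^sub>R x) (s *\<^sub>R v) = smult (r ^ d) (line_poly g x v \<circ>\<^sub>p [:0, s / r:])"
proof (rule line_poly_eqI)
  fix t
  have "form_fun g (r *\<^sub>R x + t *\<^sub>R s *\<^sub>R v) = form_fun g (r *\<^sub>R (x + (t * (s / r)) *\<^sub>R v))"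
    using assms(2) by (simp add: scaleR_add_right)
  then show "form_fun g (r *\<^sub>R x + t *\<^sub>R s *\<^sub>R v) = poly (smult (r ^ d) (line_poly g x v \<circ>\<^sub>p [:0, s / r:])) t"
    by (simp add: form_fun_scaleR[OF assms(1)] poly_pcompose poly_line_poly mult.commute)
qed

lemma degenerate_zero_scaleR:
  assumes "g \<in> forms d" "degenerate_zero g x v" "r > 0" "s \<noteq> 0"
  shows "degenerate_zero g (r *\<^sub>R x) (s *\<^sub>R v)"
  using assms
  by (auto simp: degenerate_zero_def form_fun_scaleR line_poly_scaleR coeff_pcompose_linear
      mult_nonneg_nonpos)

text \<open>The algebra \<open>A\<close> will be that of polynomial functions and that of continuous functions.\<close>

lemma function_algebra_coeff_prod:
  assumes A: "function_algebra A" and p: "\<And>j i. j \<in> J \<Longrightarrow> (\<lambda>x. coeff (p j x) i) \<in> A"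
  shows "(\<lambda>x. coeff (\<Prod>j\<in>J. p j x) i) \<in> A"
  using p
proof (induction J arbitrary: i rule: infinite_finite_induct)
  case (insert j J)
  have "(\<lambda>x. \<Sum>k\<le>i. coeff (p j x) k * coeff (\<Prod>j\<in>J. p j x) (i - k)) \<in> A"
    by (intro function_algebra_sum function_algebra_mult A) (use insert in auto)
  then show ?case using insert by (simp add: coeff_mult)
qed (auto simp: intro: function_algebra_const[OF A])

lemma line_poly_form_of:
  "line_poly (form_of d c) x v = (\<Sum>\<beta>\<in>exponents d. smult (c \<beta>)
     (\<Prod>i\<in>UNIV. \<Prod>k<Poly_Mapping.lookup \<beta> i. [:x $ i, v $ i:]))"
  by (rule line_poly_eqI) (simp add: form_fun_form_of power_product_def poly_sum poly_prod)

lemma function_algebra_form: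
  assumes A: "function_algebra A"
    and c: "\<And>\<beta>. \<beta> \<in> exponents d \<Longrightarrow> (\<lambda>p. c p \<beta>) \<in> A"
    and x: "\<And>i. (\<lambda>p. x p $ i) \<in> A"
  shows function_algebra_form_fun: "(\<lambda>p. form_fun (form_of d (c p)) (x p)) \<in> A"
    and function_algebra_coeff_line_poly: "(\<And>i. (\<lambda>p. v p $ i) \<in> A) \<Longrightarrow>
      (\<lambda>p. coeff (line_poly (form_of d (c p)) (x p) (v p)) k) \<in> A"
proof -
  show "(\<lambda>p. form_fun (form_of d (c p)) (x p)) \<in> A"
    unfolding form_fun_form_of power_product_def
    by (intro function_algebra_sum function_algebra_mult function_algebra_prod function_algebra_power A c x)
  assume v: "\<And>i. (\<lambda>p. v p $ i) \<in> A"
  have lin: "(\<lambda>p. coeff [:x p $ i, v p $ i:] k) \<in> A" for i k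
  proof -
    consider "k = 0" | "k = Suc 0" | l where "k = Suc (Suc l)" by (metis not0_implies_Suc)
    then show ?thesis
      using x[of i] v[of i] function_algebra_const[OF A, of 0] by cases auto
  qed
  show "(\<lambda>p. coeff (line_poly (form_of d (c p)) (x p) (v p)) k) \<in> A"
    unfolding line_poly_form_of coeff_sum coeff_smult
    by (intro function_algebra_sum function_algebra_mult function_algebra_coeff_prod A c lin)
qed

section \<open>The topology of the space of forms and the closure of the positive cone\<close>

lemma abs_lookup_diff_le_form_dist:
  assumes "\<alpha> \<in> exponents d"
  shows "\<bar>Poly_Mapping.lookup g \<alpha> - Poly_Mapping.lookup h \<alpha>\<bar> \<le> sqrt (multinomial d \<alpha>) * form_dist d g h"
proof -
  have pos: "multinomial d \<alpha> > 0"
    by (auto simp: multinomial_def intro!: divide_pos_pos prod_pos)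
  have "sqrt (inverse (multinomial d \<alpha>)) * \<bar>Poly_Mapping.lookup g \<alpha> - Poly_Mapping.lookup h \<alpha>\<bar>
      \<le> form_dist d g h"
    using member_le_L2_set[OF finite_exponents assms,
        of "\<lambda>\<alpha>. \<bar>sqrt (inverse (multinomial d \<alpha>)) * (form_coeffs g \<alpha> - form_coeffs h \<alpha>)\<bar>"] pos
    by (simp add: form_dist_eq form_coeffs_def abs_mult L2_set_def power_mult_distrib)
  then have "sqrt (multinomial d \<alpha>) * (sqrt (inverse (multinomial d \<alpha>)) *
      \<bar>Poly_Mapping.lookup g \<alpha> - Poly_Mapping.lookup h \<alpha>\<bar>) \<le> sqrt (multinomial d \<alpha>) * form_dist d g h"
    using pos by (intro mult_left_mono) auto
  moreover have "sqrt (multinomial d \<alpha>) * sqrt (inverse (multinomial d \<alpha>)) = 1"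
    using pos by (simp flip: real_sqrt_mult)
  ultimately show ?thesis by (simp only: mult.assoc[symmetric] mult_1)
qed

lemma topspace_form_topology: "topspace (form_topology d) = forms d"
  unfolding form_topology_def by (rule Metric_space.topspace_mtopology[OF Metric_space_forms])

lemma continuous_map_lookup:
  assumes "\<alpha> \<in> exponents d"
  shows "continuous_map (form_topology d) euclideanreal (\<lambda>g. Poly_Mapping.lookup g \<alpha>)"
proof -
  interpret Metric_space "forms d :: 'a rpoly set" "form_dist d" by (rule Metric_space_forms)
  have "openin mtopology {g \<in> forms d. Poly_Mapping.lookup g \<alpha> \<in> V}" if "open V" for V
    unfolding openin_mtopology
  proof (intro conjI allI impI)
    fix g assume g: "g \<in> {g \<in> forms d. Poly_Mapping.lookup g \<alpha> \<in> V}"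
    then obtain e where e: "e > 0" "\<And>y. \<bar>y - Poly_Mapping.lookup g \<alpha>\<bar> < e \<Longrightarrow> y \<in> V"
      using \<open>open V\<close> by (auto simp: open_dist dist_real_def)
    define C where "C = sqrt (multinomial d \<alpha>)"
    have C: "C > 0" by (auto simp: C_def multinomial_def intro!: divide_pos_pos prod_pos)
    have "mball g (e / C) \<subseteq> {g \<in> forms d. Poly_Mapping.lookup g \<alpha> \<in> V}"
    proof
      fix h assume h: "h \<in> mball g (e / C)"
      then have "C * form_dist d g h < e" using C by (simp add: in_mball field_simps)
      then have "\<bar>Poly_Mapping.lookup h \<alpha> - Poly_Mapping.lookup g \<alpha>\<bar> < e"
        using abs_lookup_diff_le_form_dist[OF assms, of g h] by (simp add: C_def abs_minus_commute)
      then show "h \<in> {g \<in> forms d. Poly_Mapping.lookup g \<alpha> \<in> V}" using h e by (simp add: in_mball)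
    qed
    then show "\<exists>r>0. mball g r \<subseteq> {g \<in> forms d. Poly_Mapping.lookup g \<alpha> \<in> V}"
      using e C by (intro exI[of _ "e / C"]) simp
  qed auto
  then show ?thesis
    by (simp add: continuous_map_def form_topology_def)
qed

lemma function_algebra_continuous_map: "function_algebra {f. continuous_map X euclideanreal f}"
  by (simp add: function_algebra_def continuous_map_add continuous_map_real_mult)

lemma form_dist_form_of_add:
  assumes "g \<in> forms d"
  shows "form_dist d g (form_of d (\<lambda>\<beta>. Poly_Mapping.lookup g \<beta> + e * Poly_Mapping.lookup h \<beta>)) =
    \<bar>e\<bar> * form_dist d h 0"
proof -
  have "form_dist d g (form_of d (\<lambda>\<beta>. Poly_Mapping.lookup g \<beta> + e * Poly_Mapping.lookup h \<beta>)) =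
      L2_set (\<lambda>\<alpha>. - e * (sqrt (inverse (multinomial d \<alpha>)) * Poly_Mapping.lookup h \<alpha>)) (exponents d)"
    unfolding form_dist_eq
    by (rule L2_set_cong) (auto simp: form_coeffs_def lookup_form_of)
  also have "\<dots> = \<bar>e\<bar> * form_dist d h 0"
    by (simp add: form_dist_eq form_coeffs_def L2_set_def power_mult_distrib real_sqrt_mult flip: sum_distrib_left)
  finally show ?thesis .
qed

lemma form_fun_form_of_add:
  assumes "g \<in> forms d" "h \<in> forms d"
  shows "form_fun (form_of d (\<lambda>\<beta>. Poly_Mapping.lookup g \<beta> + e * Poly_Mapping.lookup h \<beta>)) y =
    form_fun g y + e * form_fun h y"
  by (simp add: form_fun_form_of form_fun_eq_sum[OF assms(1)] form_fun_eq_sum[OF assms(2)]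
      sum.distrib sum_distrib_left algebra_simps)

lemma form_family_inner:
  assumes "function_algebra A"
  shows "form_family A 1 (\<lambda>x y. y \<bullet> z)"
proof -
  have "form_family A 1 (\<lambda>x y. \<Sum>i\<in>UNIV. z $ i * y $ i)"
    by (intro form_family_sum form_family_cmult form_family_var function_algebra_const assms)
  then show ?thesis by (simp add: inner_vec_def mult.commute)
qed

lemma form_family_norm_square:
  assumes "function_algebra A"
  shows "form_family A 2 (\<lambda>x y. y \<bullet> y)"
proof -
  have "form_family A (1 + 1) (\<lambda>x y. \<Sum>i\<in>UNIV. y $ i * y $ i)"
    by (intro form_family_sum form_family_mult form_family_var assms)
  then show ?thesis by (simp add: inner_vec_def numeral_2_eq_2)
qed

lemma norm_power_form_exists:
  "\<exists>h\<in>forms (2 * m). \<forall>y::real ^ 'n::finite. form_fun h y = (y \<bullet> y) ^ m"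
proof -
  have "form_family UNIV (m * 2) (\<lambda>(_::unit) y::real ^ 'n. (y \<bullet> y) ^ m)"
    by (intro form_family_power form_family_norm_square function_algebra_UNIV)
  from form_family_imp_form[OF this] show ?thesis by (simp add: mult.commute)
qed

lemma exists_pos_mult_less:
  fixes r K :: real
  assumes "r > 0" "K \<ge> 0"
  shows "\<exists>e>0. e * K < r"
  using assms by (intro exI[of _ "r / (K + 1)"]) (simp add: pos_divide_less_eq)

text \<open>Adding a small positive multiple of |y|^d, which is a form because d is even, makes a
  nonnegative form strictly positive away from the origin.\<close>

lemma in_closure_pos_cone:
  assumes "even d" and g: "g \<in> forms d" "\<And>y. form_fun g y \<ge> 0"
  shows "g \<in> form_topology d closure_of pos_cone d"
proof -
  interpret Metric_space "forms d :: 'a rpoly set" "form_dist d" by (rule Metric_space_forms)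
  obtain m where d: "d = 2 * m" using \<open>even d\<close> by blast
  obtain h :: "'a rpoly" where h: "h \<in> forms d" "\<And>y. form_fun h y = (y \<bullet> y) ^ m"
    using norm_power_form_exists[of m] d by blast
  have "\<exists>f\<in>pos_cone d. f \<in> mball g r" if "r > 0" for r
  proof -
    have "form_dist d h 0 \<ge> 0" by (simp add: form_dist_eq)
    from exists_pos_mult_less[OF \<open>r > 0\<close> this] obtain e where e: "e > 0" "e * form_dist d h 0 < r"
      by blast
    define f where "f = form_of d (\<lambda>\<beta>. Poly_Mapping.lookup g \<beta> + e * Poly_Mapping.lookup h \<beta>)"
    have "form_fun f y > 0" if "y \<noteq> 0" for y
    proof -
      have "form_fun h y > 0" using that by (simp add: h(2))
      then show ?thesis using g(2)[of y] e(1)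
        by (simp add: f_def form_fun_form_of_add[OF g(1) h(1)] add_nonneg_pos)
    qed
    then have "f \<in> pos_cone d" by (simp add: pos_cone_def f_def)
    moreover have "f \<in> mball g r"
      using form_dist_form_of_add[OF g(1), of e h] e g(1) by (simp add: in_mball f_def)
    ultimately show ?thesis by blast
  qed
  then show ?thesis using g(1) by (simp add: form_topology_def metric_closure_of)
qed

lemma closure_pos_cone_nonneg:
  assumes "g \<in> form_topology d closure_of pos_cone d" "d > 0"
  shows "g \<in> forms d" "form_fun g y \<ge> 0"
proof -
  show gd: "g \<in> forms d"
    using assms(1) closure_of_subset_topspace[of "form_topology d"] topspace_form_topology[of d] by blast
  \<comment> \<open>Going through \<open>form_of\<close> restricts the coefficients to the exponents
    of degree d, whose coordinate functions are known to be continuous; on \<open>forms d\<close>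
    this changes nothing.\<close>
  have "(\<lambda>g. form_fun (form_of d (Poly_Mapping.lookup g)) y) \<in>
      {f. continuous_map (form_topology d) euclideanreal f}"
    by (rule function_algebra_form_fun[OF function_algebra_continuous_map]) (auto simp: continuous_map_lookup)
  then have "closedin (form_topology d)
      {g \<in> topspace (form_topology d). form_fun (form_of d (Poly_Mapping.lookup g)) y \<in> {0..}}"
    by (intro closedin_continuous_map_preimage[of _ euclideanreal]) auto
  moreover have "form_fun g y \<ge> 0" if "g \<in> pos_cone d" for g
  proof (cases "y = 0")
    case True
    have "form_fun g (0 *\<^sub>R y) = 0"
      by (subst form_fun_scaleR[of _ d]) (use that \<open>d > 0\<close> in \<open>auto simp: pos_cone_def\<close>)
    then show ?thesis using True by simp
  next
    case False
    then show ?thesis using that by (auto simp: pos_cone_def intro: less_imp_le)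
  qed
  then have "pos_cone d \<subseteq> {g \<in> topspace (form_topology d). form_fun (form_of d (Poly_Mapping.lookup g)) y \<in> {0..}}"
    by (auto simp: topspace_form_topology pos_cone_def form_of_lookup)
  ultimately have "g \<in> {g \<in> topspace (form_topology d). form_fun (form_of d (Poly_Mapping.lookup g)) y \<in> {0..}}"
    using assms(1) closure_of_minimal by blast
  then show "form_fun g y \<ge> 0" using gd by (simp add: form_of_lookup)
qed

lemma pos_cone_boundary_iff:
  assumes "even d" "d > 0"
  shows "g \<in> pos_cone_boundary d \<longleftrightarrow>
    g \<in> forms d \<and> (\<forall>y. form_fun g y \<ge> 0) \<and> (\<exists>x. x \<noteq> 0 \<and> form_fun g x = 0)"
proof -
  have "g \<in> form_topology d closure_of pos_cone d \<longleftrightarrow> g \<in> forms d \<and> (\<forall>y. form_fun g y \<ge> 0)"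
    using in_closure_pos_cone[OF assms(1)] closure_pos_cone_nonneg[OF _ assms(2)] by blast
  then show ?thesis
    unfolding pos_cone_boundary_def pos_cone_def by (auto simp: less_le)
qed

lemma nongeneric_boundary_iff:
  assumes "even d" "d > 0"
  shows "g \<in> nongeneric_boundary d \<longleftrightarrow>
    g \<in> forms d \<and> (\<forall>y. form_fun g y \<ge> 0) \<and> (\<exists>x v. degenerate_zero g x v)"
  unfolding nongeneric_boundary_def mem_Collect_eq pos_cone_boundary_iff[OF assms] generic_iff
  by (auto simp: degenerate_zero_def)

text \<open>Rescaling a degenerate zero and its direction to unit length makes the parameters range over a
  compact set.\<close>

lemma closedin_degenerate_forms:
  "closedin (form_topology d) {g \<in> forms d. \<exists>x v :: real ^ 'n::finite. degenerate_zero g x v}"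
proof -
  define S where "S = (sphere 0 1 \<times> sphere 0 1 :: ((real ^ 'n) \<times> (real ^ 'n)) set)"
  define K where "K = top_of_set S"
  define X where "X = prod_topology (form_topology d :: 'n rpoly topology) K"
  define A where "A = {f. continuous_map X euclideanreal f}"
  have A: "function_algebra A" unfolding A_def by (rule function_algebra_continuous_map)
  have "compact_space K"
    unfolding K_def by (rule compact_space_subtopology) (simp add: S_def compact_Times)
  then have cm: "closed_map X (form_topology d) fst"
    unfolding X_def by (rule Abstract_Topological_Spaces.closed_map_fst)
  have tX: "topspace X = forms d \<times> S" by (simp add: X_def K_def topspace_form_topology)
  have c: "(\<lambda>p. Poly_Mapping.lookup (fst p) \<beta>) \<in> A" if "\<beta> \<in> exponents d" for \<beta>
    using continuous_map_compose[OF continuous_map_fst continuous_map_lookup[OF that]]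
    by (simp add: A_def X_def o_def)
  have snd: "(\<lambda>p. f (snd p)) \<in> A" if "continuous_on UNIV f" for f
  proof -
    have "continuous_map K euclideanreal f"
      unfolding K_def using that by (intro continuous_map_from_subtopology) simp
    from continuous_map_compose[OF continuous_map_snd this] show ?thesis
      by (simp add: A_def X_def o_def)
  qed
  have x: "(\<lambda>p. fst (snd p) $ i) \<in> A" and v: "(\<lambda>p. snd (snd p) $ i) \<in> A" for i
    by (rule snd, intro continuous_intros)+
  define F where "F p = form_fun (form_of d (Poly_Mapping.lookup (fst p))) (fst (snd p))" for p :: "'n rpoly \<times> (real ^ 'n) \<times> (real ^ 'n)"
  define G where "G p = coeff (line_poly (form_of d (Poly_Mapping.lookup (fst p))) (fst (snd p)) (snd (snd p))) 2"
    for p :: "'n rpoly \<times> (real ^ 'n) \<times> (real ^ 'n)"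
  define I where "I p = snd (snd p) \<bullet> fst (snd p)" for p :: "'n rpoly \<times> (real ^ 'n) \<times> (real ^ 'n)"
  have "F \<in> A" unfolding F_def[abs_def] by (rule function_algebra_form_fun[OF A c x])
  moreover have "G \<in> A" unfolding G_def[abs_def] by (rule function_algebra_coeff_line_poly[OF A c x v])
  moreover have "I \<in> A" unfolding I_def[abs_def] by (rule snd, intro continuous_intros)
  ultimately have "closedin X ({p \<in> topspace X. F p \<in> {0}} \<inter> {p \<in> topspace X. G p \<in> {..0}} \<inter>
      {p \<in> topspace X. I p \<in> {0}})" (is "closedin X ?Z")
    unfolding A_def
    by (intro closedin_Int closedin_continuous_map_preimage[of _ euclideanreal]) auto
  then have "closedin (form_topology d) (fst ` ?Z)"
    using cm by (auto simp: closed_map_def)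
  also have "fst ` ?Z = {g \<in> forms d. \<exists>x v. degenerate_zero g x v}"
  proof (intro equalityI subsetI)
    fix g assume "g \<in> fst ` ?Z"
    then obtain x v where "(g, x, v) \<in> ?Z" by auto
    then have "g \<in> forms d" "degenerate_zero g x v"
      by (auto simp: tX F_def G_def I_def degenerate_zero_def form_of_lookup S_def)
    then show "g \<in> {g \<in> forms d. \<exists>x v. degenerate_zero g x v}" by blast
  next
    fix g assume "g \<in> {g \<in> forms d. \<exists>x v :: real ^ 'n. degenerate_zero g x v}"
    then obtain x v where g: "g \<in> forms d" "degenerate_zero g x v" by blast
    then have nz: "x \<noteq> 0" "v \<noteq> 0" by (auto simp: degenerate_zero_def)
    have "degenerate_zero g (inverse (norm x) *\<^sub>R x) (inverse (norm v) *\<^sub>R v)"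
      using g nz by (intro degenerate_zero_scaleR) auto
    then have "(g, inverse (norm x) *\<^sub>R x, inverse (norm v) *\<^sub>R v) \<in> ?Z"
      using g(1) nz by (simp add: tX F_def G_def I_def S_def degenerate_zero_def form_of_lookup)
    then show "g \<in> fst ` ?Z" by (rule image_eqI[rotated]) simp
  qed
  finally show ?thesis .
qed

text \<open>The perturbing form \<open>(|y|\<^sup>2 |x|\<^sup>2 - (y \<bullet> x)\<^sup>2) |y|\<^bsup>d-2\<^esup>\<close> vanishes exactly on the line
  through \<open>x\<close> and is nondegenerate there.\<close>

lemma generic_perturbation:
  fixes g :: "'n::finite rpoly"
  assumes d: "even d" "d \<ge> 2" and g: "g \<in> forms d" "\<And>y. form_fun g y \<ge> 0"
    and x: "x \<noteq> 0" "form_fun g x = 0"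
  shows "\<exists>h\<in>forms d. \<forall>e>0. let f = form_of d (\<lambda>\<beta>. Poly_Mapping.lookup g \<beta> + e * Poly_Mapping.lookup h \<beta>)
    in f \<in> pos_cone_boundary d \<and> generic f"
proof -
  obtain k where "d = 2 * k" using d(1) by blast
  then obtain m where m: "d = 2 + 2 * m" using d(2) by (intro that[of "k - 1"]) auto
  define H where "H y = ((x \<bullet> x) * (y \<bullet> y) + (- 1) * (y \<bullet> x) ^ 2) * (y \<bullet> y) ^ m" for y :: "real ^ 'n"
  have inner2: "form_family UNIV 2 (\<lambda>(_::unit) y. (y \<bullet> x) ^ 2)"
    using form_family_power[OF function_algebra_UNIV form_family_inner[OF function_algebra_UNIV, of x], of 2]
    by simp
  have norm2m: "form_family UNIV (2 * m) (\<lambda>(_::unit) y::real ^ 'n. (y \<bullet> y) ^ m)"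
    using form_family_power[OF function_algebra_UNIV form_family_norm_square[OF function_algebra_UNIV], of m]
    by (simp add: mult.commute)
  have "form_family UNIV (2 + 2 * m) (\<lambda>(_::unit). H)"
    unfolding H_def[abs_def]
    by (intro form_family_mult form_family_add form_family_cmult function_algebra_UNIV inner2
        norm2m form_family_norm_square UNIV_I)
  from form_family_imp_form[OF this]
  obtain h where h: "h \<in> forms d" "\<And>y. form_fun h y = H y" using m by auto
  have cs: "(y \<bullet> x) ^ 2 \<le> (x \<bullet> x) * (y \<bullet> y)" for y
    using Cauchy_Schwarz_ineq[of y x] by (simp add: mult.commute)
  have H_nonneg: "H y \<ge> 0" for y using cs[of y] by (simp add: H_def)
  show ?thesis
  proof (intro bexI[of _ h] allI impI h(1))
    fix e :: real assume e: "e > 0"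
    define f where "f = form_of d (\<lambda>\<beta>. Poly_Mapping.lookup g \<beta> + e * Poly_Mapping.lookup h \<beta>)"
    have f: "f \<in> forms d" "\<And>y. form_fun f y = form_fun g y + e * H y"
      by (simp_all add: f_def form_fun_form_of_add[OF g(1) h(1)] h(2))
    have "H x = 0" by (simp add: H_def power2_eq_square)
    then have "f \<in> pos_cone_boundary d"
      using f g(2) x H_nonneg e d by (subst pos_cone_boundary_iff) auto
    moreover have "generic f"
      unfolding generic_iff
    proof
      assume "\<exists>y v. degenerate_zero f y v"
      then obtain y v where yv: "y \<noteq> 0" "form_fun f y = 0" "v \<noteq> 0" "v \<bullet> y = 0" "coeff (line_poly f y v) 2 \<le> 0"
        by (auto simp: degenerate_zero_def)
      have "e * H y \<ge> 0" using e H_nonneg by simp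
      then have g0: "form_fun g y = 0" and "e * H y = 0" using yv(2) f(2)[of y] g(2)[of y] by linarith+
      then have "H y = 0" using e by simp
      then have eq: "(x \<bullet> x) * (y \<bullet> y) = (y \<bullet> x) ^ 2" using yv(1) by (simp add: H_def)
      have yx: "y \<bullet> x \<noteq> 0" using eq x yv(1) by auto
      \<comment> \<open>Equality in the Cauchy-Schwarz inequality makes x and y parallel: the vector
        z, which measures the deviation from this, has norm zero. Hence v, orthogonal to y, is
        orthogonal to x too.\<close>
      have "v \<bullet> x = 0"
      proof -
        define z where "z = (x \<bullet> x) *\<^sub>R y - (y \<bullet> x) *\<^sub>R x"
        have "z \<bullet> z = (x \<bullet> x) * ((x \<bullet> x) * (y \<bullet> y) - (y \<bullet> x) ^ 2)"
          by (simp add: z_def algebra_simps inner_commute power2_eq_square)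
        then have "z = 0" using eq by simp
        then have "v \<bullet> ((x \<bullet> x) *\<^sub>R y) = v \<bullet> ((y \<bullet> x) *\<^sub>R x)" by (simp add: z_def)
        then show ?thesis using yv(4) yx by simp
      qed
      \<comment> \<open>Along y + t v the first factor of H reduces to t^2 |x|^2 |v|^2, because its
        constant part vanishes by \<open>eq\<close> and the terms linear in t vanish by
        orthogonality.\<close>
      define p where "p = [:0, 0, (x \<bullet> x) * (v \<bullet> v):] * [:y \<bullet> y, 0, v \<bullet> v:] ^ m"
      have yv': "y \<bullet> v = 0" using yv(4) by (simp add: inner_commute)
      have "line_poly h y v = p"
      proof (rule line_poly_eqI)
        fix t
        have yy: "(y + t *\<^sub>R v) \<bullet> (y + t *\<^sub>R v) = y \<bullet> y + t * t * (v \<bullet> v)"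
          by (simp add: inner_add_left inner_add_right yv(4) yv')
        have yx: "(y + t *\<^sub>R v) \<bullet> x = y \<bullet> x"
          by (simp add: inner_add_left \<open>v \<bullet> x = 0\<close>)
        show "form_fun h (y + t *\<^sub>R v) = poly p t"
          unfolding h(2) H_def yy yx by (simp add: p_def eq[symmetric] algebra_simps)
      qed
      moreover have "coeff p 2 = (x \<bullet> x) * (v \<bullet> v) * (y \<bullet> y) ^ m"
        by (simp add: p_def numeral_2_eq_2 coeff_0_power)
      ultimately have "coeff (line_poly h y v) 2 > 0" using x yv by simp
      moreover have "line_poly f y v = line_poly g y v + smult e (line_poly h y v)"
        by (rule line_poly_eqI) (simp add: f(2) poly_line_poly h(2))
      moreover have "coeff (line_poly g y v) 2 \<ge> 0" using coeff_line_poly_nonneg(2)[OF g(2) g0] .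
      ultimately have "coeff (line_poly f y v) 2 > 0" using e by (simp add: add_nonneg_pos)
      then show False using yv(5) by simp
    qed
    ultimately show "let f = form_of d (\<lambda>\<beta>. Poly_Mapping.lookup g \<beta> + e * Poly_Mapping.lookup h \<beta>)
      in f \<in> pos_cone_boundary d \<and> generic f"
      by (simp add: f_def)
  qed
qed

lemma nowhere_dense_nongeneric_boundary:
  assumes d: "even d" "d \<ge> 2"
  shows "nowhere_dense_in (subtopology (form_topology d) (pos_cone_boundary d))
    (nongeneric_boundary d :: 'n::finite rpoly set)"
proof -
  interpret Metric_space "forms d :: 'n rpoly set" "form_dist d" by (rule Metric_space_forms)
  define T where "T = subtopology (form_topology d) (pos_cone_boundary d :: 'n rpoly set)"
  define N where "N = (nongeneric_boundary d :: 'n rpoly set)"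
  have d0: "d > 0" using d by simp
  note boundary_iff = pos_cone_boundary_iff[OF d(1) d0]
  have N_eq: "N = {g \<in> forms d. \<exists>x v. degenerate_zero g x v} \<inter> pos_cone_boundary d"
    unfolding N_def by (auto simp: nongeneric_boundary_def generic_iff boundary_iff)
  have "closedin T N"
    unfolding T_def N_eq closedin_subtopology using closedin_degenerate_forms by blast
  moreover have "T interior_of N = {}"
  proof (rule ccontr)
    assume "T interior_of N \<noteq> {}"
    then obtain g where g: "g \<in> T interior_of N" by blast
    obtain V where V: "openin (form_topology d) V" "T interior_of N = V \<inter> pos_cone_boundary d"
      using openin_interior_of[of T N] unfolding T_def openin_subtopology by blast
    have "g \<in> V" "g \<in> pos_cone_boundary d" using g V by auto
    then have gd: "g \<in> forms d" "\<And>y. form_fun g y \<ge> 0" and "\<exists>x. x \<noteq> 0 \<and> form_fun g x = 0"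
      by (auto simp: boundary_iff)
    then obtain x where x: "x \<noteq> 0" "form_fun g x = 0" by blast
    obtain r where r: "r > 0" "mball g r \<subseteq> V"
      using V(1) \<open>g \<in> V\<close> unfolding form_topology_def openin_mtopology by blast
    obtain h where h: "h \<in> forms d"
      "\<And>e f. e > 0 \<Longrightarrow> f = form_of d (\<lambda>\<beta>. Poly_Mapping.lookup g \<beta> + e * Poly_Mapping.lookup h \<beta>) \<Longrightarrow>
        f \<in> pos_cone_boundary d \<and> generic f"
      using generic_perturbation[OF d gd x] unfolding Let_def by blast
    have "form_dist d h 0 \<ge> 0" by (simp add: form_dist_eq)
    from exists_pos_mult_less[OF \<open>r > 0\<close> this] obtain e where e: "e > 0" "e * form_dist d h 0 < r"
      by blast
    define f where "f = form_of d (\<lambda>\<beta>. Poly_Mapping.lookup g \<beta> + e * Poly_Mapping.lookup h \<beta>)"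
    have f: "f \<in> pos_cone_boundary d" "generic f" using h(2)[OF e(1) f_def] by auto
    have "f \<in> mball g r"
      using form_dist_form_of_add[OF gd(1), of e h] e gd(1) by (simp add: in_mball f_def)
    then have "f \<in> T interior_of N" using r f V(2) by blast
    then have "f \<in> N" using interior_of_subset[of T N] by blast
    then show False using f by (simp add: N_def nongeneric_boundary_def)
  qed
  moreover have "N \<subseteq> topspace T"
    by (auto simp: T_def N_eq topspace_form_topology)
  ultimately show ?thesis
    unfolding nowhere_dense_in_def T_def[symmetric] N_def[symmetric] by (simp add: closure_of_closedin)
qed

lemma coord_space_eq_form_coeffs:
  assumes "c \<in> coord_space (exponents d)"
  shows "form_coeffs (form_of d c) = c"
  using assms by (auto simp: form_coeffs_def coord_space_def fun_eq_iff lookup_form_of)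

lemma form_coeffs_in_coord_space:
  assumes "g \<in> forms d"
  shows "form_coeffs g \<in> coord_space (exponents d)"
  using assms by (auto simp: form_coeffs_def coord_space_def forms_def in_keys_iff)

section \<open>Semialgebraicity of the set of non-generic forms\<close>

lemma semialgebraic_nongeneric_boundary:
  fixes d :: nat
  assumes d: "even d" "d > 0"
  shows "semialgebraic (exponents d) (form_coeffs ` (nongeneric_boundary d :: 'n::finite rpoly set))"
proof -
  \<comment> \<open>The variables are the coefficients of the form (\<open>Inl\<close>), the entries
    of a point x and those of a direction v (both under \<open>Inr\<close>). Those in
    \<open>V\<close> are quantified away, and those in \<open>J\<close> remain.\<close>
  define J :: "(('n \<Rightarrow>\<^sub>0 nat) + ('n + 'n)) set" where "J = Inl ` exponents d"
  define V :: "(('n \<Rightarrow>\<^sub>0 nat) + ('n + 'n)) set" where "V = range Inr"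
  define A where "A = polyfun (J \<union> V)"
  define G where "G p = form_of d (\<lambda>\<beta>. p (Inl \<beta>))" for p :: "('n \<Rightarrow>\<^sub>0 nat) + ('n + 'n) \<Rightarrow> real"
  define X where "X p = (\<chi> i. p (Inr (Inl i)))" for p :: "('n \<Rightarrow>\<^sub>0 nat) + ('n + 'n) \<Rightarrow> real"
  define Y where "Y p = (\<chi> i. p (Inr (Inr i)))" for p :: "('n \<Rightarrow>\<^sub>0 nat) + ('n + 'n) \<Rightarrow> real"
  have A: "function_algebra A" unfolding A_def by (rule function_algebra_polyfun)
  have c: "(\<lambda>p. p (Inl \<beta>)) \<in> A" if "\<beta> \<in> exponents d" for \<beta>
    unfolding A_def using that by (intro polyfun_var) (auto simp: J_def)
  have x: "(\<lambda>p. X p $ i) \<in> A" and y: "(\<lambda>p. Y p $ i) \<in> A" for i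
    unfolding A_def X_def Y_def by (auto intro: polyfun_var simp: V_def)
  have inner: "(\<lambda>p. f p \<bullet> g p) \<in> A" if "\<And>i. (\<lambda>p. f p $ i) \<in> A" "\<And>i. (\<lambda>p. g p $ i) \<in> A"
    for f g :: "(('n \<Rightarrow>\<^sub>0 nat) + ('n + 'n) \<Rightarrow> real) \<Rightarrow> real ^ 'n"
    unfolding inner_vec_def inner_real_def by (intro function_algebra_sum function_algebra_mult A that)
  have gX: "(\<lambda>p. form_fun (G p) (X p)) \<in> A"
    unfolding G_def by (rule function_algebra_form_fun[OF A c x])
  have gY: "(\<lambda>p. coeff (line_poly (G p) (X p) (Y p)) 2) \<in> A"
    unfolding G_def by (rule function_algebra_coeff_line_poly[OF A c x y])
  define D where "D = {p. degenerate_zero (G p) (X p) (Y p)}"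
  define P where "P = {p. form_fun (G p) (X p) < 0}"
  have "sgn_determined A (- {p. X p \<bullet> X p = 0} \<inter> {p. form_fun (G p) (X p) = 0} \<inter>
      - {p. Y p \<bullet> Y p = 0} \<inter> {p. Y p \<bullet> X p = 0} \<inter> {p. coeff (line_poly (G p) (X p) (Y p)) 2 \<le> 0})"
    by (intro sgn_determined_Int sgn_determined_compl sgn_determined_eq sgn_determined_le inner x y gX gY)
  also have "- {p. X p \<bullet> X p = 0} \<inter> {p. form_fun (G p) (X p) = 0} \<inter>
      - {p. Y p \<bullet> Y p = 0} \<inter> {p. Y p \<bullet> X p = 0} \<inter> {p. coeff (line_poly (G p) (X p) (Y p)) 2 \<le> 0} = D"
    by (auto simp: D_def degenerate_zero_def)
  finally have D: "sgn_determined A D" .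
  have P: "sgn_determined A P" unfolding P_def by (intro sgn_determined_less gX)
  have finV: "finite V" and JV: "J \<inter> V = {}" by (auto simp: V_def J_def)
  \<comment> \<open>The first set says that the form takes no negative value, the second that it has
    a degenerate zero; by \<open>nongeneric_boundary_iff\<close> this describes the non-generic
    boundary forms.\<close>
  define T where "T = - {p. \<exists>u. override_on p u V \<in> P} \<inter> {p. \<exists>u. override_on p u V \<in> D}"
  have "sgn_determined (polyfun J) T"
    unfolding T_def
    using sgn_determined_ex[OF finV _ JV] D P
    by (intro sgn_determined_Int sgn_determined_compl) (auto simp: A_def)
  then have "semialgebraic (exponents d) {c \<in> coord_space (exponents d). case_sum c (\<lambda>_. 0) \<in> T}"
    unfolding J_def by (rule semialgebraic_if_sgn_determined)
  also have "{c \<in> coord_space (exponents d). case_sum c (\<lambda>_. 0) \<in> T} =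
      form_coeffs ` (nongeneric_boundary d :: 'n rpoly set)"
  proof -
    have G_eq: "G (override_on (case_sum c (\<lambda>_. 0)) u V) = form_of d c" for c u
    proof -
      have "override_on (case_sum c (\<lambda>_. 0)) u V (Inl \<beta>) = c \<beta>" for \<beta>
        by (auto simp: override_on_def V_def)
      then show ?thesis by (simp add: G_def)
    qed
    have X_eq: "X (override_on p u V) = (\<chi> i. u (Inr (Inl i)))" "Y (override_on p u V) = (\<chi> i. u (Inr (Inr i)))"
      for p u by (auto simp: X_def Y_def override_on_def V_def)
    have T_iff: "case_sum c (\<lambda>_. 0) \<in> T \<longleftrightarrow> form_of d c \<in> nongeneric_boundary d" for c
    proof -
      have "(\<exists>u. override_on (case_sum c (\<lambda>_. 0)) u V \<in> P) \<longleftrightarrow> (\<exists>x. form_fun (form_of d c) x < 0)"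
      proof
        assume "\<exists>x. form_fun (form_of d c) x < 0"
        then obtain x where "form_fun (form_of d c) x < 0" ..
        then show "\<exists>u. override_on (case_sum c (\<lambda>_. 0)) u V \<in> P"
          by (intro exI[of _ "case_sum (\<lambda>_. 0) (case_sum (vec_nth x) (\<lambda>_. 0))"]) (simp add: P_def G_eq X_eq)
      qed (auto simp: P_def G_eq X_eq)
      moreover have "(\<exists>u. override_on (case_sum c (\<lambda>_. 0)) u V \<in> D) \<longleftrightarrow>
          (\<exists>x v. degenerate_zero (form_of d c) x v)"
      proof
        assume "\<exists>x v. degenerate_zero (form_of d c) x v"
        then obtain x v where "degenerate_zero (form_of d c) x v" by blast
        then show "\<exists>u. override_on (case_sum c (\<lambda>_. 0)) u V \<in> D"
          by (intro exI[of _ "case_sum (\<lambda>_. 0) (case_sum (vec_nth x) (vec_nth v))"]) (simp add: D_def G_eq X_eq)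
      qed (auto simp: D_def G_eq X_eq)
      ultimately show ?thesis
        unfolding nongeneric_boundary_iff[OF d] T_def by (auto simp: not_less)
    qed
    show ?thesis
    proof (intro equalityI subsetI)
      fix c assume "c \<in> {c \<in> coord_space (exponents d). case_sum c (\<lambda>_. 0) \<in> T}"
      then show "c \<in> form_coeffs ` (nongeneric_boundary d :: 'n rpoly set)"
        using coord_space_eq_form_coeffs[of c d] T_iff[of c] by (intro image_eqI[of _ _ "form_of d c"]) auto
    next
      fix c assume "c \<in> form_coeffs ` (nongeneric_boundary d :: 'n rpoly set)"
      then obtain g where g: "c = form_coeffs g" "g \<in> nongeneric_boundary d" by blast
      then have "g \<in> forms d" by (simp add: nongeneric_boundary_iff[OF d])
      then show "c \<in> {c \<in> coord_space (exponents d). case_sum c (\<lambda>_. 0) \<in> T}"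
        using g T_iff[of c] form_coeffs_in_coord_space[of g d] by (simp add: form_coeffs_def form_of_lookup)
    qed
  qed
  finally show ?thesis .
qed

section \<open>Algebraic dependence and chains of prime ideals\<close>

lemma homogeneous_system_nontrivial_solution:
  fixes a :: "'u \<Rightarrow> 'v \<Rightarrow> real"
  assumes "finite V" "finite U" "card V < card U"
  shows "\<exists>c. (\<exists>u\<in>U. c u \<noteq> 0) \<and> (\<forall>v\<in>V. (\<Sum>u\<in>U. c u * a u v) = 0)"
  using assms
proof (induction V arbitrary: U a rule: finite_induct)
  case empty
  then have "U \<noteq> {}" by auto
  then show ?case by (intro exI[of _ "\<lambda>_. 1"]) auto
next
  case (insert v V)
  show ?case
  proof (cases "\<forall>u\<in>U. a u v = 0")
    case True
    have "card V < card U" using insert.prems insert.hyps by simp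
    from insert.IH[OF insert.prems(1) this, of a] show ?thesis using True by auto
  next
    case False
    then obtain w where w: "w \<in> U" "a w v \<noteq> 0" by blast
    define W where "W = U - {w}"
    have W: "finite W" "w \<notin> W" "U = insert w W" using w insert.prems by (auto simp: W_def)
    then have "card V < card W" using insert.prems insert.hyps by simp
    \<comment> \<open>Gaussian elimination with pivot \<open>a w v\<close>: the unknown at w is
      expressed by the others through equation v and substituted into the remaining
      equations.\<close>
    from insert.IH[OF W(1) this, of "\<lambda>u v'. a u v' - a u v / a w v * a w v'"]
    obtain c where c: "\<exists>u\<in>W. c u \<noteq> 0"
      "\<And>v'. v' \<in> V \<Longrightarrow> (\<Sum>u\<in>W. c u * (a u v' - a u v / a w v * a w v')) = 0" by blast
    define c' where "c' = c(w := - (\<Sum>u\<in>W. c u * a u v) / a w v)"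
    have c'_W: "(\<Sum>u\<in>W. c' u * a u v') = (\<Sum>u\<in>W. c u * a u v')" for v'
      by (rule sum.cong) (use W in \<open>auto simp: c'_def\<close>)
    have "(\<Sum>u\<in>U. c' u * a u v') = 0" if "v' \<in> insert v V" for v'
    proof (cases "v' = v")
      case True
      then show ?thesis using w by (simp add: W c'_W) (simp add: c'_def)
    next
      case False
      then have "(\<Sum>u\<in>W. c u * a u v') = (\<Sum>u\<in>W. c u * (a u v / a w v * a w v'))"
        using c(2)[of v'] that by (simp add: right_diff_distrib sum_subtractf)
      also have "\<dots> = (\<Sum>u\<in>W. c u * a u v) / a w v * a w v'"
        by (simp add: sum_distrib_right sum_divide_distrib mult.assoc)
      finally show ?thesis by (simp add: W c'_W) (simp add: c'_def)
    qed
    moreover have "\<exists>u\<in>U. c' u \<noteq> 0" using c(1) W by (auto simp: c'_def)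
    ultimately show ?thesis by blast
  qed
qed

text \<open>The degree is bounded in each variable separately, so that the number of available
  monomials is exactly (D + 1) to the number of variables; \<open>PiE\<close> gives each exponent
  vector a unique representative.\<close>

definition box_degree_le :: "'w set \<Rightarrow> nat \<Rightarrow> (('w \<Rightarrow> real) \<Rightarrow> real) \<Rightarrow> bool" where
  "box_degree_le T D f \<longleftrightarrow>
     (\<exists>a. \<forall>t. f t = (\<Sum>v\<in>PiE T (\<lambda>_. {..D}). a v * (\<Prod>i\<in>T. t i ^ v i)))"

lemma box_degree_le_monomial:
  assumes "finite T" "v \<in> PiE T (\<lambda>_. {..D})"
  shows "box_degree_le T D (\<lambda>t. c * (\<Prod>i\<in>T. t i ^ v i))"
  unfolding box_degree_le_def
proof (intro exI[of _ "\<lambda>w. if w = v then c else 0"] allI)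
  fix t :: "'a \<Rightarrow> real"
  show "c * (\<Prod>i\<in>T. t i ^ v i) =
      (\<Sum>w\<in>PiE T (\<lambda>_. {..D}). (if w = v then c else 0) * (\<Prod>i\<in>T. t i ^ w i))"
    using assms by (simp add: if_distrib[of "\<lambda>a. a * b" for b] sum.delta finite_PiE cong: if_cong)
qed

lemma box_degree_le_add:
  assumes "box_degree_le T D f" "box_degree_le T D g"
  shows "box_degree_le T D (\<lambda>t. f t + g t)"
proof -
  obtain a where "\<And>t. f t = (\<Sum>v\<in>PiE T (\<lambda>_. {..D}). a v * (\<Prod>i\<in>T. t i ^ v i))"
    using assms(1) unfolding box_degree_le_def by blast
  moreover obtain b where "\<And>t. g t = (\<Sum>v\<in>PiE T (\<lambda>_. {..D}). b v * (\<Prod>i\<in>T. t i ^ v i))"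
    using assms(2) unfolding box_degree_le_def by blast
  ultimately show ?thesis unfolding box_degree_le_def
    by (intro exI[of _ "\<lambda>v. a v + b v"]) (simp add: distrib_right sum.distrib)
qed

lemma box_degree_le_const:
  assumes "finite T"
  shows "box_degree_le T D (\<lambda>t. c)"
  using box_degree_le_monomial[OF assms, of "\<lambda>i\<in>T. 0" D c] by (auto cong: prod.cong)

lemma box_degree_le_sum:
  assumes "finite T" "\<And>i. i \<in> I \<Longrightarrow> box_degree_le T D (f i)"
  shows "box_degree_le T D (\<lambda>t. \<Sum>i\<in>I. f i t)"
  using assms(2)
  by (induction I rule: infinite_finite_induct)
    (auto intro: box_degree_le_const[OF assms(1)] box_degree_le_add)

lemma box_degree_le_mult:
  assumes "finite T" "box_degree_le T D f" "box_degree_le T E g"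
  shows "box_degree_le T (D + E) (\<lambda>t. f t * g t)"
proof -
  obtain a where a: "\<And>t. f t = (\<Sum>v\<in>PiE T (\<lambda>_. {..D}). a v * (\<Prod>i\<in>T. t i ^ v i))"
    using assms(2) unfolding box_degree_le_def by blast
  obtain b where b: "\<And>t. g t = (\<Sum>v\<in>PiE T (\<lambda>_. {..E}). b v * (\<Prod>i\<in>T. t i ^ v i))"
    using assms(3) unfolding box_degree_le_def by blast
  have "box_degree_le T (D + E) (\<lambda>t. a v * (\<Prod>i\<in>T. t i ^ v i) * (b w * (\<Prod>i\<in>T. t i ^ w i)))"
    if "v \<in> PiE T (\<lambda>_. {..D})" "w \<in> PiE T (\<lambda>_. {..E})" for v w
  proof -
    have "(\<lambda>i\<in>T. v i + w i) \<in> PiE T (\<lambda>_. {..D + E})" using that by (fastforce intro: add_mono)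
    from box_degree_le_monomial[OF assms(1) this, of "a v * b w"] show ?thesis
      by (simp add: power_add prod.distrib mult_ac cong: prod.cong)
  qed
  then show ?thesis unfolding a b sum_product
    by (intro box_degree_le_sum assms(1)) auto
qed

lemma box_degree_le_mono:
  assumes "finite T" "box_degree_le T D f" "D \<le> E"
  shows "box_degree_le T E f"
  using box_degree_le_mult[OF assms(1,2) box_degree_le_const[OF assms(1), of "E - D" 1]] assms(3) by simp

lemma box_degree_le_power:
  assumes "finite T" "box_degree_le T D f"
  shows "box_degree_le T (n * D) (\<lambda>t. f t ^ n)"
  by (induction n) (auto intro: box_degree_le_const[OF assms(1)] box_degree_le_mult[OF assms])

lemma box_degree_le_prod:
  assumes "finite T" "\<And>i. i \<in> I \<Longrightarrow> box_degree_le T (D i) (f i)"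
  shows "box_degree_le T (\<Sum>i\<in>I. D i) (\<lambda>t. \<Prod>i\<in>I. f i t)"
  using assms(2)
  by (induction I rule: infinite_finite_induct)
    (auto intro: box_degree_le_const[OF assms(1)] box_degree_le_mult[OF assms(1)])

lemma polyfun_box_degree_le:
  assumes "f \<in> polyfun T" "finite T"
  shows "\<exists>D. box_degree_le T D f"
  using assms(1)
proof induction
  case (polyfun_const c)
  then show ?case using box_degree_le_const[OF assms(2)] by blast
next
  case (polyfun_var j)
  define v where "v = (\<lambda>i\<in>T. if i = j then 1 else 0 :: nat)"
  have "v \<in> PiE T (\<lambda>_. {..1})" by (auto simp: v_def)
  from box_degree_le_monomial[OF assms(2) this, of 1]
  have "box_degree_le T 1 (\<lambda>t. \<Prod>i\<in>T. t i ^ v i)" by simp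
  moreover have "(\<Prod>i\<in>T. t i ^ v i) = t j" for t :: "'a \<Rightarrow> real"
  proof -
    have "(\<Prod>i\<in>T. t i ^ v i) = (\<Prod>i\<in>T. if i = j then t i else 1)"
      by (rule prod.cong) (auto simp: v_def)
    then show ?thesis using assms(2) polyfun_var by (simp add: prod.delta)
  qed
  ultimately show ?case by auto
next
  case (polyfun_add f g)
  then obtain D E where DE: "box_degree_le T D f" "box_degree_le T E g" by blast
  then have "box_degree_le T (max D E) f" "box_degree_le T (max D E) g"
    by (auto intro: box_degree_le_mono[OF assms(2)])
  then show ?case using box_degree_le_add by blast
next
  case (polyfun_mult f g)
  then show ?case using box_degree_le_mult[OF assms(2)] by blast
qed

text \<open>Counting: the \<open>(D + 1)\<^sup>k\<close> products of powers up to \<open>D\<close> lie, on each chart, in a space of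
  polynomials of dimension \<open>O(D\<^bsup>k-1\<^esup>)\<close>.\<close>

lemma algebraically_dependent_on_charts:
  fixes f :: "nat \<Rightarrow> 's \<Rightarrow> real" and \<phi> :: "'c \<Rightarrow> ('w \<Rightarrow> real) \<Rightarrow> 's"
  assumes K: "finite K" and T: "\<And>\<kappa>. \<kappa> \<in> K \<Longrightarrow> finite (T \<kappa>) \<and> card (T \<kappa>) < k"
    and f: "\<And>\<kappa> l. \<kappa> \<in> K \<Longrightarrow> l < k \<Longrightarrow> (\<lambda>t. f l (\<phi> \<kappa> t)) \<in> polyfun (T \<kappa>)"
    and S: "S \<subseteq> (\<Union>\<kappa>\<in>K. range (\<phi> \<kappa>))"
  shows "\<exists>U c. finite U \<and> U \<subseteq> extensional {..<k} \<and> (\<exists>u\<in>U. c u \<noteq> 0) \<and>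
    (\<forall>s\<in>S. (\<Sum>u\<in>U. c u * (\<Prod>l<k. f l s ^ u l)) = 0)"
proof -
  have "\<exists>D. \<forall>(\<kappa>, l)\<in>K \<times> {..<k}. box_degree_le (T \<kappa>) D (\<lambda>t. f l (\<phi> \<kappa> t))"
  proof -
    have "\<forall>p\<in>K \<times> {..<k}. \<exists>D. box_degree_le (T (fst p)) D (\<lambda>t. f (snd p) (\<phi> (fst p) t))"
      using polyfun_box_degree_le f T by fastforce
    then obtain D where D: "\<And>p. p \<in> K \<times> {..<k} \<Longrightarrow>
        box_degree_le (T (fst p)) (D p) (\<lambda>t. f (snd p) (\<phi> (fst p) t))" by metis
    have "D p \<le> (\<Sum>p\<in>K \<times> {..<k}. D p)" if "p \<in> K \<times> {..<k}" for p
      using that K by (intro member_le_sum) auto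
    then show ?thesis
      using D T by (intro exI[of _ "\<Sum>p\<in>K \<times> {..<k}. D p"]) (fastforce intro: box_degree_le_mono)
  qed
  then obtain D0 where D0: "\<And>\<kappa> l. \<kappa> \<in> K \<Longrightarrow> l < k \<Longrightarrow> box_degree_le (T \<kappa>) D0 (\<lambda>t. f l (\<phi> \<kappa> t))"
    by auto
  \<comment> \<open>Chosen so that \<open>card K * (k * D0 + 1) ^ (k - 1)\<close> is at most D. The
    number of equations is then at most D (D+1)^(k-1), which is less than the number (D+1)^k of
    unknowns.\<close>
  define D where "D = card K * (k * D0 + 1) ^ k"
  define U where "U = PiE {..<k} (\<lambda>_. {..D})"
  define E where "E = k * (D * D0)"
  \<comment> \<open>One equation for each chart and each monomial on it, so a single solution is a
    relation valid on all charts at once.\<close>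
  define V where "V = Sigma K (\<lambda>\<kappa>. PiE (T \<kappa>) (\<lambda>_. {..E}))"
  have finU: "finite U" unfolding U_def by (intro finite_PiE) auto
  have finV: "finite V" unfolding V_def using K T by (intro finite_SigmaI finite_PiE) auto
  have prod_deg: "box_degree_le (T \<kappa>) E (\<lambda>t. \<Prod>l<k. f l (\<phi> \<kappa> t) ^ u l)" if "\<kappa> \<in> K" "u \<in> U" for \<kappa> u
  proof -
    have fin: "finite (T \<kappa>)" using T that by blast
    have "box_degree_le (T \<kappa>) (\<Sum>l<k. u l * D0) (\<lambda>t. \<Prod>l<k. f l (\<phi> \<kappa> t) ^ u l)"
      by (intro box_degree_le_prod box_degree_le_power fin D0 that(1)) auto
    moreover have "(\<Sum>l<k. u l * D0) \<le> (\<Sum>l<k. D * D0)"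
      using that(2) by (intro sum_mono mult_right_mono) (auto simp: U_def)
    ultimately show ?thesis
      using box_degree_le_mono[OF fin] by (simp add: E_def)
  qed
  define a where "a u \<kappa> = (SOME a. \<forall>t. (\<Prod>l<k. f l (\<phi> \<kappa> t) ^ u l) =
      (\<Sum>v\<in>PiE (T \<kappa>) (\<lambda>_. {..E}). a v * (\<Prod>i\<in>T \<kappa>. t i ^ v i)))" for u \<kappa>
  have a: "(\<Prod>l<k. f l (\<phi> \<kappa> t) ^ u l) =
      (\<Sum>v\<in>PiE (T \<kappa>) (\<lambda>_. {..E}). a u \<kappa> v * (\<Prod>i\<in>T \<kappa>. t i ^ v i))"
    if "u \<in> U" "\<kappa> \<in> K" for u \<kappa> t
    using someI_ex[OF prod_deg[OF that(2,1), unfolded box_degree_le_def]] unfolding a_def by blast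
  have "card V < card U"
  proof -
    have cardU: "card U = (D + 1) ^ k" by (simp add: U_def card_PiE)
    show ?thesis
    proof (cases "K = {}")
      case True
      then show ?thesis by (simp add: V_def cardU)
    next
      case False
      then have k: "k > 0" using T by fastforce
      have "card V = (\<Sum>\<kappa>\<in>K. (E + 1) ^ card (T \<kappa>))"
        unfolding V_def using K T by (subst card_SigmaI) (auto simp: card_PiE intro!: finite_PiE)
      also have "\<dots> \<le> (\<Sum>\<kappa>\<in>K. ((k * D0 + 1) * (D + 1)) ^ (k - 1))"
      proof (rule sum_mono)
        fix \<kappa> assume "\<kappa> \<in> K"
        then have "card (T \<kappa>) \<le> k - 1" using T by fastforce
        have "E + 1 \<le> (k * D0 + 1) * (D + 1)" by (simp add: E_def algebra_simps)
        then have "(E + 1) ^ card (T \<kappa>) \<le> ((k * D0 + 1) * (D + 1)) ^ card (T \<kappa>)"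
          by (rule power_mono) simp
        also have "\<dots> \<le> ((k * D0 + 1) * (D + 1)) ^ (k - 1)"
          using \<open>card (T \<kappa>) \<le> k - 1\<close> by (intro power_increasing) auto
        finally show "(E + 1) ^ card (T \<kappa>) \<le> ((k * D0 + 1) * (D + 1)) ^ (k - 1)" .
      qed
      also have "\<dots> = card K * (k * D0 + 1) ^ (k - 1) * (D + 1) ^ (k - 1)"
        by (simp only: power_mult_distrib sum_constant of_nat_id mult.assoc)
      also have "\<dots> \<le> D * (D + 1) ^ (k - 1)"
        unfolding D_def by (intro mult_right_mono mult_left_mono power_increasing) auto
      also have "\<dots> < (D + 1) * (D + 1) ^ (k - 1)" by simp
      also have "\<dots> = card U" using k by (simp add: cardU flip: power_Suc)
      finally show ?thesis .
    qed
  qed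
  from homogeneous_system_nontrivial_solution[OF finV finU this, of "\<lambda>u (\<kappa>, v). a u \<kappa> v"]
  obtain c where c: "\<exists>u\<in>U. c u \<noteq> 0" "\<And>\<kappa> v. (\<kappa>, v) \<in> V \<Longrightarrow> (\<Sum>u\<in>U. c u * a u \<kappa> v) = 0"
    by force
  have "(\<Sum>u\<in>U. c u * (\<Prod>l<k. f l s ^ u l)) = 0" if "s \<in> S" for s
  proof -
    obtain \<kappa> t where \<kappa>: "\<kappa> \<in> K" "s = \<phi> \<kappa> t" using S \<open>s \<in> S\<close> by blast
    have "(\<Sum>u\<in>U. c u * (\<Prod>l<k. f l s ^ u l)) =
        (\<Sum>u\<in>U. \<Sum>v\<in>PiE (T \<kappa>) (\<lambda>_. {..E}). c u * a u \<kappa> v * (\<Prod>i\<in>T \<kappa>. t i ^ v i))"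
      by (rule sum.cong) (auto simp: \<kappa>(2) a[OF _ \<kappa>(1)] sum_distrib_left mult.assoc)
    also have "\<dots> = (\<Sum>v\<in>PiE (T \<kappa>) (\<lambda>_. {..E}). \<Sum>u\<in>U. c u * a u \<kappa> v * (\<Prod>i\<in>T \<kappa>. t i ^ v i))"
      by (rule sum.swap)
    also have "\<dots> = (\<Sum>v\<in>PiE (T \<kappa>) (\<lambda>_. {..E}). (\<Sum>u\<in>U. c u * a u \<kappa> v) * (\<Prod>i\<in>T \<kappa>. t i ^ v i))"
      by (simp add: sum_distrib_right)
    also have "\<dots> = 0" using c(2) \<kappa>(1) by (intro sum.neutral) (auto simp: V_def)
    finally show ?thesis .
  qed
  \<comment> \<open>Being extensional, different exponent vectors in U differ at some l < k. The
    relation is therefore nontrivial as a polynomial in the k functions.\<close>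
  moreover have "U \<subseteq> extensional {..<k}" by (auto simp: U_def PiE_def)
  ultimately show ?thesis using finU c(1) by blast
qed

section \<open>Chains of prime ideals and the bound on the dimension\<close>

lemma rpoly_ring_add: "p \<in> carrier (rpoly_ring I) \<Longrightarrow> q \<in> carrier (rpoly_ring I) \<Longrightarrow> p + q \<in> carrier (rpoly_ring I)"
  and rpoly_ring_mult: "p \<in> carrier (rpoly_ring I) \<Longrightarrow> q \<in> carrier (rpoly_ring I) \<Longrightarrow> p * q \<in> carrier (rpoly_ring I)"
  using cring.cring_simprules(1,5)[OF cring_rpoly_ring, of p I q] by (simp_all add: rpoly_ring_def)

lemma rpoly_ring_one: "1 \<in> carrier (rpoly_ring I)"
  using rpoly_ring_const[of 1 I] by (simp only: single_one)

lemma rpoly_ring_sum: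
  assumes "\<And>m. m \<in> M \<Longrightarrow> f m \<in> carrier (rpoly_ring I)"
  shows "sum f M \<in> carrier (rpoly_ring I)"
  using assms
proof (induction M rule: infinite_finite_induct)
  case (insert m M)
  then show ?case by (auto intro: rpoly_ring_add)
qed (auto simp: rpoly_ring_def)

lemma rpoly_ring_prod_power:
  assumes "\<And>m. m \<in> M \<Longrightarrow> f m \<in> carrier (rpoly_ring I)"
  shows "(\<Prod>m\<in>M. f m ^ e m) \<in> carrier (rpoly_ring I)"
proof -
  have "p ^ n \<in> carrier (rpoly_ring I)" if "p \<in> carrier (rpoly_ring I)" for p n
    by (induction n) (auto intro: rpoly_ring_one rpoly_ring_mult that)
  with assms show ?thesis
    by (induction M rule: infinite_finite_induct) (auto intro: rpoly_ring_one rpoly_ring_mult)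
qed

lemma rpoly_eval_one: "rpoly_eval 1 x = 1"
  using rpoly_eval_single[of 0 1 x] by (simp only: single_one) simp

lemma rpoly_eval_prod_power: "rpoly_eval (\<Prod>m\<in>M. f m ^ e m) x = (\<Prod>m\<in>M. rpoly_eval (f m) x ^ e m)"
proof -
  have "rpoly_eval (p ^ n) x = rpoly_eval p x ^ n" for p :: "'a rpoly" and n
    by (induction n) (auto simp: rpoly_eval_one rpoly_eval_mult)
  then show ?thesis
    by (induction M rule: infinite_finite_induct) (auto simp: rpoly_eval_one rpoly_eval_mult)
qed

lemma rpoly_primeideal:
  fixes P :: "'v rpoly set"
  assumes "primeideal P (rpoly_ring I)"
  shows rpoly_primeideal_add: "p \<in> P \<Longrightarrow> q \<in> P \<Longrightarrow> p + q \<in> P"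
    and rpoly_primeideal_mult: "p \<in> P \<Longrightarrow> q \<in> carrier (rpoly_ring I) \<Longrightarrow> q * p \<in> P"
    and rpoly_primeideal_prime: "p \<in> carrier (rpoly_ring I) \<Longrightarrow> q \<in> carrier (rpoly_ring I) \<Longrightarrow>
      p * q \<in> P \<Longrightarrow> p \<in> P \<or> q \<in> P"
    and rpoly_primeideal_const: "Poly_Mapping.single 0 c \<in> P \<Longrightarrow> c = 0"
proof -
  interpret primeideal P "rpoly_ring I" by fact
  show "p \<in> P \<Longrightarrow> q \<in> P \<Longrightarrow> p + q \<in> P"
    using additive_subgroup.a_closed[OF ideal.axioms(1)[OF primeideal.axioms(1)[OF assms]], of p q] by (simp add: rpoly_ring_def)
  show mult: "p \<in> P \<Longrightarrow> q \<in> carrier (rpoly_ring I) \<Longrightarrow> q * p \<in> P" for p q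
    using I_l_closed[of p q] by (simp add: rpoly_ring_def)
  show "p \<in> carrier (rpoly_ring I) \<Longrightarrow> q \<in> carrier (rpoly_ring I) \<Longrightarrow> p * q \<in> P \<Longrightarrow> p \<in> P \<or> q \<in> P"
    using I_prime[of p q] by (simp add: rpoly_ring_def)
  show "c = 0" if "Poly_Mapping.single 0 c \<in> P"
  proof (rule ccontr)
    assume "c \<noteq> 0"
    then have "Poly_Mapping.single 0 (1 / c) * Poly_Mapping.single 0 c = (1 :: 'v rpoly)"
      by (simp add: mult_single)
    then have "1 \<in> P"
      using mult[OF that rpoly_ring_const[of "1 / c"]] by (simp only:)
    then show False using I_notcarr one_imp_carrier by (simp add: rpoly_ring_def)
  qed
qed

text \<open>Factor out the least power \<open>x\<^sub>0\<^sup>a\<close>, which is not in \<open>P\<^sub>0\<close>: the part of the remaining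
  factor without \<open>x\<^sub>0\<close> belongs to \<open>P\<^sub>1\<close>, and only involves \<open>x\<^sub>1, x\<^sub>2, \<dots>\<close>\<close>

lemma prime_chain_algebraically_independent:
  fixes x :: "nat \<Rightarrow> 'v rpoly" and e :: "'a \<Rightarrow> nat \<Rightarrow> nat"
  assumes "\<And>l. l \<le> k \<Longrightarrow> primeideal (P l) (rpoly_ring I)"
    and "\<And>l. l < k \<Longrightarrow> P l \<subseteq> P (Suc l)"
    and "\<And>l. l < k \<Longrightarrow> x l \<in> carrier (rpoly_ring I) \<and> x l \<in> P (Suc l) \<and> x l \<notin> P l"
    and "finite M"
    and "\<And>m m'. m \<in> M \<Longrightarrow> m' \<in> M \<Longrightarrow> (\<forall>l<k. e m l = e m' l) \<Longrightarrow> m = m'"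
    and "(\<Sum>m\<in>M. Poly_Mapping.single 0 (c m) * (\<Prod>l<k. x l ^ e m l)) \<in> P 0"
    and "m \<in> M"
  shows "c m = 0"
  using assms
proof (induction k arbitrary: P x M e m)
  case 0
  then have "M = {m}" by auto
  then show ?case using 0 rpoly_primeideal_const[of "P 0" I "c m"] by simp
next
  case (Suc k)
  let ?C = "carrier (rpoly_ring I)"
  show ?case
  proof (rule ccontr)
    assume "c m \<noteq> 0"
    \<comment> \<open>Zero coefficients are discarded so that the least exponent a is attained by a
      term with nonzero coefficient, which yields the contradiction.\<close>
    define M' where "M' = {m \<in> M. c m \<noteq> 0}"
    have M': "finite M'" "M' \<noteq> {}" using Suc.prems \<open>c m \<noteq> 0\<close> by (auto simp: M'_def)
    define a where "a = Min ((\<lambda>m. e m 0) ` M')"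
    have "a \<in> (\<lambda>m. e m 0) ` M'" unfolding a_def by (rule Min_in) (use M' in auto)
    then obtain m0 where m0: "m0 \<in> M'" "e m0 0 = a" by blast
    have a_le: "a \<le> e m 0" if "m \<in> M'" for m
      unfolding a_def by (rule Min_le) (use M' that in auto)
    define y where "y m = Poly_Mapping.single 0 (c m) * (\<Prod>l<k. x (Suc l) ^ e m (Suc l))" for m
    have xC: "x l \<in> ?C" if "l < Suc k" for l using Suc.prems(3)[OF that] by blast
    have y: "y m \<in> ?C" for m
      unfolding y_def by (intro rpoly_ring_mult rpoly_ring_const rpoly_ring_prod_power xC) auto
    have x0n: "x 0 ^ n \<in> ?C" for n
      using rpoly_ring_prod_power[of "{0::nat}" x I "\<lambda>_. n"] xC by simp
    define A where "A = (\<Sum>m\<in>{m\<in>M'. e m 0 = a}. y m)"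
    define B where "B = (\<Sum>m\<in>{m\<in>M'. e m 0 \<noteq> a}. x 0 ^ (e m 0 - a - 1) * y m)"
    have AB: "A \<in> ?C" "B \<in> ?C"
      unfolding A_def B_def by (intro rpoly_ring_sum rpoly_ring_mult y x0n)+
    have summand: "Poly_Mapping.single 0 (c m) * (\<Prod>l<Suc k. x l ^ e m l) = x 0 ^ e m 0 * y m" for m
      by (simp add: y_def prod.lessThan_Suc_shift mult_ac del: prod.lessThan_Suc)
    have "(\<Sum>m\<in>M. Poly_Mapping.single 0 (c m) * (\<Prod>l<Suc k. x l ^ e m l)) = (\<Sum>m\<in>M'. x 0 ^ e m 0 * y m)"
      unfolding summand
      by (rule sum.mono_neutral_right) (use Suc.prems in \<open>auto simp: M'_def y_def\<close>)
    also have "\<dots> = (\<Sum>m\<in>{m\<in>M'. e m 0 = a}. x 0 ^ e m 0 * y m) + (\<Sum>m\<in>{m\<in>M'. e m 0 \<noteq> a}. x 0 ^ e m 0 * y m)"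
    proof -
      have "M' = {m\<in>M'. e m 0 = a} \<union> {m\<in>M'. e m 0 \<noteq> a}" by auto
      then show ?thesis
        by (subst sum.union_disjoint[symmetric]) (use M' in auto)
    qed
    also have "(\<Sum>m\<in>{m\<in>M'. e m 0 = a}. x 0 ^ e m 0 * y m) = x 0 ^ a * A"
      unfolding A_def sum_distrib_left by (rule sum.cong) auto
    also have "(\<Sum>m\<in>{m\<in>M'. e m 0 \<noteq> a}. x 0 ^ e m 0 * y m) = x 0 ^ a * (x 0 * B)"
      unfolding B_def sum_distrib_left
    proof (rule sum.cong[OF refl])
      fix m assume "m \<in> {m\<in>M'. e m 0 \<noteq> a}"
      then have "e m 0 = a + (1 + (e m 0 - a - 1))" using a_le[of m] by auto
      then have "x 0 ^ e m 0 = x 0 ^ a * (x 0 * x 0 ^ (e m 0 - a - 1))"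
        by (metis power_add power_one_right)
      then show "x 0 ^ e m 0 * y m = x 0 ^ a * (x 0 * (x 0 ^ (e m 0 - a - 1) * y m))"
        by (simp add: mult.assoc)
    qed
    finally have eq: "(\<Sum>m\<in>M. Poly_Mapping.single 0 (c m) * (\<Prod>l<Suc k. x l ^ e m l)) = x 0 ^ a * (A + x 0 * B)"
      by (simp add: distrib_left)
    have x0: "x 0 \<in> ?C" "x 0 \<in> P 1" "x 0 \<notin> P 0" using Suc.prems(3)[of 0] by auto
    have P0: "primeideal (P 0) (rpoly_ring I)" and P1: "primeideal (P 1) (rpoly_ring I)"
      using Suc.prems(1)[of 0] Suc.prems(1)[of 1] by auto
    \<comment> \<open>Powers of \<open>x 0\<close> cancel modulo the prime ideal \<open>P 0\<close>,
      which does not contain \<open>x 0\<close>.\<close>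
    have "x 0 ^ n * q \<in> P 0 \<Longrightarrow> q \<in> P 0" if "q \<in> ?C" for n q
    proof (induction n)
      case (Suc n)
      then have "x 0 * (x 0 ^ n * q) \<in> P 0" by (simp add: mult.assoc)
      then have "x 0 ^ n * q \<in> P 0"
        using rpoly_primeideal_prime[OF P0 x0(1), of "x 0 ^ n * q"] x0(3) rpoly_ring_mult[OF x0n that] by blast
      then show ?case by (rule Suc.IH)
    qed simp
    moreover have xB: "x 0 * B \<in> ?C" by (rule rpoly_ring_mult[OF x0(1) AB(2)])
    ultimately have "A + x 0 * B \<in> P 0"
      using Suc.prems(6) rpoly_ring_add[OF AB(1) xB] unfolding eq by blast
    then have 1: "A + x 0 * B \<in> P 1" using Suc.prems(2)[of 0] by auto
    have "(Poly_Mapping.single 0 (- 1) * B) * x 0 \<in> P 1"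
      by (intro rpoly_primeideal_mult[OF P1] x0 rpoly_ring_mult rpoly_ring_const AB)
    from rpoly_primeideal_add[OF P1 1 this] have "A + (x 0 * B + (Poly_Mapping.single 0 (- 1) * B) * x 0) \<in> P 1"
      by (simp only: add.assoc)
    moreover have "Poly_Mapping.single 0 (- 1 :: real) = - (1 :: 'v rpoly)"
      by (simp only: single_uminus single_one)
    ultimately have "A \<in> P 1" by (simp add: mult.commute)
    \<comment> \<open>The induction hypothesis is applied to the chain starting at
      \<open>P 1\<close>. Among the terms with exponent a at \<open>x 0\<close>, the remaining
      exponents still tell the terms apart.\<close>
    have "c m0 = 0"
    proof (rule Suc.IH[of "\<lambda>l. P (Suc l)" "\<lambda>l. x (Suc l)" "{m\<in>M'. e m 0 = a}" "\<lambda>m l. e m (Suc l)" m0])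
      show "(\<Sum>m\<in>{m\<in>M'. e m 0 = a}. Poly_Mapping.single 0 (c m) * (\<Prod>l<k. x (Suc l) ^ e m (Suc l))) \<in> P (Suc 0)"
        using \<open>A \<in> P 1\<close> by (simp add: A_def y_def)
    next
      fix m m' assume m: "m \<in> {m\<in>M'. e m 0 = a}" "m' \<in> {m\<in>M'. e m 0 = a}"
        "\<forall>l<k. e m (Suc l) = e m' (Suc l)"
      then have "\<forall>l<Suc k. e m l = e m' l" by (auto simp: less_Suc_eq_0_disj)
      then show "m = m'" using Suc.prems(5) m by (auto simp: M'_def)
    qed (use Suc.prems M' m0 in auto)
    then show False using m0 by (simp add: M'_def)
  qed
qed

text \<open>The third conclusion, that every element of P is a coset of a ring element, lets strict
  inclusions between primes of the quotient survive the passage to preimages.\<close>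

lemma primeideal_quotient_preimage:
  assumes "cring R" "ideal J R" "primeideal P (R Quot J)"
  shows "primeideal {r \<in> carrier R. J +>\<^bsub>R\<^esub> r \<in> P} R"
    and "J \<subseteq> {r \<in> carrier R. J +>\<^bsub>R\<^esub> r \<in> P}"
    and "P \<subseteq> (+>\<^bsub>R\<^esub>) J ` carrier R"
proof -
  show "primeideal {r \<in> carrier R. J +>\<^bsub>R\<^esub> r \<in> P} R"
    by (rule ring_hom_ring.primeideal_vimage[OF ideal.rcos_ring_hom_ring[OF assms(2)] assms(1,3)])
  have "\<zero>\<^bsub>R Quot J\<^esub> \<in> P"
    by (rule additive_subgroup.zero_closed[OF ideal.axioms(1)[OF primeideal.axioms(1)[OF assms(3)]]])
  then have "J \<in> P" by (simp add: FactRing_def)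
  moreover have "J +>\<^bsub>R\<^esub> r = J" if "r \<in> J" for r
  proof -
    interpret ideal J R by fact
    show ?thesis by (rule a_rcos_const[OF that])
  qed
  ultimately show "J \<subseteq> {r \<in> carrier R. J +>\<^bsub>R\<^esub> r \<in> P}"
    using ideal.Icarr[OF assms(2)] by auto
  show "P \<subseteq> (+>\<^bsub>R\<^esub>) J ` carrier R"
    using ideal.Icarr[OF primeideal.axioms(1)[OF assms(3)]] by (auto simp: FactRing_def A_RCOSETS_def')
qed

text \<open>Pull the chain back to the polynomial ring and choose an element in each step of it. By
  \<open>dep\<close> some nontrivial polynomial in these elements vanishes on \<open>S\<close>,
  hence lies in the vanishing ideal and so in the lowest prime, against
  \<open>prime_chain_algebraically_independent\<close>.\<close>

lemma prime_chain_in_quotient_length: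
  assumes dep: "\<And>f. (\<And>l. l < k \<Longrightarrow> f l \<in> carrier (rpoly_ring I)) \<Longrightarrow>
      \<exists>U c. finite U \<and> U \<subseteq> extensional {..<k} \<and> (\<exists>u\<in>U. c u \<noteq> (0::real)) \<and>
        (\<forall>s\<in>S. (\<Sum>u\<in>U. c u * (\<Prod>l<k. rpoly_eval (f l) s ^ u l)) = 0)"
    and prime: "\<And>l. l \<le> k \<Longrightarrow> primeideal (P l) (rpoly_ring I Quot vanishing_ideal I S)"
    and chain: "\<And>l. l < k \<Longrightarrow> P l \<subset> P (Suc l)"
  shows False
proof -
  define R where "R = rpoly_ring I"
  define J where "J = vanishing_ideal I S"
  have J: "ideal J R" unfolding J_def R_def by (rule ideal_vanishing_ideal)
  have R: "cring R" unfolding R_def by (rule cring_rpoly_ring)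
  have prime': "primeideal (P l) (R Quot J)" if "l \<le> k" for l
    using prime[OF that] by (simp add: J_def R_def)
  define Q where "Q l = {r \<in> carrier R. J +>\<^bsub>R\<^esub> r \<in> P l}" for l
  have Q: "primeideal (Q l) R" "J \<subseteq> Q l" "P l \<subseteq> (+>\<^bsub>R\<^esub>) J ` carrier R" if "l \<le> k" for l
    unfolding Q_def using primeideal_quotient_preimage[OF R J prime'[OF that]] by auto
  have Q_mono: "Q l \<subseteq> Q (Suc l)" if "l < k" for l
    using chain[OF that] by (auto simp: Q_def)
  have "\<exists>x. x \<in> carrier R \<and> x \<in> Q (Suc l) \<and> x \<notin> Q l" if "l < k" for l
  proof -
    obtain z where z: "z \<in> P (Suc l)" "z \<notin> P l" using chain[OF \<open>l < k\<close>] by blast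
    then obtain r where "r \<in> carrier R" "z = J +>\<^bsub>R\<^esub> r" using Q(3)[of "Suc l"] \<open>l < k\<close> by auto
    then show ?thesis using z by (auto simp: Q_def)
  qed
  then obtain x where x: "\<And>l. l < k \<Longrightarrow> x l \<in> carrier R \<and> x l \<in> Q (Suc l) \<and> x l \<notin> Q l" by metis
  have "\<exists>U c. finite U \<and> U \<subseteq> extensional {..<k} \<and> (\<exists>u\<in>U. c u \<noteq> (0::real)) \<and>
      (\<forall>s\<in>S. (\<Sum>u\<in>U. c u * (\<Prod>l<k. rpoly_eval (x l) s ^ u l)) = 0)"
    by (rule dep) (use x in \<open>simp add: R_def\<close>)
  then obtain U c where U: "finite U" "U \<subseteq> extensional {..<k}" "\<exists>u\<in>U. c u \<noteq> (0::real)"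
    "\<forall>s\<in>S. (\<Sum>u\<in>U. c u * (\<Prod>l<k. rpoly_eval (x l) s ^ u l)) = 0"
    by (elim exE conjE) (rule that)
  define p where "p = (\<Sum>u\<in>U. Poly_Mapping.single 0 (c u) * (\<Prod>l<k. x l ^ u l))"
  have pC: "p \<in> carrier R"
    unfolding p_def R_def
    by (intro rpoly_ring_sum rpoly_ring_mult rpoly_ring_const rpoly_ring_prod_power) (use x in \<open>auto simp: R_def\<close>)
  have "rpoly_eval p s = 0" if "s \<in> S" for s
    using bspec[OF U(4) that] by (simp add: p_def rpoly_eval_sum rpoly_eval_mult rpoly_eval_single rpoly_eval_prod_power)
  then have "p \<in> J" using pC by (simp add: J_def R_def vanishing_ideal_def)
  then have "p \<in> Q 0" using Q(2)[of 0] by blast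
  obtain u where u: "u \<in> U" "c u \<noteq> 0" using U(3) by blast
  have "c u = 0"
  proof (rule prime_chain_algebraically_independent[of k Q I x U "\<lambda>u. u" c u])
    fix u u' assume "u \<in> U" "u' \<in> U" "\<forall>l<k. u l = u' l"
    then show "u = u'" using U(2) by (intro extensionalityI[of u "{..<k}" u']) auto
  qed (use Q(1) Q_mono x U(1) u \<open>p \<in> Q 0\<close> in \<open>simp_all add: R_def p_def\<close>)
  then show False using u by simp
qed

text \<open>A chain of length at least k has an initial segment of length k, so all chains are
  shorter than k. The subtraction is the real one: for k = 0 the bound is -1, and there are no
  primes at all.\<close>

lemma semialg_dim_le:
  assumes "\<And>f. (\<And>l. l < k \<Longrightarrow> f l \<in> carrier (rpoly_ring I)) \<Longrightarrow>
      \<exists>U c. finite U \<and> U \<subseteq> extensional {..<k} \<and> (\<exists>u\<in>U. c u \<noteq> (0::real)) \<and>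
        (\<forall>s\<in>S. (\<Sum>u\<in>U. c u * (\<Prod>l<k. rpoly_eval (f l) s ^ u l)) = 0)"
  shows "semialg_dim I S \<le> ereal (real k - 1)"
  unfolding semialg_dim_def krull_dim_def
proof (rule Sup_least)
  fix z assume "z \<in> {ereal (real k) |k. \<exists>P. (\<forall>i\<le>k. primeideal (P i) (rpoly_ring I Quot vanishing_ideal I S)) \<and>
      (\<forall>i<k. P i \<subset> P (Suc i))}"
  then obtain n P where P: "z = ereal (real n)"
    "\<And>i. i \<le> n \<Longrightarrow> primeideal (P i) (rpoly_ring I Quot vanishing_ideal I S)"
    "\<And>i. i < n \<Longrightarrow> P i \<subset> P (Suc i)" by blast
  have "n < k"
  proof (rule ccontr)
    assume "\<not> n < k"
    then show False
      using prime_chain_in_quotient_length[of k I S P] assms P(2,3) by simp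
  qed
  then show "z \<le> ereal (real k - 1)" by (simp add: P(1))
qed

section \<open>Charts for the non-generic forms\<close>

text \<open>The line in question stays inside the line spanned by x, on which g vanishes by
  homogeneity. So x is an isotropic direction, and multiples of it may be added to v when v is
  normalised.\<close>

lemma coeff_line_poly_self:
  assumes "g \<in> forms d" "form_fun g x = 0"
  shows "coeff (line_poly g x (c *\<^sub>R x)) 2 = 0"
proof -
  have "line_poly g x (c *\<^sub>R x) = 0"
  proof (rule line_poly_eqI)
    fix t
    have "x + t *\<^sub>R c *\<^sub>R x = (1 + t * c) *\<^sub>R x" by (simp add: scaleR_add_left)
    then show "form_fun g (x + t *\<^sub>R c *\<^sub>R x) = poly 0 t"
      using assms by (simp add: form_fun_scaleR)
  qed
  then show ?thesis by simp
qed

text \<open>At a zero of \<open>g\<close> the second coefficient is a positive semidefinite quadratic form in the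
  direction, so its isotropic vectors lie in its radical.\<close>

lemma coeff_line_poly_add_isotropic:
  assumes nonneg: "\<And>y. form_fun g y \<ge> 0" and "form_fun g x = 0" and b: "coeff (line_poly g x b) 2 = 0"
  shows "coeff (line_poly g x (a + b)) 2 = coeff (line_poly g x a) 2"
proof -
  define H where "H = hessian (form_fun g) x"
  define B where "B w = coeff (line_poly g x w) 2" for w
  have B_eq: "B w = (w \<bullet> (H *v w)) / 2" for w
    using hessian_quadratic_form[of w g x] by (simp add: B_def H_def)
  define C where "C = (a \<bullet> (H *v b) + b \<bullet> (H *v a)) / 2"
  \<comment> \<open>Isotropy of b removes the term quadratic in s, so B is affine along the
    direction b; being nonnegative for all s, it has slope C = 0.\<close>
  have B_add: "B (a + s *\<^sub>R b) = B a + s * C" for s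
  proof -
    have "b \<bullet> (H *v b) = 0" using b B_eq[of b] by (simp add: B_def)
    then show ?thesis
      unfolding B_eq C_def
      by (simp add: matrix_vector_right_distrib matrix_vector_mult_scaleR inner_add_left inner_add_right
          field_simps)
  qed
  have B_nonneg: "B w \<ge> 0" for w
    unfolding B_def using coeff_line_poly_nonneg(2)[OF nonneg assms(2)] .
  have "C = 0"
  proof (rule ccontr)
    assume "C \<noteq> 0"
    then have "B (a + (- (B a + 1) / C) *\<^sub>R b) = - 1" by (simp add: B_add field_simps)
    then show False using B_nonneg[of "a + (- (B a + 1) / C) *\<^sub>R b"] by simp
  qed
  then show ?thesis using B_add[of 1] by (simp add: B_def)
qed

lemma lookup_le_degree: "\<alpha> \<in> exponents d \<Longrightarrow> Poly_Mapping.lookup \<alpha> i \<le> d"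
  by (auto simp: exponents_def intro: member_le_sum)

text \<open>On the line \<open>axis i 1 + t w\<close> with vanishing i-th entry of w, the variable
  X_i is constantly 1, so a monomial contributes only to the power of t that is its degree in the
  other variables. The coefficients of the line polynomial therefore separate the form by this
  degree.\<close>

lemma coeff_line_poly_axis:
  assumes h: "h \<in> forms d" and w: "w $ i = 0"
  shows "coeff (line_poly h (axis i 1) w) m =
    (\<Sum>\<alpha>\<in>{\<alpha> \<in> exponents d. d - Poly_Mapping.lookup \<alpha> i = m}.
      Poly_Mapping.lookup h \<alpha> * (\<Prod>k\<in>- {i}. (w $ k) ^ Poly_Mapping.lookup \<alpha> k))"
proof -
  define c where "c \<alpha> = Poly_Mapping.lookup h \<alpha> * (\<Prod>k\<in>- {i}. (w $ k) ^ Poly_Mapping.lookup \<alpha> k)" for \<alpha>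
  have "line_poly h (axis i 1) w = (\<Sum>\<alpha>\<in>exponents d. monom (c \<alpha>) (d - Poly_Mapping.lookup \<alpha> i))"
  proof (rule line_poly_eqI)
    fix t
    have "power_product \<alpha> (axis i 1 + t *\<^sub>R w) =
        t ^ (d - Poly_Mapping.lookup \<alpha> i) * (\<Prod>k\<in>- {i}. (w $ k) ^ Poly_Mapping.lookup \<alpha> k)"
      if "\<alpha> \<in> exponents d" for \<alpha>
    proof -
      have "(\<Sum>k\<in>UNIV. Poly_Mapping.lookup \<alpha> k) = Poly_Mapping.lookup \<alpha> i + (\<Sum>k\<in>- {i}. Poly_Mapping.lookup \<alpha> k)"
        by (subst sum.remove[of _ i]) (auto simp: Compl_eq_Diff_UNIV)
      then have "(\<Sum>k\<in>- {i}. Poly_Mapping.lookup \<alpha> k) = d - Poly_Mapping.lookup \<alpha> i"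
        using that by (simp add: exponents_def)
      moreover have "power_product \<alpha> (axis i 1 + t *\<^sub>R w) =
          (\<Prod>k\<in>- {i}. (t * w $ k) ^ Poly_Mapping.lookup \<alpha> k)"
      proof -
        have "power_product \<alpha> (axis i 1 + t *\<^sub>R w) =
            ((axis i 1 + t *\<^sub>R w) $ i) ^ Poly_Mapping.lookup \<alpha> i *
            (\<Prod>k\<in>- {i}. ((axis i 1 + t *\<^sub>R w) $ k) ^ Poly_Mapping.lookup \<alpha> k)"
          unfolding power_product_def by (subst prod.remove[of _ i]) (auto simp: Compl_eq_Diff_UNIV)
        also have "(\<Prod>k\<in>- {i}. ((axis i 1 + t *\<^sub>R w) $ k) ^ Poly_Mapping.lookup \<alpha> k) =
            (\<Prod>k\<in>- {i}. (t * w $ k) ^ Poly_Mapping.lookup \<alpha> k)"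
          by (rule prod.cong) (auto simp: axis_def)
        finally show ?thesis using w by (simp add: axis_def)
      qed
      ultimately show ?thesis
        by (simp add: power_mult_distrib prod.distrib flip: power_sum)
    qed
    then show "form_fun h (axis i 1 + t *\<^sub>R w) =
        poly (\<Sum>\<alpha>\<in>exponents d. monom (c \<alpha>) (d - Poly_Mapping.lookup \<alpha> i)) t"
      by (simp add: form_fun_eq_sum[OF h] poly_sum poly_monom c_def mult_ac)
  qed
  then show ?thesis
    by (simp add: coeff_sum sum.If_cases finite_exponents c_def Int_def)
qed

lemma coefficients_eq_0_if_vanishing:
  fixes i :: "'n::finite" and c :: "('n \<Rightarrow>\<^sub>0 nat) \<Rightarrow> real"
  assumes "\<And>w :: real ^ 'n. w $ i = 0 \<Longrightarrow>
      (\<Sum>\<alpha>\<in>{\<alpha> \<in> exponents d. d - Poly_Mapping.lookup \<alpha> i = m}.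
        c \<alpha> * (\<Prod>k\<in>- {i}. (w $ k) ^ Poly_Mapping.lookup \<alpha> k)) = 0"
    and \<alpha>: "\<alpha> \<in> exponents d" "d - Poly_Mapping.lookup \<alpha> i = m"
  shows "c \<alpha> = 0"
proof (rule sum_power_products_eq_0D[of "- {i}" "{\<alpha> \<in> exponents d. d - Poly_Mapping.lookup \<alpha> i = m}"
      "Poly_Mapping.lookup"])
  fix \<beta> \<gamma> :: "'n \<Rightarrow>\<^sub>0 nat"
  assume \<beta>\<gamma>: "\<beta> \<in> {\<alpha> \<in> exponents d. d - Poly_Mapping.lookup \<alpha> i = m}"
    "\<gamma> \<in> {\<alpha> \<in> exponents d. d - Poly_Mapping.lookup \<alpha> i = m}"
    and eq: "\<forall>k\<in>- {i}. Poly_Mapping.lookup \<beta> k = Poly_Mapping.lookup \<gamma> k"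
  \<comment> \<open>Entries of an exponent are at most d, so the truncated difference m determines
    the i-th entry, and the other entries determine the whole exponent.\<close>
  have "Poly_Mapping.lookup \<beta> i = Poly_Mapping.lookup \<gamma> i"
    using \<beta>\<gamma> lookup_le_degree[of \<beta> d i] lookup_le_degree[of \<gamma> d i] by auto
  then have "Poly_Mapping.lookup \<beta> k = Poly_Mapping.lookup \<gamma> k" for k
    using eq by (cases "k = i") auto
  then show "\<beta> = \<gamma>" by (rule poly_mapping_eqI)
next
  fix y :: "'n \<Rightarrow> real"
  have "(\<Prod>k\<in>- {i}. ((\<chi> k. if k = i then 0 else y k) $ k) ^ Poly_Mapping.lookup \<alpha> k) =
      (\<Prod>k\<in>- {i}. y k ^ Poly_Mapping.lookup \<alpha> k)" for \<alpha>
    by (rule prod.cong) auto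
  then show "(\<Sum>\<alpha>\<in>{\<alpha> \<in> exponents d. d - Poly_Mapping.lookup \<alpha> i = m}.
      c \<alpha> * (\<Prod>k\<in>- {i}. y k ^ Poly_Mapping.lookup \<alpha> k)) = 0"
    using assms(1)[of "\<chi> k. if k = i then 0 else y k"] by simp
qed (use \<alpha> in \<open>auto simp: finite_exponents\<close>)

definition degenerate_exponents :: "nat \<Rightarrow> 'n::finite \<Rightarrow> 'n \<Rightarrow> ('n \<Rightarrow>\<^sub>0 nat) set" where
  "degenerate_exponents d i j = {\<alpha> \<in> exponents d. d - Poly_Mapping.lookup \<alpha> i \<le> 1 \<or>
     (d - Poly_Mapping.lookup \<alpha> i = 2 \<and> Poly_Mapping.lookup \<alpha> j > 0)}"

text \<open>At the zero e_i of a nonnegative form the value and the first derivatives vanish, which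
  kills the parts of degree 0 and 1 in the other variables. Since e_j is isotropic, hence in the
  radical, the part of degree 2 does not depend on X_j.\<close>

lemma degenerate_exponents_coefficient_eq_0:
  assumes h: "h \<in> forms d" "\<And>y. form_fun h y \<ge> 0" and "i \<noteq> j"
    and zero: "form_fun h (axis i 1) = 0" "coeff (line_poly h (axis i 1) (axis j 1)) 2 = 0"
    and \<alpha>: "\<alpha> \<in> degenerate_exponents d i j"
  shows "Poly_Mapping.lookup h \<alpha> = 0"
proof -
  have \<alpha>d: "\<alpha> \<in> exponents d" using \<alpha> by (simp add: degenerate_exponents_def)
  consider "d - Poly_Mapping.lookup \<alpha> i = 0" | "d - Poly_Mapping.lookup \<alpha> i = 1"
    | "d - Poly_Mapping.lookup \<alpha> i = 2" "Poly_Mapping.lookup \<alpha> j > 0"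
    using \<alpha> by (auto simp: degenerate_exponents_def le_Suc_eq)
  then show ?thesis
  proof cases
    case 1
    have 0: "coeff (line_poly h (axis i 1) w) 0 = 0" for w
      using poly_line_poly[of h "axis i 1" w 0] zero(1) by (simp add: poly_0_coeff_0)
    show ?thesis
      by (rule coefficients_eq_0_if_vanishing[OF _ \<alpha>d 1])
        (use coeff_line_poly_axis[OF h(1), of _ i 0] 0 in simp)
  next
    case 2
    have 0: "coeff (line_poly h (axis i 1) w) 1 = 0" for w
      by (rule coeff_line_poly_nonneg(1)[OF h(2) zero(1)])
    show ?thesis
      by (rule coefficients_eq_0_if_vanishing[OF _ \<alpha>d 2])
        (use coeff_line_poly_axis[OF h(1), of _ i 1] 0 in simp)
  next
    case 3
    \<comment> \<open>Setting the j-th entry of w to 0 leaves exactly the monomials without X_j. The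
      quadratic part takes the same value at w and at w0, so the monomials that do contain X_j,
      collected in c, sum to zero.\<close>
    define c where "c \<beta> = (if Poly_Mapping.lookup \<beta> j = 0 then 0 else Poly_Mapping.lookup h \<beta>)" for \<beta>
    have "c \<alpha> = 0"
    proof (rule coefficients_eq_0_if_vanishing[OF _ \<alpha>d 3(1)])
      fix w :: "real ^ 'a" assume w: "w $ i = 0"
      define w0 where "w0 = (\<chi> k. if k = j then 0 else w $ k)"
      let ?M = "{\<alpha> \<in> exponents d. d - Poly_Mapping.lookup \<alpha> i = 2}"
      define W where "W \<beta> = (\<Prod>k\<in>- {i}. (w $ k) ^ Poly_Mapping.lookup \<beta> k)" for \<beta>
      have w_eq: "w = w0 + w $ j *\<^sub>R axis j 1"
        by (auto simp: vec_eq_iff w0_def axis_def)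
      have "line_poly h (1 *\<^sub>R axis i 1) (w $ j *\<^sub>R axis j 1) =
          smult (1 ^ d) (line_poly h (axis i 1) (axis j 1) \<circ>\<^sub>p [:0, w $ j / 1:])"
        by (rule line_poly_scaleR[OF h(1)]) simp
      then have "coeff (line_poly h (axis i 1) (w $ j *\<^sub>R axis j 1)) 2 = 0"
        using zero(2) by (simp add: coeff_pcompose_linear)
      from coeff_line_poly_add_isotropic[OF h(2) zero(1) this, of w0]
      have "coeff (line_poly h (axis i 1) w) 2 = coeff (line_poly h (axis i 1) w0) 2"
        using w_eq by simp
      moreover have "coeff (line_poly h (axis i 1) w) 2 = (\<Sum>\<beta>\<in>?M. Poly_Mapping.lookup h \<beta> * W \<beta>)"
        unfolding W_def by (rule coeff_line_poly_axis[OF h(1) w])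
      moreover have "coeff (line_poly h (axis i 1) w0) 2 =
          (\<Sum>\<beta>\<in>?M. Poly_Mapping.lookup h \<beta> * (if Poly_Mapping.lookup \<beta> j = 0 then W \<beta> else 0))"
      proof -
        have "(\<Prod>k\<in>- {i}. (w0 $ k) ^ Poly_Mapping.lookup \<beta> k) = (if Poly_Mapping.lookup \<beta> j = 0 then W \<beta> else 0)" for \<beta>
        proof (cases "Poly_Mapping.lookup \<beta> j = 0")
          case True
          then have "(w0 $ k) ^ Poly_Mapping.lookup \<beta> k = (w $ k) ^ Poly_Mapping.lookup \<beta> k" for k
            by (cases "k = j") (simp_all add: w0_def)
          then show ?thesis using True by (simp add: W_def)
        next
          case False
          then show ?thesis using \<open>i \<noteq> j\<close> by (auto simp: w0_def intro!: prod_zero bexI[of _ j])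
        qed
        then show ?thesis using coeff_line_poly_axis[OF h(1), of w0 i 2] w \<open>i \<noteq> j\<close> by (simp add: w0_def)
      qed
      ultimately have "(\<Sum>\<beta>\<in>?M. Poly_Mapping.lookup h \<beta> * W \<beta> -
          Poly_Mapping.lookup h \<beta> * (if Poly_Mapping.lookup \<beta> j = 0 then W \<beta> else 0)) = 0"
        by (simp add: sum_subtractf)
      also have "(\<Sum>\<beta>\<in>?M. Poly_Mapping.lookup h \<beta> * W \<beta> -
          Poly_Mapping.lookup h \<beta> * (if Poly_Mapping.lookup \<beta> j = 0 then W \<beta> else 0)) = (\<Sum>\<beta>\<in>?M. c \<beta> * W \<beta>)"
        by (rule sum.cong) (auto simp: c_def)
      finally show "(\<Sum>\<beta>\<in>?M. c \<beta> * (\<Prod>k\<in>- {i}. (w $ k) ^ Poly_Mapping.lookup \<beta> k)) = 0"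
        by (simp add: W_def)
    qed
    then show ?thesis using 3 by (simp add: c_def)
  qed
qed

text \<open>The n monomials X_i^(d-1) X_k, including X_i^d for k = i, and the n-1 monomials
  X_i^(d-2) X_j X_k with k different from i, including k = j. The exponent of X_i, at least d-1 or
  equal to d-2, separates the two families.\<close>

lemma card_degenerate_exponents:
  fixes i j :: "'n::finite"
  assumes "i \<noteq> j" "d \<ge> 2"
  shows "2 * CARD('n) - 1 \<le> card (degenerate_exponents d i j)"
proof -
  define b1 where "b1 k = Poly_Mapping.single i (d - 1) + Poly_Mapping.single k 1" for k
  define b2 where "b2 k = Poly_Mapping.single i (d - 2) + Poly_Mapping.single j 1 + Poly_Mapping.single k 1" for k
  have lookup_single': "Poly_Mapping.lookup (Poly_Mapping.single k (c :: nat)) l = (if k = l then c else 0)"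
    for k l :: 'n and c by (simp add: lookup_single when_def)
  have exp: "b1 k \<in> exponents d" "b2 k \<in> exponents d" for k
    using assms by (simp_all add: b1_def b2_def exponents_def lookup_add lookup_single' sum.distrib)
  have single_inj: "k = l" if "Poly_Mapping.single k (1 :: nat) = Poly_Mapping.single l 1" for k l :: 'n
    using arg_cong[OF that, of "\<lambda>p. Poly_Mapping.lookup p k"] by (simp add: lookup_single' split: if_splits)
  have inj: "inj b1" "inj b2"
    by (auto intro!: injI single_inj simp: b1_def b2_def)
  have i1: "Poly_Mapping.lookup (b1 k) i \<ge> d - 1" for k by (simp add: b1_def lookup_add lookup_single')
  have i2: "Poly_Mapping.lookup (b2 k) i = d - 2" "Poly_Mapping.lookup (b2 k) j > 0" if "k \<noteq> i" for k
    using that assms by (simp_all add: b2_def lookup_add lookup_single')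
  have "b1 k \<in> degenerate_exponents d i j" for k
    using exp(1)[of k] i1[of k] by (simp add: degenerate_exponents_def) linarith
  moreover have "b2 k \<in> degenerate_exponents d i j" if "k \<noteq> i" for k
    using exp(2)[of k] i2[OF that] assms by (simp add: degenerate_exponents_def)
  ultimately have sub: "range b1 \<union> b2 ` (- {i}) \<subseteq> degenerate_exponents d i j" by auto
  have "range b1 \<inter> b2 ` (- {i}) = {}"
  proof (rule ccontr)
    assume "range b1 \<inter> b2 ` (- {i}) \<noteq> {}"
    then obtain k l where "b1 k = b2 l" "l \<noteq> i" by auto
    then show False using i1[of k] i2(1)[of l] assms by auto
  qed
  then have "card (range b1 \<union> b2 ` (- {i})) = CARD('n) + (CARD('n) - 1)"
    using inj by (subst card_Un_disjoint)
      (auto simp: card_image inj_on_subset Compl_eq_Diff_UNIV card_Diff_subset)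
  moreover have "card (range b1 \<union> b2 ` (- {i})) \<le> card (degenerate_exponents d i j)"
    by (rule card_mono[OF _ sub]) (simp add: degenerate_exponents_def finite_exponents)
  ultimately show ?thesis by simp
qed

section \<open>Polynomial charts and the codimension\<close>

lemma form_family_form_fun:
  assumes A: "function_algebra A" and "\<And>k. form_family A 1 (L k)" and g: "g \<in> forms d"
  shows "form_family A d (\<lambda>x y. form_fun g (\<chi> k. L k x y))"
  unfolding form_fun_eq_sum[OF g]
  by (intro form_family_sum form_family_cmult function_algebra_const form_family_power_product assms)

text \<open>Linear change of coordinates sending \<open>e\<^sub>i, e\<^sub>j\<close> to \<open>x, v\<close>, and its inverse when \<open>x\<^sub>i = v\<^sub>j = 1\<close>
  and \<open>v\<^sub>i = 0\<close>\<close>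

definition chart_lin :: "'n::finite \<Rightarrow> 'n \<Rightarrow> real ^ 'n \<Rightarrow> real ^ 'n \<Rightarrow> real ^ 'n \<Rightarrow> real ^ 'n" where
  "chart_lin i j x v z = (\<chi> k. x $ k * z $ i + v $ k * z $ j + (if k = i \<or> k = j then 0 else 1) * z $ k)"

definition chart_inv :: "'n::finite \<Rightarrow> 'n \<Rightarrow> real ^ 'n \<Rightarrow> real ^ 'n \<Rightarrow> real ^ 'n \<Rightarrow> real ^ 'n" where
  "chart_inv i j x v y = (\<chi> k. if k = i then y $ i else if k = j then y $ j + - 1 * x $ j * y $ i
     else y $ k + - 1 * x $ k * y $ i + - 1 * v $ k * (y $ j + - 1 * x $ j * y $ i))"

lemma chart_lin_inv:
  assumes "i \<noteq> j" "x $ i = 1" "v $ i = 0" "v $ j = 1"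
  shows "chart_lin i j x v (chart_inv i j x v y) = y"
  using assms by (auto simp: vec_eq_iff chart_lin_def chart_inv_def algebra_simps)

lemma chart_lin_axis:
  assumes "i \<noteq> j"
  shows "chart_lin i j x v (axis i 1 + t *\<^sub>R axis j 1) = x + t *\<^sub>R v"
  using assms by (auto simp: vec_eq_iff chart_lin_def axis_def)

text \<open>Choose i with a nonzero entry of x, subtract a multiple of x from v to clear its i-th
  entry, choose j with a nonzero entry of the result, and rescale both vectors. All of this
  preserves isotropy. The normalised entries are not recorded in the conclusion because
  \<open>chart_inv\<close> never reads them.\<close>

lemma nongeneric_form_in_chart:
  fixes g :: "'n::finite rpoly"
  assumes g: "g \<in> forms d" "\<And>y. form_fun g y \<ge> 0" and xv: "degenerate_zero g x v"
  shows "\<exists>i j x' v' h. i \<noteq> j \<and> (\<forall>\<alpha>\<in>degenerate_exponents d i j. Poly_Mapping.lookup h \<alpha> = 0) \<and>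
    h \<in> forms d \<and> (\<forall>y. form_fun g y = form_fun h (chart_inv i j x' v' y))"
proof -
  have x: "x \<noteq> 0" "form_fun g x = 0" and v: "v \<noteq> 0" "v \<bullet> x = 0" "coeff (line_poly g x v) 2 \<le> 0"
    using xv by (auto simp: degenerate_zero_def)
  have Bv: "coeff (line_poly g x v) 2 = 0"
    using v(3) coeff_line_poly_nonneg(2)[OF g(2) x(2), of v] by simp
  obtain i where i: "x $ i \<noteq> 0" using x(1) by (auto simp: vec_eq_iff)
  define w where "w = v + (- v $ i / x $ i) *\<^sub>R x"
  \<comment> \<open>Here the orthogonality of v and x enters: the inner product of v with w equals
    that of v with itself.\<close>
  have "w \<noteq> 0"
  proof
    assume "w = 0"
    then have "v \<bullet> w = 0" by simp
    then have "v \<bullet> v = 0" using v(2) by (simp add: w_def inner_add_right inner_diff_right)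
    then show False using v(1) by simp
  qed
  then obtain j where j: "w $ j \<noteq> 0" by (auto simp: vec_eq_iff)
  have wi: "w $ i = 0" using i by (simp add: w_def)
  then have "i \<noteq> j" using j by auto
  have Bw: "coeff (line_poly g x w) 2 = 0"
    using coeff_line_poly_add_isotropic[OF g(2) x(2) coeff_line_poly_self[OF g(1) x(2)], of v "- v $ i / x $ i"] Bv
    by (simp add: w_def)
  define x' where "x' = (1 / x $ i) *\<^sub>R x"
  define v' where "v' = (1 / w $ j) *\<^sub>R w"
  have x'v': "x' $ i = 1" "v' $ i = 0" "v' $ j = 1" using i j wi by (auto simp: x'_def v'_def)
  have gx': "form_fun g x' = 0" by (simp add: x'_def form_fun_scaleR[OF g(1)] x(2))
  have "line_poly g x' v' = smult ((1 / x $ i) ^ d) (line_poly g x w \<circ>\<^sub>p [:0, (1 / w $ j) / (1 / x $ i):])"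
    unfolding x'_def v'_def by (rule line_poly_scaleR[OF g(1)]) (use i in simp)
  then have Bv': "coeff (line_poly g x' v') 2 = 0"
    by (simp add: coeff_pcompose_linear Bw del: divide_divide_eq_left divide_divide_eq_right)
  have "form_family UNIV d (\<lambda>(_::unit) z. form_fun g (\<chi> k. x' $ k * z $ i + v' $ k * z $ j +
      (if k = i \<or> k = j then 0 else 1) * z $ k))"
    by (intro form_family_form_fun form_family_add form_family_cmult form_family_var function_algebra_UNIV
        UNIV_I g(1))
  from form_family_imp_form[OF this] obtain h where h: "h \<in> forms d"
    "\<And>z. form_fun h z = form_fun g (chart_lin i j x' v' z)"
    unfolding chart_lin_def by auto
  have h_line: "form_fun h (axis i 1 + t *\<^sub>R axis j 1) = form_fun g (x' + t *\<^sub>R v')" for t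
    by (simp add: h(2) chart_lin_axis[OF \<open>i \<noteq> j\<close>])
  have "form_fun h (axis i 1) = 0" using h_line[of 0] gx' by simp
  moreover have "line_poly h (axis i 1) (axis j 1) = line_poly g x' v'"
    by (rule line_poly_eqI) (simp add: h_line poly_line_poly)
  ultimately have "\<forall>\<alpha>\<in>degenerate_exponents d i j. Poly_Mapping.lookup h \<alpha> = 0"
    using degenerate_exponents_coefficient_eq_0[OF h(1) _ \<open>i \<noteq> j\<close>] h(2) g(2) Bv' by simp
  moreover have "form_fun g y = form_fun h (chart_inv i j x' v' y)" for y
    by (simp add: h(2) chart_lin_inv[OF \<open>i \<noteq> j\<close> x'v'])
  ultimately show ?thesis using \<open>i \<noteq> j\<close> h(1) by blast
qed

text \<open>The parameters of a chart are the free entries of \<open>x\<close>, those of \<open>v\<close>, and the coefficients of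
  the form that may be nonzero after the change of coordinates.\<close>

definition chart_params :: "nat \<Rightarrow> 'n::finite \<times> 'n \<Rightarrow> ('n + 'n + ('n \<Rightarrow>\<^sub>0 nat)) set" where
  "chart_params d = (\<lambda>(i, j). Inl ` (- {i}) \<union> (Inr \<circ> Inl) ` (- {i, j}) \<union>
     (Inr \<circ> Inr) ` (exponents d - degenerate_exponents d i j))"

lemma finite_chart_params: "finite (chart_params d \<kappa>)"
  by (cases \<kappa>) (simp add: chart_params_def finite_exponents)

text \<open>With N monomials there are at most (n-1) + (n-2) + (N - (2n-1)) = N - 2 parameters. The
  bound is stated as it is needed for counting with k = N - 1 functions.\<close>

lemma card_chart_params:
  fixes i j :: "'n::finite"
  assumes "i \<noteq> j" "d \<ge> 2"
  shows "card (chart_params d (i, j)) < card (exponents d :: ('n \<Rightarrow>\<^sub>0 nat) set) - 1"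
proof -
  have "card {i, j} \<le> CARD('n)" by (rule card_mono) auto
  then have n: "CARD('n) \<ge> 2" using assms by simp
  have sub: "degenerate_exponents d i j \<subseteq> exponents d" by (auto simp: degenerate_exponents_def)
  have le: "card (degenerate_exponents d i j) \<le> card (exponents d :: ('n \<Rightarrow>\<^sub>0 nat) set)"
    by (rule card_mono[OF finite_exponents sub])
  have "card (chart_params d (i, j)) \<le> card (Inl ` (- {i}) :: ('n + 'n + ('n \<Rightarrow>\<^sub>0 nat)) set) +
      card ((Inr \<circ> Inl) ` (- {i, j}) :: ('n + 'n + ('n \<Rightarrow>\<^sub>0 nat)) set) +
      card ((Inr \<circ> Inr) ` (exponents d - degenerate_exponents d i j) :: ('n + 'n + ('n \<Rightarrow>\<^sub>0 nat)) set)"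
    unfolding chart_params_def prod.case
    by (intro order_trans[OF card_Un_le] add_mono order_refl)
  also have "\<dots> \<le> card (- {i}) + card (- {i, j}) + card (exponents d - degenerate_exponents d i j)"
    by (intro add_mono card_image_le) (auto simp: finite_exponents)
  also have "\<dots> = (CARD('n) - 1) + (CARD('n) - 2) +
      (card (exponents d :: ('n \<Rightarrow>\<^sub>0 nat) set) - card (degenerate_exponents d i j))"
    using assms sub by (simp add: Compl_eq_Diff_UNIV card_Diff_subset finite_subset[OF sub finite_exponents])
  finally show ?thesis using card_degenerate_exponents[OF assms] n le by linarith
qed

lemma chart_map_exists:
  fixes i j :: "'n::finite"
  assumes "i \<noteq> j"
  shows "\<exists>c. (\<forall>\<beta>. c \<beta> \<in> polyfun (chart_params d (i, j))) \<and>
    (\<forall>t y. (\<Sum>\<alpha>\<in>exponents d - degenerate_exponents d i j. t (Inr (Inr \<alpha>)) *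
        power_product \<alpha> (chart_inv i j (\<chi> k. t (Inl k)) (\<chi> k. t (Inr (Inl k))) y)) =
      (\<Sum>\<beta>\<in>exponents d. c \<beta> t * power_product \<beta> y))"
proof -
  define A where "A = polyfun (chart_params d (i, j))"
  have A: "function_algebra A" unfolding A_def by (rule function_algebra_polyfun)
  have x: "(\<lambda>t. - 1 * t (Inl k)) \<in> A" if "k \<noteq> i" for k
    using that unfolding A_def
    by (intro function_algebra_cmult function_algebra_polyfun polyfun_var) (simp add: chart_params_def)
  have v: "(\<lambda>t. - 1 * t (Inr (Inl k))) \<in> A" if "k \<noteq> i" "k \<noteq> j" for k
    using that unfolding A_def
    by (intro function_algebra_cmult function_algebra_polyfun polyfun_var) (auto simp: chart_params_def)
  have c: "(\<lambda>t. t (Inr (Inr \<alpha>))) \<in> A" if "\<alpha> \<in> exponents d - degenerate_exponents d i j" for \<alpha>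
    using that unfolding A_def by (intro polyfun_var) (auto simp: chart_params_def)
  \<comment> \<open>Thanks to the normalisation the inverse involves no division. It reads only the
    entries of x off i and those of v off i and j, which are precisely the chart parameters.\<close>
  have "form_family A 1 (\<lambda>t y. if k = i then y $ i else if k = j then y $ j + - 1 * t (Inl j) * y $ i
     else y $ k + - 1 * t (Inl k) * y $ i + - 1 * t (Inr (Inl k)) * (y $ j + - 1 * t (Inl j) * y $ i))" for k
  proof -
    consider "k = i" | "k \<noteq> i" "k = j" | "k \<noteq> i" "k \<noteq> j" by blast
    then show ?thesis
    proof cases
      case 1
      then show ?thesis using form_family_var[OF A] by simp
    next
      case 2
      have "form_family A 1 (\<lambda>t y. y $ j + - 1 * t (Inl j) * y $ i)"
        by (intro form_family_add form_family_cmult form_family_var A x) (use assms in simp)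
      then show ?thesis using 2 by simp
    next
      case 3
      have "form_family A 1 (\<lambda>t y. y $ k + - 1 * t (Inl k) * y $ i +
          - 1 * t (Inr (Inl k)) * (y $ j + - 1 * t (Inl j) * y $ i))"
        by (intro form_family_add form_family_cmult form_family_var A x v) (use assms 3 in simp_all)
      then show ?thesis using 3 by simp
    qed
  qed
  then have "form_family A d (\<lambda>t y. power_product \<alpha> (chart_inv i j (\<chi> k. t (Inl k)) (\<chi> k. t (Inr (Inl k))) y))"
    if "\<alpha> \<in> exponents d" for \<alpha>
    unfolding chart_inv_def vec_lambda_beta using that by (intro form_family_power_product A)
  then have "form_family A d (\<lambda>t y. \<Sum>\<alpha>\<in>exponents d - degenerate_exponents d i j. t (Inr (Inr \<alpha>)) *
        power_product \<alpha> (chart_inv i j (\<chi> k. t (Inl k)) (\<chi> k. t (Inr (Inl k))) y))"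
    by (intro form_family_sum form_family_cmult A c) auto
  then show ?thesis unfolding form_family_def A_def .
qed

text \<open>Each non-generic g is a form h without degenerate monomials composed with
  \<open>chart_inv\<close>. Expanding the composition gives coefficients polynomial in the
  parameters, and independence of power products identifies them with those of g.\<close>

lemma nongeneric_coeffs_covered_by_charts:
  assumes d: "even d" "d > 0"
  shows "\<exists>\<phi>. (\<forall>\<kappa>\<in>{(i :: 'n::finite, j). i \<noteq> j}. \<forall>\<beta>. (\<lambda>t. \<phi> \<kappa> t \<beta>) \<in> polyfun (chart_params d \<kappa>)) \<and>
    form_coeffs ` (nongeneric_boundary d :: 'n rpoly set) \<subseteq> (\<Union>\<kappa>\<in>{(i, j). i \<noteq> j}. range (\<phi> \<kappa>))"
proof -
  have "\<forall>\<kappa>\<in>{(i, j). i \<noteq> j}. \<exists>c. (\<forall>\<beta>. c \<beta> \<in> polyfun (chart_params d \<kappa>)) \<and>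
    (\<forall>t y. (\<Sum>\<alpha>\<in>exponents d - degenerate_exponents d (fst \<kappa>) (snd \<kappa>). t (Inr (Inr \<alpha>)) *
        power_product \<alpha> (chart_inv (fst \<kappa>) (snd \<kappa>) (\<chi> k. t (Inl k)) (\<chi> k. t (Inr (Inl k))) y)) =
      (\<Sum>\<beta>\<in>exponents d. c \<beta> t * power_product \<beta> (y :: real ^ 'n)))"
    using chart_map_exists[of _ _ d] by auto
  from bchoice[OF this] obtain c where c: "\<And>i j \<beta>. i \<noteq> j \<Longrightarrow> c (i, j) \<beta> \<in> polyfun (chart_params d (i, j))"
    "\<And>i j t y. i \<noteq> j \<Longrightarrow> (\<Sum>\<alpha>\<in>exponents d - degenerate_exponents d i j. t (Inr (Inr \<alpha>)) *
        power_product \<alpha> (chart_inv i j (\<chi> k. t (Inl k)) (\<chi> k. t (Inr (Inl k))) y)) =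
      (\<Sum>\<beta>\<in>exponents d. c (i, j) \<beta> t * power_product \<beta> (y :: real ^ 'n))"
    by fastforce
  \<comment> \<open>The value 0 outside \<open>exponents d\<close> agrees with
    \<open>form_coeffs\<close>, so the chart reaches the coefficient function itself and not just
    its restriction.\<close>
  define \<phi> where "\<phi> \<kappa> t \<beta> = (if \<beta> \<in> exponents d then c \<kappa> \<beta> t else 0)" for \<kappa> t \<beta>
  have "(\<lambda>t. \<phi> (i, j) t \<beta>) \<in> polyfun (chart_params d (i, j))" if "i \<noteq> j" for i j \<beta>
    using c(1)[OF that, of \<beta>] by (cases "\<beta> \<in> exponents d") (auto simp: \<phi>_def intro: polyfun_const)
  moreover have "form_coeffs g \<in> (\<Union>\<kappa>\<in>{(i, j). i \<noteq> j}. range (\<phi> \<kappa>))"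
    if gN: "g \<in> (nongeneric_boundary d :: 'n rpoly set)" for g
  proof -
    obtain x v where g: "g \<in> forms d" "\<And>y. form_fun g y \<ge> 0" "degenerate_zero g x v"
      using gN nongeneric_boundary_iff[OF d] by blast
    from nongeneric_form_in_chart[OF g] obtain i j x' v' h where h: "i \<noteq> j"
      "\<And>\<alpha>. \<alpha> \<in> degenerate_exponents d i j \<Longrightarrow> Poly_Mapping.lookup h \<alpha> = 0"
      "h \<in> forms d" "\<And>y. form_fun g y = form_fun h (chart_inv i j x' v' y)" by blast
    define t where "t = case_sum (vec_nth x') (case_sum (vec_nth v') (Poly_Mapping.lookup h))"
    have "(\<Sum>\<beta>\<in>exponents d. Poly_Mapping.lookup g \<beta> * power_product \<beta> y) =
        (\<Sum>\<beta>\<in>exponents d. c (i, j) \<beta> t * power_product \<beta> y)" for y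
    proof -
      have "(\<Sum>\<beta>\<in>exponents d. Poly_Mapping.lookup g \<beta> * power_product \<beta> y) = form_fun g y"
        by (simp add: form_fun_eq_sum[OF g(1)])
      also have "\<dots> = (\<Sum>\<alpha>\<in>exponents d. Poly_Mapping.lookup h \<alpha> * power_product \<alpha> (chart_inv i j x' v' y))"
        by (simp add: h(4) form_fun_eq_sum[OF h(3)])
      also have "\<dots> = (\<Sum>\<alpha>\<in>exponents d - degenerate_exponents d i j.
          Poly_Mapping.lookup h \<alpha> * power_product \<alpha> (chart_inv i j x' v' y))"
        by (rule sum.mono_neutral_right) (use h(2) in \<open>auto simp: finite_exponents\<close>)
      also have "\<dots> = (\<Sum>\<beta>\<in>exponents d. c (i, j) \<beta> t * power_product \<beta> y)"
        using c(2)[OF h(1), of t y] by (simp add: t_def)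
      finally show ?thesis .
    qed
    then have "Poly_Mapping.lookup g \<beta> = c (i, j) \<beta> t" if "\<beta> \<in> exponents d" for \<beta>
      using power_products_independent[where c = "Poly_Mapping.lookup g" and c' = "\<lambda>\<beta>. c (i, j) \<beta> t", OF _ that]
      by simp
    then have "form_coeffs g = \<phi> (i, j) t"
      using form_coeffs_in_coord_space[OF g(1)] by (auto simp: \<phi>_def fun_eq_iff form_coeffs_def coord_space_def)
    then show ?thesis using h(1) by blast
  qed
  ultimately show ?thesis by (intro exI[of _ \<phi>]) auto
qed

lemma codim_nongeneric_boundary:
  assumes d: "even d" "d \<ge> 2"
  shows "semialg_codim (exponents d) (form_coeffs ` (nongeneric_boundary d :: 'n::finite rpoly set)) \<ge> 2"
proof -
  let ?I = "exponents d :: ('n \<Rightarrow>\<^sub>0 nat) set"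
  let ?S = "form_coeffs ` (nongeneric_boundary d :: 'n rpoly set)"
  define K where "K = {(i, j :: 'n). i \<noteq> j}"
  have "even d" "d > 0" using d by auto
  from nongeneric_coeffs_covered_by_charts[OF this]
  obtain \<phi> where \<phi>: "\<And>\<kappa> \<beta>. \<kappa> \<in> K \<Longrightarrow> (\<lambda>t. \<phi> \<kappa> t \<beta>) \<in> polyfun (chart_params d \<kappa>)"
    "?S \<subseteq> (\<Union>\<kappa>\<in>K. range (\<phi> \<kappa>))"
    unfolding K_def by blast
  \<comment> \<open>Any k = N - 1 polynomials are dependent on charts with fewer than k parameters,
    so the dimension is at most k - 1 = N - 2. In one variable there are no pairs i, j, hence no
    charts and an empty set; then N = 1 and the bound reads -1.\<close>
  have "semialg_dim ?I ?S \<le> ereal (real (card ?I - 1) - 1)"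
  proof (rule semialg_dim_le)
    fix f :: "nat \<Rightarrow> ('n \<Rightarrow>\<^sub>0 nat) rpoly"
    show "\<exists>U c. finite U \<and> U \<subseteq> extensional {..<card ?I - 1} \<and> (\<exists>u\<in>U. c u \<noteq> (0::real)) \<and>
        (\<forall>s\<in>?S. (\<Sum>u\<in>U. c u * (\<Prod>l<card ?I - 1. rpoly_eval (f l) s ^ u l)) = 0)"
    proof (rule algebraically_dependent_on_charts[of K "chart_params d"])
      show "finite K" by simp
      show "finite (chart_params d \<kappa>) \<and> card (chart_params d \<kappa>) < card ?I - 1" if "\<kappa> \<in> K" for \<kappa>
        using that card_chart_params[OF _ d(2)] finite_chart_params by (auto simp: K_def)
      show "(\<lambda>t. rpoly_eval (f l) (\<phi> \<kappa> t)) \<in> polyfun (chart_params d \<kappa>)" if "\<kappa> \<in> K" for \<kappa> l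
        unfolding rpoly_eval_def
        by (intro function_algebra_sum function_algebra_cmult function_algebra_prod function_algebra_power
            function_algebra_polyfun \<phi>(1) that)
    qed (rule \<phi>(2))
  qed
  \<comment> \<open>Makes the natural number subtraction in \<open>card ?I - 1\<close> agree with
    the real one, also in the case N = 1.\<close>
  moreover have "card ?I \<ge> 1"
  proof -
    have "Poly_Mapping.single (undefined :: 'n) d \<in> ?I"
      by (simp add: exponents_def lookup_single when_def sum.delta)
    then show ?thesis using finite_exponents[of d, where 'n = 'n] by (simp add: Suc_le_eq card_gt_0_iff) blast
  qed
  ultimately have "ereal (real (card ?I)) - ereal (real (card ?I) - 2) \<le>
      ereal (real (card ?I)) - semialg_dim ?I ?S"
    by (intro ereal_minus_mono) (auto simp: of_nat_diff)
  then show ?thesis unfolding semialg_codim_def by simp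
qed

theorem proposition5p4:
  fixes d :: nat and N :: "'n::finite rpoly set"
  assumes "d \<ge> 2" and "even d"
    and N_def: "N = nongeneric_boundary d"
  shows "semialgebraic (exponents d) (form_coeffs ` N)
       \<and> semialg_codim (exponents d) (form_coeffs ` N) \<ge> 2
       \<and> nowhere_dense_in (subtopology (form_topology d) (pos_cone_boundary d)) N"
  unfolding N_def
  using semialgebraic_nongeneric_boundary[of d] codim_nongeneric_boundary[of d]
    nowhere_dense_nongeneric_boundary[of d] assms(1,2)
  by auto

end
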